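(* Let $p>0$ and $\tau\in(0,1)$, and for each $n$ let $k=[pn]$ and $\ell=[\tau n]$ (integer parts). Then $$\lim_{n\to\infty}\frac{1}{nk}\log\left\{k^{nk}\,\mathrm{Vol}^{(n)}_{k,\ell}\right\}=1+\log\sin(\pi\tau)-\log\pi .$$
   Context: $\mathbb{Z}_n=\mathbb{Z}/n\mathbb{Z}=\{0,\ldots,n-1\}$ and $\mathbb{T}_n=[0,1)\times\mathbb{Z}_n$ (string $h$ is $[0,1)\times\{h\}$); arithmetic on string labels is mod $n$. Bead configuration: for $k\ge1$, a collection of $nk$ distinct points of $\mathbb{T}_n$ with exactly $k$ points on each string such that for every $h\in\mathbb{Z}_n$, if $t_1<\cdots<t_k$ and $t_1'<\cdots<t_k'$ are the horizontal coordinates of the points on strings $h$ and $h+1$, then either $t_1\le t_1'<t_2\le t_2'<\cdots<t_k\le t_k'$ or $t_1'<t_1\le t_2'<t_2\le\cdots\le t_k'<t_k$. Occupation number: $\ell:=\#\{h\in\mathbb{Z}_n:\ \text{the smallest horizontal coordinate on string }h\text{ is strictly less than that on string }h-1\}$. Volumes: identify a bead configuration with the array $(t_{h,j})_{0\le h\le n-1,1\le j\le k}\in[0,1)^{nk}$, where $t_{h,j}$ is the horizontal coordinate of the $j$-th bead (in increasing order) on string $h$; $\mathrm{Vol}^{(n)}_{k,\ell}$ is the $nk$-dimensional Lebesgue measure of the set of arrays of bead configurations with $k$ beads per string and occupation number $\ell$. *)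

theory Defs
  imports "HOL-Analysis.Analysis"
begin

text \<open>
  A point \<open>(t, h)\<close> lies at horizontal coordinate \<open>t\<close> on string \<open>h\<close>; the label set of
  integers modulo \<open>n\<close> is represented by \<open>{..<n}\<close>.
\<close>

definition threaded_torus :: "nat \<Rightarrow> (real \<times> nat) set" where
  "threaded_torus n = {0..<1} \<times> {..<n}"

definition string_coords :: "(real \<times> nat) set \<Rightarrow> nat \<Rightarrow> real set" where
  "string_coords B h = {t. (t, h) \<in> B}"

text \<open>The beads on a string are numbered from 1, in increasing order.\<close>

definition bead_coord :: "(real \<times> nat) set \<Rightarrow> nat \<Rightarrow> nat \<Rightarrow> real" where
  "bead_coord B h j = sorted_list_of_set (string_coords B h) ! (j - 1)"

definition interlaced :: "nat \<Rightarrow> (nat \<Rightarrow> real) \<Rightarrow> (nat \<Rightarrow> real) \<Rightarrow> bool" where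
  "interlaced k t t' \<longleftrightarrow>
     (\<forall>j\<in>{1..k}. t j \<le> t' j) \<and> (\<forall>j\<in>{1..<k}. t' j < t (j + 1)) \<or>
     (\<forall>j\<in>{1..k}. t' j < t j) \<and> (\<forall>j\<in>{1..<k}. t j \<le> t' (j + 1))"

definition bead_configuration :: "nat \<Rightarrow> nat \<Rightarrow> (real \<times> nat) set \<Rightarrow> bool" where
  "bead_configuration n k B \<longleftrightarrow>
     k \<ge> 1 \<and> B \<subseteq> threaded_torus n \<and>
     (\<forall>h<n. card (string_coords B h) = k) \<and>
     (\<forall>h<n. interlaced k (bead_coord B h) (bead_coord B ((h + 1) mod n)))"

text \<open>
  The predecessor of \<open>h\<close> modulo \<open>n\<close> is written \<open>(h + n - 1) mod n\<close>
  because subtraction on \<open>nat\<close> truncates.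
\<close>

definition occupation_number :: "nat \<Rightarrow> (real \<times> nat) set \<Rightarrow> nat" where
  "occupation_number n B =
     card {h. h < n \<and> Min (string_coords B h) < Min (string_coords B ((h + n - 1) mod n))}"

definition bead_array :: "nat \<Rightarrow> nat \<Rightarrow> (real \<times> nat) set \<Rightarrow> nat \<times> nat \<Rightarrow> real" where
  "bead_array n k B = (\<lambda>(h, j)\<in>{..<n} \<times> {1..k}. bead_coord B h j)"

text \<open>
  The product of \<open>n * k\<close> copies of \<open>lborel\<close> is \<open>n * k\<close>-dimensional Lebesgue measure on the
  Borel sets; it is a measure on functions that are \<open>undefined\<close> outside the index set
  \<open>{..<n} \<times> {1..k}\<close>, as \<open>bead_array n k B\<close> is.
\<close>

definition bead_volume :: "nat \<Rightarrow> nat \<Rightarrow> nat \<Rightarrow> real" where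
  "bead_volume n k l =
     measure (Pi\<^sub>M ({..<n} \<times> {1..k}) (\<lambda>_. lborel))
       (bead_array n k ` {B. bead_configuration n k B \<and> occupation_number n B = l})"

end

theory Submission
  imports Defs "HOL-Real_Asymp.Real_Asymp"
begin

text \<open>
  Reading a bead configuration in the order of the horizontal coordinates turns it into a closed trajectory of
  \<open>l\<close> particles hopping without collisions on the ring of \<open>n\<close> sites, so the volume is the trace of the
  \<open>n * k\<close>-th power of the hopping matrix divided by \<open>(n * k)!\<close>. The Vandermonde function
  \<open>\<Prod> \<bar>sin (pi * (i - j) / n)\<bar>\<close> over pairs of occupied sites is a positive eigenvector with eigenvalue
  \<open>\<rho> = sin (pi * l / n) / sin (pi / n)\<close>. This bounds the trace by \<open>(n choose l) * \<rho> ^ (n * k)\<close>, which is the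
  upper bound.

  For the lower bound the eigenvector alone only controls the regime in which \<open>n\<close> is fixed and \<open>k\<close> tends to
  infinity, where trajectories can be closed up at bounded cost. Hence take a fixed ring of \<open>n0\<close> strings,
  discretise time into \<open>n0\<^sup>2 * k\<close> slots, and fix by pigeonhole the slots used on string 0; this costs only
  \<open>O (ln n0 / n0)\<close> per bead. Rings with the same string 0 can be cut open along it and placed side by side, and
  a proportion \<open>O (1 / n0)\<close> of explicit filler strings adjusts the number of strings and the occupation number.
  Finally \<open>n0\<close> tends to infinity.
\<close>

text \<open>The obstacle is that n and k grow together. For l of order n the values of
  \<open>ground\<close> on different states can differ by factors of order exp (c * n^2), and the
  number n * k of beads is itself only of order n^2, so comparing \<open>ground\<close> with
  constants would cost a fixed amount per bead. The upper bound avoids the comparison, because only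
  closed trajectories are counted and the value at their common end cancels; its factor n choose l
  \<le> 2^n costs ln 2 / k per bead. Slots replace Lebesgue measure by counting. Interlacing and
  occupation only compare beads on equal or neighbouring strings, so only these must lie in
  different slots; the blocks may share theirs, and the number of slots does not grow with the
  number of blocks. With n0^2 * k slots for n0 * k beads a share 1 / n0 is filled and discretisation
  costs little, while fixing the k slots of string 0 costs about 1 + 2 * ln n0 per bead of that
  string. Filler beads are placed in a single way and add no entropy; their small proportion keeps
  the resulting loss of order ln n0 / n0.\<close>

section \<open>A trigonometric identity\<close>

text \<open>Compare top coefficients in Lagrange's interpolation formula: the basis polynomials
  \<open>b z\<close> are monic of degree card Z - 1, and the interpolant \<open>q\<close> agrees
  with \<open>p\<close> at more points than the degree of a nonzero difference would allow.\<close>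

lemma lagrange_leading_coeff:
  fixes p :: "'a::field poly"
  assumes "finite Z" and "degree p < card Z"
  shows "(\<Sum>z\<in>Z. poly p z / (\<Prod>y\<in>Z - {z}. z - y)) = coeff p (card Z - 1)"
proof -
  define b where "b z = (\<Prod>y\<in>Z - {z}. [:- y, 1:])" for z
  define q where "q = (\<Sum>z\<in>Z. smult (poly p z / (\<Prod>y\<in>Z - {z}. z - y)) (b z))"
  have deg_b: "degree (b z) = card Z - 1" if "z \<in> Z" for z
  proof -
    have "degree (b z) = (\<Sum>y\<in>Z - {z}. degree [:- y, 1:])"
      unfolding b_def by (rule degree_prod_eq_sum_degree) auto
    then show ?thesis
      using that assms(1) by simp
  qed
  have monic_b: "coeff (b z) (card Z - 1) = 1" if "z \<in> Z" for z
    using deg_b[OF that] lead_coeff_prod[of "\<lambda>y. [:- y, 1:]" "Z - {z}"]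
    by (simp add: b_def)
  have poly_b: "poly (b z) x = (\<Prod>y\<in>Z - {z}. x - y)" for x z
    by (simp add: b_def poly_prod)
  have eq_on: "poly q x = poly p x" if x: "x \<in> Z" for x
  proof -
    have "poly q x = (\<Sum>z\<in>Z. if z = x then poly p x else 0)"
      unfolding q_def poly_sum
    proof (rule sum.cong)
      fix z assume z: "z \<in> Z"
      show "poly (smult (poly p z / (\<Prod>y\<in>Z - {z}. z - y)) (b z)) x = (if z = x then poly p x else 0)"
      proof (cases "z = x")
        case True
        have "(\<Prod>y\<in>Z - {x}. x - y) \<noteq> 0"
          using assms(1) by (simp add: prod_zero_iff)
        with True show ?thesis by (simp add: poly_b)
      next
        case False
        then have "(\<Prod>y\<in>Z - {z}. x - y) = 0"
          using assms(1) x by (intro prod_zero) auto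
        with False show ?thesis by (simp add: poly_b)
      qed
    qed simp
    then show ?thesis using x assms(1) by simp
  qed
  have "degree q \<le> card Z - 1"
    unfolding q_def by (intro degree_sum_le[OF assms(1)]) (metis deg_b degree_smult_le)
  then have "degree (q - p) < card Z"
    using assms(2) by (intro degree_diff_less) auto
  moreover have "card Z \<le> degree (q - p)" if "q - p \<noteq> 0"
  proof -
    have "Z \<subseteq> {x. poly (q - p) x = 0}"
      using eq_on by auto
    then have "card Z \<le> card {x. poly (q - p) x = 0}"
      using poly_roots_finite[OF that] by (intro card_mono)
    also have "\<dots> \<le> degree (q - p)"
      using that by (rule card_poly_roots_bound)
    finally show ?thesis .
  qed
  ultimately have "q = p" by fastforce
  then have "coeff p (card Z - 1) = coeff q (card Z - 1)" by simp
  also have "\<dots> = (\<Sum>z\<in>Z. poly p z / (\<Prod>y\<in>Z - {z}. z - y))"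
    unfolding q_def coeff_sum coeff_smult by (intro sum.cong refl) (metis monic_b mult.right_neutral)
  finally show ?thesis ..
qed

text \<open>This is a Lagrange sum for the polynomial \<open>G\<close> with x * G x = prod (q * x -
  y) - prod (x - y), the products running over y in Z. The right side vanishes at 0, its coefficient
  of degree card Z is q ^ card Z - 1, and at a point of Z only the first product survives.\<close>

lemma sum_prod_q_ratio:
  fixes q :: "'a::field"
  assumes "finite Z" and "0 \<notin> Z"
  shows "(q - 1) * (\<Sum>z\<in>Z. \<Prod>y\<in>Z - {z}. (q * z - y) / (z - y)) = q ^ card Z - 1"
proof (cases "Z = {}")
  case False
  define P where "P = (\<Prod>y\<in>Z. [:- y, q:]) - (\<Prod>y\<in>Z. [:- y, 1:])"
  have "poly P 0 = 0" by (simp add: P_def poly_prod)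
  then obtain G where G: "P = [:0, 1:] * G"
    by (metis dvd_def minus_zero poly_eq_0_iff_dvd)
  have card_pos: "card Z > 0" using assms(1) False by (simp add: card_gt_0_iff)
  have coeff_prod: "degree (\<Prod>y\<in>Y. [:- y, c:]) \<le> card Y \<and> coeff (\<Prod>y\<in>Y. [:- y, c:]) (card Y) = c ^ card Y"
    if "finite Y" for Y and c :: 'a
    using that
  proof induction
    case (insert x F)
    then show ?case
      using degree_mult_le[of "[:- x, c:]" "\<Prod>y\<in>F. [:- y, c:]"] 
      by (auto simp: coeff_eq_0 le_degree split: if_splits intro: order.trans[OF degree_add_le_max] order.trans[OF degree_smult_le] order.trans[OF degree_pCons_le])
  qed simp
  have deg_P: "degree P \<le> card Z"
    unfolding P_def using coeff_prod[OF assms(1)] by (intro degree_diff_le) auto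
  have coeff_P: "coeff P (card Z) = q ^ card Z - 1"
    using coeff_prod[OF assms(1), of q] coeff_prod[OF assms(1), of 1] by (simp add: P_def)
  have P_eq: "P = pCons 0 G" using G by simp
  have deg_G: "degree G < card Z"
  proof (cases "G = 0")
    case True then show ?thesis using card_pos by simp
  next
    case False then show ?thesis using deg_P P_eq by simp
  qed
  have coeff_G: "coeff G (card Z - 1) = q ^ card Z - 1"
    using coeff_P P_eq card_pos by (cases "card Z") auto
  have poly_G: "poly G z = (q - 1) * (\<Prod>y\<in>Z - {z}. q * z - y)" if z: "z \<in> Z" for z
  proof -
    have "z * poly G z = poly P z" by (simp add: G)
    also have "\<dots> = (\<Prod>y\<in>Z. q * z - y) - (\<Prod>y\<in>Z. z - y)"
      by (simp add: P_def poly_prod algebra_simps)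
    also have "(\<Prod>y\<in>Z. z - y) = 0"
      using assms(1) z by (intro prod_zero) auto
    also have "(\<Prod>y\<in>Z. q * z - y) = (q * z - z) * (\<Prod>y\<in>Z - {z}. q * z - y)"
      using assms(1) z by (simp add: prod.remove)
    finally have "z * poly G z = z * ((q - 1) * (\<Prod>y\<in>Z - {z}. q * z - y))"
      by (simp add: algebra_simps)
    then show ?thesis using z assms(2) by auto
  qed
  have "(q - 1) * (\<Sum>z\<in>Z. \<Prod>y\<in>Z - {z}. (q * z - y) / (z - y))
      = (\<Sum>z\<in>Z. poly G z / (\<Prod>y\<in>Z - {z}. z - y))"
    unfolding sum_distrib_left by (intro sum.cong) (auto simp: poly_G prod_dividef)
  then show ?thesis
    using lagrange_leading_coeff[OF assms(1) deg_G] coeff_G by simp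
qed simp

section \<open>From roots of unity to sines\<close>

lemma cis_double_minus_one: "cis (2 * x) - 1 = 2 * \<i> * cis x * complex_of_real (sin x)"
  using cos_double_sin[of x] sin_double[of x]
  by (intro complex_eqI) (simp_all add: power2_eq_square)

lemma sin_ratio_eq_cis:
  fixes a d :: real
  assumes "sin a \<noteq> 0"
  shows "complex_of_real (sin (a + d) / sin a)
    = cis (- d) * ((cis (2 * d) * cis (2 * a) - 1) / (cis (2 * a) - 1))"
proof -
  have "cis (2 * d) * cis (2 * a) - 1 = 2 * \<i> * cis (a + d) * complex_of_real (sin (a + d))"
    using cis_double_minus_one[of "a + d"] by (simp add: cis_mult algebra_simps)
  moreover have "cis (a + d) = cis a * cis d" by (simp add: cis_mult)
  moreover have "cis (- d) * cis d = 1" by (simp add: cis_mult)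
  moreover have "cis a \<noteq> 0" by simp
  ultimately show ?thesis
    using assms cis_double_minus_one[of a] by (simp add: field_simps)
qed

lemma sin_pi_frac_pos:
  assumes "0 < i" and "i < n"
  shows "sin (pi * real i / real n) > 0"
  using assms by (intro sin_gt_zero) (auto simp: field_simps)

lemma sin_diff_frac_nonzero:
  assumes "i < n" and "j < n" and "i \<noteq> j"
  shows "sin (pi * (real i - real j) / real n) \<noteq> 0"
proof (cases "j < i")
  case True
  then show ?thesis
    using sin_pi_frac_pos[of "i - j" n] assms by (force simp: of_nat_diff)
next
  case False
  moreover have "pi * (real i - real j) / real n = - (pi * (real j - real i) / real n)"
    by (simp add: algebra_simps diff_divide_distrib)
  ultimately show ?thesis
    using sin_pi_frac_pos[of "j - i" n] assms by (force simp: of_nat_diff)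
qed

text \<open>Put particle j at the root of unity z j = cis (2 * pi * j / n). A hop multiplies z p by
  \<open>q\<close>, and each sine ratio is the ratio of \<open>sum_prod_q_ratio\<close> times the
  phase cis (- pi / n). The phases collected from the card X - 1 factors turn (q ^ card X - 1) / (q
  - 1) into a quotient of sines.\<close>

lemma sum_prod_sin_ratio:
  assumes "X \<subseteq> {..<n}" and "n \<ge> 2"
  shows "(\<Sum>p\<in>X. \<Prod>j\<in>X - {p}. sin (pi * (real p + 1 - real j) / real n) / sin (pi * (real p - real j) / real n))
    = sin (pi * real (card X) / real n) / sin (pi / real n)"
proof (cases "X = {}")
  case False
  define \<delta> where "\<delta> = pi / real n"
  define z where "z j = cis (2 * \<delta> * real j)" for j :: nat
  define q where "q = cis (2 * \<delta>)"
  have fin: "finite X" using assms(1) finite_subset by blast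
  have card_pos: "card X > 0" using fin False by (simp add: card_gt_0_iff)
  have sin_d: "sin \<delta> > 0"
    using sin_pi_frac_pos[of 1 n] assms(2) by (simp add: \<delta>_def)
  have sin_nz: "sin (\<delta> * (real i - real j)) \<noteq> 0" if "i \<in> X" "j \<in> X" "i \<noteq> j" for i j
    using sin_diff_frac_nonzero[of i n j] that assms(1) by (auto simp: \<delta>_def field_simps)
  note cis_m1 = cis_double_minus_one
  have z_div: "z i / z j = cis (2 * (\<delta> * (real i - real j)))" for i j
    by (simp add: z_def cis_divide algebra_simps)
  have z_neq: "z i \<noteq> z j" if "i \<in> X" "j \<in> X" "i \<noteq> j" for i j
  proof
    assume "z i = z j"
    then have "cis (2 * (\<delta> * (real i - real j))) = 1"
      using z_div[of i j] by (simp add: z_def)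
    then show False using cis_m1[of "\<delta> * (real i - real j)"] sin_nz[OF that] by simp
  qed
  have inj: "inj_on z X" using z_neq by (meson inj_onI)
  have factor: "complex_of_real (sin (pi * (real p + 1 - real j) / real n) / sin (pi * (real p - real j) / real n))
      = cis (- \<delta>) * ((q * z p - z j) / (z p - z j))" if "p \<in> X" "j \<in> X" "p \<noteq> j" for p j
  proof -
    define a where "a = \<delta> * (real p - real j)"
    have "complex_of_real (sin (a + \<delta>) / sin a)
       = cis (- \<delta>) * ((cis (2 * \<delta>) * cis (2 * a) - 1) / (cis (2 * a) - 1))"
      using sin_nz[OF that] by (intro sin_ratio_eq_cis) (simp add: a_def)
    moreover have "cis (2 * a) = z p / z j" by (simp add: z_div a_def)
    moreover have "z j \<noteq> 0" by (simp add: z_def)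
    moreover have "pi * (real p + 1 - real j) / real n = a + \<delta>" "pi * (real p - real j) / real n = a"
      by (simp_all add: a_def \<delta>_def algebra_simps add_divide_distrib diff_divide_distrib)
    moreover have "z p = z j * cis (2 * a)"
      using \<open>cis (2 * a) = z p / z j\<close> \<open>z j \<noteq> 0\<close> by simp
    then have "q * z p - z j = z j * (q * cis (2 * a) - 1)" "z p - z j = z j * (cis (2 * a) - 1)"
      by (simp_all add: algebra_simps)
    ultimately show ?thesis by (simp add: q_def)
  qed
  define T where "T = (\<Sum>p\<in>X. \<Prod>j\<in>X - {p}. sin (pi * (real p + 1 - real j) / real n) / sin (pi * (real p - real j) / real n))"
  have "complex_of_real T = (\<Sum>p\<in>X. \<Prod>j\<in>X - {p}. cis (- \<delta>) * ((q * z p - z j) / (z p - z j)))"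
    unfolding T_def of_real_sum of_real_prod
    by (intro sum.cong prod.cong refl factor) auto
  also have "\<dots> = (\<Sum>p\<in>X. cis (- \<delta>) ^ (card X - 1) * (\<Prod>j\<in>X - {p}. (q * z p - z j) / (z p - z j)))"
    using fin by (intro sum.cong refl) (simp only: prod.distrib prod_constant card_Diff_singleton)
  also have "\<dots> = cis (- \<delta>) ^ (card X - 1) * (\<Sum>p\<in>X. \<Prod>j\<in>X - {p}. (q * z p - z j) / (z p - z j))"
    by (simp add: sum_distrib_left)
  also have "(\<Sum>p\<in>X. \<Prod>j\<in>X - {p}. (q * z p - z j) / (z p - z j))
      = (\<Sum>w\<in>z ` X. \<Prod>y\<in>z ` X - {w}. (q * w - y) / (w - y))"
  proof -
    have "(\<Sum>w\<in>z ` X. \<Prod>y\<in>z ` X - {w}. (q * w - y) / (w - y))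
        = (\<Sum>p\<in>X. \<Prod>y\<in>z ` X - {z p}. (q * z p - y) / (z p - y))"
      by (simp add: sum.reindex[OF inj])
    also have "\<dots> = (\<Sum>p\<in>X. \<Prod>j\<in>X - {p}. (q * z p - z j) / (z p - z j))"
    proof (rule sum.cong)
      fix p assume p: "p \<in> X"
      have "z ` X - {z p} = z ` (X - {p})" using inj p by (auto simp: inj_on_def)
      moreover have "inj_on z (X - {p})" using inj by (rule inj_on_subset) auto
      ultimately show "(\<Prod>y\<in>z ` X - {z p}. (q * z p - y) / (z p - y)) = (\<Prod>j\<in>X - {p}. (q * z p - z j) / (z p - z j))"
        by (simp add: prod.reindex)
    qed simp
    finally show ?thesis ..
  qed
  finally have T_eq: "complex_of_real T = cis (- \<delta>) ^ (card X - 1) * (\<Sum>w\<in>z ` X. \<Prod>y\<in>z ` X - {w}. (q * w - y) / (w - y))" .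
  have "(q - 1) * (\<Sum>w\<in>z ` X. \<Prod>y\<in>z ` X - {w}. (q * w - y) / (w - y)) = q ^ card X - 1"
  proof -
    have "0 \<notin> z ` X" by (metis cis_neq_zero imageE z_def)
    then show ?thesis
      using sum_prod_q_ratio[of "z ` X" q] fin card_image[OF inj] by simp
  qed
  then have "(q - 1) * complex_of_real T = cis (- \<delta>) ^ (card X - 1) * (q ^ card X - 1)"
    unfolding T_eq by (simp only: mult.left_commute[of "q - 1"])
  moreover have "q ^ card X = cis (2 * (\<delta> * real (card X)))"
    by (simp add: q_def Complex.DeMoivre algebra_simps)
  moreover have "cis (- \<delta>) ^ (card X - 1) = cis \<delta> * cis (- (\<delta> * real (card X)))"
    using card_pos by (simp add: Complex.DeMoivre cis_mult of_nat_diff algebra_simps)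
  ultimately have "2 * \<i> * cis \<delta> * complex_of_real (sin \<delta>) * complex_of_real T
     = cis \<delta> * cis (- (\<delta> * real (card X))) * (2 * \<i> * cis (\<delta> * real (card X)) * complex_of_real (sin (\<delta> * real (card X))))"
    using cis_m1[of \<delta>] cis_m1[of "\<delta> * real (card X)"] by (simp add: q_def)
  also have "\<dots> = 2 * \<i> * cis \<delta> * complex_of_real (sin (\<delta> * real (card X)))
      * (cis (- (\<delta> * real (card X))) * cis (\<delta> * real (card X)))"
    by (simp only: ac_simps)
  also have "\<dots> = 2 * \<i> * cis \<delta> * complex_of_real (sin (\<delta> * real (card X)))"
    by (simp add: cis_mult)
  finally have "(2 * \<i> * cis \<delta>) * complex_of_real (sin \<delta> * T) = (2 * \<i> * cis \<delta>) * complex_of_real (sin (\<delta> * real (card X)))"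
    by (simp add: algebra_simps)
  then have "complex_of_real (sin \<delta> * T) = complex_of_real (sin (\<delta> * real (card X)))"
    unfolding mult_cancel_left by simp
  then have "sin \<delta> * T = sin (\<delta> * real (card X))"
    using of_real_eq_iff by blast
  then show ?thesis
    using sin_d unfolding T_def[symmetric] by (simp add: \<delta>_def field_simps)
qed simp

section \<open>Hopping particles on a ring\<close>

text \<open>
  Site \<open>h\<close> of the ring stands for the pair of strings \<open>h\<close> and \<open>h + 1\<close>; it is occupied when the next bead of the
  pair has to be on string \<open>h + 1\<close>. A bead on string \<open>h\<close> then moves a particle from site \<open>h - 1\<close> to site \<open>h\<close>.
\<close>

definition pred_string :: "nat \<Rightarrow> nat \<Rightarrow> nat" where
  "pred_string n h = (h + n - 1) mod n"

definition movable :: "nat \<Rightarrow> nat set \<Rightarrow> nat set" where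
  "movable n X = {h. h < n \<and> pred_string n h \<in> X \<and> h \<notin> X}"

definition jump :: "nat \<Rightarrow> nat \<Rightarrow> nat set \<Rightarrow> nat set" where
  "jump n h X = insert h (X - {pred_string n h})"

text \<open>Half the distance between the n-th roots of unity with numbers i and j.\<close>

definition chord :: "nat \<Rightarrow> nat \<Rightarrow> nat \<Rightarrow> real" where
  "chord n i j = \<bar>sin (pi * (real i - real j) / real n)\<bar>"

text \<open>Every unordered pair occurs twice, hence the square root; in this form no ordering of X
  has to be chosen.\<close>

definition ground :: "nat \<Rightarrow> nat set \<Rightarrow> real" where
  "ground n X = sqrt (\<Prod>i\<in>X. \<Prod>j\<in>X - {i}. chord n i j)"

definition top_eigenvalue :: "nat \<Rightarrow> nat \<Rightarrow> real" where
  "top_eigenvalue n l = sin (pi * real l / real n) / sin (pi / real n)"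

section \<open>Arithmetic of the ring\<close>

lemma pred_string_eq: "h < n \<Longrightarrow> pred_string n h = (if h = 0 then n - 1 else h - 1)"
  by (auto simp: pred_string_def mod_if)

lemma pred_string_less: "h < n \<Longrightarrow> pred_string n h < n"
  by (auto simp: pred_string_def)

lemma succ_string_eq:
  fixes h n :: nat
  assumes "h < n"
  shows "(h + 1) mod n = (if h = n - 1 then 0 else h + 1)"
proof (cases "h = n - 1")
  case True
  with assms have "h + 1 = n" by arith
  with True show ?thesis by simp
next
  case False
  with assms have "h + 1 < n" by arith
  with False show ?thesis by simp
qed

lemma pred_string_eq_iff:
  assumes "h < n" and "i < n"
  shows "pred_string n h = i \<longleftrightarrow> h = (i + 1) mod n"
  using assms by (auto simp: pred_string_eq mod_Suc split: if_splits)

lemma pred_succ_string: "h < n \<Longrightarrow> pred_string n (Suc h mod n) = h"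
  by (simp add: pred_string_eq_iff)

lemma succ_pred_string: "h < n \<Longrightarrow> (pred_string n h + 1) mod n = h"
  by (metis pred_string_eq_iff pred_string_less)

lemma pred_string_neq: "h < n \<Longrightarrow> n \<ge> 2 \<Longrightarrow> pred_string n h \<noteq> h"
  by (auto simp: pred_string_eq)

lemma jump_subset: "X \<subseteq> {..<n} \<Longrightarrow> h \<in> movable n X \<Longrightarrow> jump n h X \<subseteq> {..<n}"
  by (auto simp: movable_def jump_def)

lemma card_jump:
  assumes "X \<subseteq> {..<n}" and "h \<in> movable n X"
  shows "card (jump n h X) = card X"
proof -
  have "finite X" using assms(1) finite_subset by blast
  moreover have "pred_string n h \<in> X" "h \<notin> X" using assms(2) by (simp_all add: movable_def)
  ultimately show ?thesis
    using card_Suc_Diff1[of X "pred_string n h"] by (simp add: jump_def)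
qed

section \<open>The Vandermonde function as an eigenvector\<close>

lemma chord_commute: "chord n i j = chord n j i"
proof -
  have "pi * (real i - real j) / real n = - (pi * (real j - real i) / real n)"
    by (simp add: algebra_simps diff_divide_distrib)
  then show ?thesis by (simp add: chord_def)
qed

lemma chord_pos: "i < n \<Longrightarrow> j < n \<Longrightarrow> i \<noteq> j \<Longrightarrow> chord n i j > 0"
  using sin_diff_frac_nonzero by (simp add: chord_def)

lemma ground_pos:
  assumes "X \<subseteq> {..<n}"
  shows "ground n X > 0"
proof -
  have "(\<Prod>i\<in>X. \<Prod>j\<in>X - {i}. chord n i j) > 0"
    using assms by (intro prod_pos ballI chord_pos) auto
  then show ?thesis by (simp add: ground_def)
qed

lemma ground_le_1: "ground n X \<le> 1"
proof -
  have "(\<Prod>i\<in>X. \<Prod>j\<in>X - {i}. chord n i j) \<le> 1"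
    by (intro prod_le_1) (auto intro!: prod_le_1 prod_nonneg simp: chord_def)
  then show ?thesis by (simp add: ground_def)
qed

lemma ground_insert:
  assumes "finite Y" and "p \<notin> Y"
  shows "ground n (insert p Y) = ground n Y * (\<Prod>j\<in>Y. chord n p j)"
proof -
  have "(\<Prod>i\<in>insert p Y. \<Prod>j\<in>insert p Y - {i}. chord n i j)
      = (\<Prod>j\<in>Y. chord n p j) * (\<Prod>i\<in>Y. \<Prod>j\<in>insert p Y - {i}. chord n i j)"
    using assms by simp
  also have "(\<Prod>i\<in>Y. \<Prod>j\<in>insert p Y - {i}. chord n i j) = (\<Prod>i\<in>Y. chord n p i * (\<Prod>j\<in>Y - {i}. chord n i j))"
  proof (rule prod.cong)
    fix i assume "i \<in> Y"
    with assms have "insert p Y - {i} = insert p (Y - {i})" by auto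
    with assms show "(\<Prod>j\<in>insert p Y - {i}. chord n i j) = chord n p i * (\<Prod>j\<in>Y - {i}. chord n i j)"
      by (simp add: chord_commute)
  qed simp
  finally have "(\<Prod>i\<in>insert p Y. \<Prod>j\<in>insert p Y - {i}. chord n i j)
      = (\<Prod>j\<in>Y. chord n p j)\<^sup>2 * (\<Prod>i\<in>Y. \<Prod>j\<in>Y - {i}. chord n i j)"
    by (simp add: prod.distrib power2_eq_square)
  moreover have "(\<Prod>j\<in>Y. chord n p j) \<ge> 0"
    by (intro prod_nonneg) (simp add: chord_def)
  ultimately show ?thesis
    by (simp add: ground_def real_sqrt_mult)
qed

text \<open>At p = n - 1 the angle on the right exceeds the one in \<open>chord n 0 j\<close> by pi,
  which changes only the sign of the sine. So a hop can be computed with p + 1 unreduced, as the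
  trigonometric identity requires.\<close>

lemma chord_succ:
  assumes "p < n"
  shows "chord n ((p + 1) mod n) j = \<bar>sin (pi * (real p + 1 - real j) / real n)\<bar>"
proof (cases "p = n - 1")
  case True
  then have "pi * (real p + 1 - real j) / real n = pi * (real 0 - real j) / real n + pi"
    using assms by (simp add: of_nat_diff algebra_simps add_divide_distrib diff_divide_distrib)
  then have "\<bar>sin (pi * (real p + 1 - real j) / real n)\<bar> = chord n 0 j"
    by (simp add: chord_def)
  with True assms show ?thesis by simp
next
  case False
  with assms show ?thesis by (simp add: chord_def succ_string_eq add.commute)
qed

lemma sin_frac_nonneg:
  assumes "0 \<le> x" and "x \<le> real n"
  shows "sin (pi * x / real n) \<ge> 0"
proof (cases "n = 0")
  case False
  with assms show ?thesis
    by (intro sin_ge_zero) (simp_all add: divide_le_eq)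
qed simp

text \<open>In one step from p a particle can reach another site j but not pass it, so the sine does
  not change sign. This lets the signed ratios of the trigonometric identity stand for ratios of
  chords.\<close>

lemma sin_ratio_nonneg:
  assumes "p < n" and "j < n" and "j \<noteq> p"
  shows "sin (pi * (real p + 1 - real j) / real n) / sin (pi * (real p - real j) / real n) \<ge> 0"
proof (cases "j < p")
  case True
  then show ?thesis using assms by (intro divide_nonneg_nonneg sin_frac_nonneg) auto
next
  case False
  then have "sin (pi * (real j - real p - 1) / real n) / sin (pi * (real j - real p) / real n) \<ge> 0"
    using assms by (intro divide_nonneg_nonneg sin_frac_nonneg) auto
  moreover have "pi * (real p + 1 - real j) / real n = - (pi * (real j - real p - 1) / real n)"
    "pi * (real p - real j) / real n = - (pi * (real j - real p) / real n)"
    by (simp_all add: algebra_simps diff_divide_distrib add_divide_distrib)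
  ultimately show ?thesis by simp
qed

lemma ground_jump:
  assumes X: "X \<subseteq> {..<n}" and h: "h \<in> movable n X" and p: "p = pred_string n h"
  shows "ground n (jump n h X) = ground n X *
    (\<Prod>j\<in>X - {p}. sin (pi * (real p + 1 - real j) / real n) / sin (pi * (real p - real j) / real n))"
proof -
  define Y where "Y = X - {p}"
  have "finite Y" using X finite_subset by (auto simp: Y_def)
  have pX: "p \<in> X" "p < n" and hn: "h < n" "h \<notin> X"
    using h X by (auto simp: movable_def p)
  have h_eq: "h = (p + 1) mod n" using succ_pred_string[OF hn(1)] p by simp
  have "ground n (jump n h X) = ground n Y * (\<Prod>j\<in>Y. chord n h j)"
    using ground_insert[OF \<open>finite Y\<close>, of h n] hn by (simp add: jump_def Y_def p)
  moreover have "insert p Y = X" using pX by (auto simp: Y_def)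
  then have "ground n X = ground n Y * (\<Prod>j\<in>Y. chord n p j)"
    using ground_insert[OF \<open>finite Y\<close>, of p n] by (simp add: Y_def)
  moreover have "(\<Prod>j\<in>Y. chord n h j) = (\<Prod>j\<in>Y. chord n p j) *
      (\<Prod>j\<in>Y. sin (pi * (real p + 1 - real j) / real n) / sin (pi * (real p - real j) / real n))"
    unfolding prod.distrib[symmetric]
  proof (rule prod.cong)
    fix j assume j: "j \<in> Y"
    then have jn: "j < n" "j \<noteq> p" using X by (auto simp: Y_def)
    have "chord n p j > 0" using jn pX by (intro chord_pos) auto
    moreover have "sin (pi * (real p + 1 - real j) / real n) / sin (pi * (real p - real j) / real n)
        = chord n h j / chord n p j"
      using sin_ratio_nonneg[OF pX(2) jn] chord_succ[OF pX(2), of j]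
      by (metis abs_divide abs_of_nonneg chord_def h_eq)
    ultimately show "chord n h j = chord n p j * (sin (pi * (real p + 1 - real j) / real n) / sin (pi * (real p - real j) / real n))"
      by simp
  qed simp
  ultimately show ?thesis by (simp add: Y_def)
qed

text \<open>The trigonometric identity sums over all particles, while only unblocked ones can hop.
  The terms of blocked particles vanish: the factor of the particle directly ahead is sin 0, or sin
  pi across the end of the ring.\<close>

lemma ground_eigen:
  assumes X: "X \<subseteq> {..<n}" and n: "n \<ge> 2"
  shows "(\<Sum>h\<in>movable n X. ground n (jump n h X)) = top_eigenvalue n (card X) * ground n X"
proof -
  define w where "w p = (\<Prod>j\<in>X - {p}. sin (pi * (real p + 1 - real j) / real n) / sin (pi * (real p - real j) / real n))" for p
  have finX: "finite X" using X finite_subset by blast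
  have zero: "w p = 0" if p: "p \<in> X" "(p + 1) mod n \<in> X" for p
  proof -
    have pn: "p < n" using X p by auto
    have "(p + 1) mod n \<noteq> p" using succ_string_eq[OF pn] pn n by (simp split: if_splits)
    moreover have "sin (pi * (real p + 1 - real ((p + 1) mod n)) / real n) = 0"
      using pn unfolding succ_string_eq[OF pn] by (auto simp: of_nat_diff)
    ultimately show ?thesis unfolding w_def
      using finX p by (intro prod_zero bexI[of _ "(p + 1) mod n"]) auto
  qed
  have inj: "inj_on (pred_string n) (movable n X)"
    by (intro inj_onI) (metis (mono_tags, lifting) mem_Collect_eq movable_def succ_pred_string)
  have img: "pred_string n ` movable n X = {p \<in> X. (p + 1) mod n \<notin> X}"
  proof (intro equalityI subsetI)
    fix p assume p: "p \<in> {p \<in> X. (p + 1) mod n \<notin> X}"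
    then have "p < n" using X by auto
    with p have "(p + 1) mod n \<in> movable n X" "pred_string n ((p + 1) mod n) = p"
      by (simp_all add: movable_def pred_succ_string)
    then show "p \<in> pred_string n ` movable n X" by (metis imageI)
  qed (use succ_pred_string in \<open>auto simp: movable_def\<close>)
  have "(\<Sum>h\<in>movable n X. ground n (jump n h X)) = (\<Sum>h\<in>movable n X. ground n X * w (pred_string n h))"
    by (intro sum.cong refl) (simp add: ground_jump[OF X _ refl] w_def)
  also have "\<dots> = (\<Sum>p\<in>{p \<in> X. (p + 1) mod n \<notin> X}. ground n X * w p)"
    unfolding img[symmetric] by (simp add: sum.reindex[OF inj])
  also have "\<dots> = (\<Sum>p\<in>X. ground n X * w p)"
    using finX zero by (intro sum.mono_neutral_left) auto
  also have "\<dots> = ground n X * top_eigenvalue n (card X)"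
    using sum_prod_sin_ratio[OF X n] by (simp add: w_def top_eigenvalue_def flip: sum_distrib_left)
  finally show ?thesis by simp
qed

text \<open>A word records in each time slot the string carrying a bead; the letter \<open>n\<close> marks an empty slot.\<close>

fun legal :: "nat \<Rightarrow> nat set \<Rightarrow> nat list \<Rightarrow> bool" where
  "legal n X [] \<longleftrightarrow> True"
| "legal n X (a # v) \<longleftrightarrow>
     (if a < n then a \<in> movable n X \<and> legal n (jump n a X) v else a = n \<and> legal n X v)"

fun final :: "nat \<Rightarrow> nat set \<Rightarrow> nat list \<Rightarrow> nat set" where
  "final n X [] = X"
| "final n X (a # v) = final n (if a < n then jump n a X else X) v"

definition jumps :: "nat \<Rightarrow> nat list \<Rightarrow> nat" where
  "jumps n v = length (filter (\<lambda>a. a < n) v)"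

definition words :: "nat \<Rightarrow> nat \<Rightarrow> nat \<Rightarrow> nat set \<Rightarrow> nat list set" where
  "words n M N X = {v. length v = M \<and> jumps n v = N \<and> legal n X v}"

lemma finite_movable [simp]: "finite (movable n X)"
  by (simp add: movable_def)

lemma words_0: "words n 0 N X = (if N = 0 then {[]} else {})"
  by (auto simp: words_def jumps_def)

lemma words_Suc:
  "words n (Suc M) N X = (#) n ` words n M N X \<union>
    (if N = 0 then {} else (\<Union>h\<in>movable n X. (#) h ` words n M (N - 1) (jump n h X)))"
  (is "?L = ?R")
proof (intro equalityI subsetI)
  fix v assume v: "v \<in> ?L"
  then obtain a w where "v = a # w" by (auto simp: words_def length_Suc_conv)
  show "v \<in> ?R"
  proof (cases "a < n")
    case True
    then have "a \<in> movable n X" "w \<in> words n M (N - 1) (jump n a X)" "N \<noteq> 0"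
      using v \<open>v = a # w\<close> by (auto simp: words_def jumps_def)
    then show ?thesis unfolding \<open>v = a # w\<close> by auto
  next
    case False
    then have "a = n" "w \<in> words n M N X"
      using v \<open>v = a # w\<close> by (auto simp: words_def jumps_def)
    then show ?thesis unfolding \<open>v = a # w\<close> by blast
  qed
next
  fix v assume "v \<in> ?R"
  then show "v \<in> ?L" by (auto simp: words_def jumps_def movable_def split: if_splits)
qed

lemma finite_words [simp]: "finite (words n M N X)"
  by (induction M arbitrary: N X) (auto simp: words_0 words_Suc)

text \<open>The first slot is empty or holds a hop. Hops contribute one eigenvalue by
  \<open>ground_eigen\<close>, and Pascal's rule adds the two cases.\<close>

lemma sum_ground_words:
  assumes "X \<subseteq> {..<n}" and "n \<ge> 2"
  shows "(\<Sum>v\<in>words n M N X. ground n (final n X v))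
    = real (M choose N) * top_eigenvalue n (card X) ^ N * ground n X"
  using assms(1)
proof (induction M arbitrary: N X)
  case 0
  then show ?case by (auto simp: words_0)
next
  case (Suc M)
  have rest: "(\<Sum>v\<in>(#) n ` words n M N X. ground n (final n X v))
     = real (M choose N) * top_eigenvalue n (card X) ^ N * ground n X"
    using Suc by (simp add: sum.reindex)
  show ?case
  proof (cases N)
    case 0
    with rest show ?thesis by (simp add: words_Suc)
  next
    case (Suc N')
    have "(\<Sum>v\<in>(\<Union>h\<in>movable n X. (#) h ` words n M N' (jump n h X)). ground n (final n X v))
       = (\<Sum>h\<in>movable n X. \<Sum>v\<in>(#) h ` words n M N' (jump n h X). ground n (final n X v))"
      by (intro sum.UNION_disjoint) auto
    also have "\<dots> = (\<Sum>h\<in>movable n X. \<Sum>v\<in>words n M N' (jump n h X). ground n (final n (jump n h X) v))"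
    proof (rule sum.cong)
      fix h assume "h \<in> movable n X"
      then have "h < n" by (simp add: movable_def)
      then show "(\<Sum>v\<in>(#) h ` words n M N' (jump n h X). ground n (final n X v))
          = (\<Sum>v\<in>words n M N' (jump n h X). ground n (final n (jump n h X) v))"
        by (simp add: sum.reindex)
    qed simp
    also have "\<dots> = (\<Sum>h\<in>movable n X. real (M choose N') * top_eigenvalue n (card X) ^ N' * ground n (jump n h X))"
      using Suc.IH[OF jump_subset[OF Suc.prems]] card_jump[OF Suc.prems] by (intro sum.cong) auto
    also have "\<dots> = real (M choose N') * top_eigenvalue n (card X) ^ N * ground n X"
      using ground_eigen[OF Suc.prems assms(2)] by (simp add: Suc flip: sum_distrib_left)
    finally have move: "(\<Sum>v\<in>(\<Union>h\<in>movable n X. (#) h ` words n M N' (jump n h X)). ground n (final n X v))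
      = real (M choose N') * top_eigenvalue n (card X) ^ N * ground n X" .
    have "(\<Sum>v\<in>words n (Suc M) N X. ground n (final n X v))
       = (\<Sum>v\<in>(#) n ` words n M N X. ground n (final n X v))
       + (\<Sum>v\<in>(\<Union>h\<in>movable n X. (#) h ` words n M N' (jump n h X)). ground n (final n X v))"
      unfolding words_Suc Suc using finite_words
      by (subst sum.union_disjoint[symmetric]) (auto simp: movable_def)
    then show ?thesis unfolding rest move by (simp add: Suc algebra_simps)
  qed
qed

section \<open>Legality of words through letter counts\<close>

lemma legal_append: "legal n X (u @ v) \<longleftrightarrow> legal n X u \<and> legal n (final n X u) v"
  by (induction u arbitrary: X) auto

lemma final_append: "final n X (u @ v) = final n (final n X u) v"
  by (induction u arbitrary: X) auto

lemma jumps_append: "jumps n (u @ v) = jumps n u + jumps n v"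
  by (simp add: jumps_def)

lemma final_subset_card:
  "X \<subseteq> {..<n} \<Longrightarrow> legal n X v \<Longrightarrow> final n X v \<subseteq> {..<n} \<and> card (final n X v) = card X"
proof (induction v arbitrary: X)
  case (Cons a v)
  then show ?case
    by (auto simp: jump_subset card_jump split: if_splits)
qed simp

lemma legal_letters: "legal n X v \<Longrightarrow> a \<in> set v \<Longrightarrow> a \<le> n"
  by (induction v arbitrary: X) (auto split: if_splits)

lemma of_bool_jump:
  assumes "X \<subseteq> {..<n}" "n \<ge> 2" "a \<in> movable n X" "h < n"
  shows "of_bool (h \<in> jump n a X) = (of_bool (h \<in> X) + of_bool (a = h) - of_bool (a = (h + 1) mod n) :: int)"
proof -
  have a: "a < n" using assms by (simp add: movable_def)
  show ?thesis
    using assms(3) pred_string_eq_iff[OF a assms(4)] pred_string_neq[OF a assms(2)]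
    by (auto simp: jump_def movable_def)
qed

text \<open>Conservation of particles: site h gains one with every letter h and loses one with every
  letter h + 1.\<close>

lemma of_bool_final:
  assumes "X \<subseteq> {..<n}" "n \<ge> 2" "legal n X v" "h < n"
  shows "of_bool (h \<in> final n X v)
    = (of_bool (h \<in> X) + int (count_list v h) - int (count_list v ((h + 1) mod n)))"
  using assms(1,3)
proof (induction v arbitrary: X)
  case (Cons a v)
  have m: "(h + 1) mod n < n" using assms(4) by simp
  show ?case
  proof (cases "a < n")
    case True
    then show ?thesis
      using Cons.IH[of "jump n a X"] Cons.prems of_bool_jump[OF Cons.prems(1) assms(2) _ assms(4), of a]
        jump_subset[of X n a] by auto
  next
    case False
    then have "a = n" using Cons.prems(2) by (simp split: if_splits)
    moreover from this have "a \<noteq> h" "a \<noteq> (h + 1) mod n" using m assms(4) by linarith+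
    ultimately show ?thesis using Cons by simp
  qed
qed simp

lemma legal_take: "legal n X v \<Longrightarrow> legal n X (take i v)"
  by (metis append_take_drop_id legal_append)

text \<open>The conservation law assigns to each site after each prefix a formal occupation;
  exclusion only asks it to stay in {0, 1}. Legality thus becomes a system of inequalities between
  counts, the form in which interlacing will be expressed.\<close>

lemma legalI:
  assumes "X \<subseteq> {..<n}" "n \<ge> 2" "\<And>a. a \<in> set v \<Longrightarrow> a \<le> n"
    and "\<And>i h. i \<le> length v \<Longrightarrow> h < n \<Longrightarrow>
      of_bool (h \<in> X) + int (count_list (take i v) h) - int (count_list (take i v) ((h + 1) mod n)) \<in> {0, 1}"
  shows "legal n X v"
  using assms(1,3,4)
proof (induction v arbitrary: X)
  case (Cons a v)
  show ?case
  proof (cases "a < n")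
    case True
    have 1: "of_bool (h \<in> X) + of_bool (a = h) - of_bool (a = (h + 1) mod n) \<in> {0, 1 :: int}" if "h < n" for h
      using Cons.prems(3)[of 1 h] that by (auto simp: of_bool_def split: if_splits)
    have p: "pred_string n a < n" "pred_string n a \<noteq> a" "(pred_string n a + 1) mod n = a"
      "(a + 1) mod n \<noteq> a"
      using True assms(2) pred_string_less[OF True] pred_string_neq[OF True] succ_pred_string[OF True]
        succ_string_eq[OF True] by auto
    have mov: "a \<in> movable n X"
      using 1[of a] 1[of "pred_string n a"] p True by (auto simp: movable_def of_bool_def split: if_splits)
    have "legal n (jump n a X) v"
    proof (rule Cons.IH)
      show "jump n a X \<subseteq> {..<n}" using Cons.prems(1) mov by (rule jump_subset)
      show "\<And>b. b \<in> set v \<Longrightarrow> b \<le> n" using Cons.prems(2) by auto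
      fix i h assume ih: "i \<le> length v" "h < n"
      then show "of_bool (h \<in> jump n a X) + int (count_list (take i v) h) - int (count_list (take i v) ((h + 1) mod n)) \<in> {0, 1}"
        using Cons.prems(3)[of "Suc i" h] of_bool_jump[OF Cons.prems(1) assms(2) mov ih(2)]
        by (auto split: if_splits)
    qed
    with mov True show ?thesis by simp
  next
    case False
    then have "a = n" using Cons.prems(2)[of a] by simp
    moreover have "legal n X v"
    proof (rule Cons.IH)
      show "X \<subseteq> {..<n}" by fact
      show "\<And>b. b \<in> set v \<Longrightarrow> b \<le> n" using Cons.prems(2) by auto
      fix i h assume ih: "i \<le> length v" "h < n"
      have "Suc h mod n < n" using assms(2) by simp
      then have "n \<noteq> Suc h mod n" by simp
      with ih \<open>a = n\<close> show "of_bool (h \<in> X) + int (count_list (take i v) h) - int (count_list (take i v) ((h + 1) mod n)) \<in> {0, 1}"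
        using Cons.prems(3)[of "Suc i" h] by auto
    qed
    ultimately show ?thesis by simp
  qed
qed simp

section \<open>Slot arrays and words\<close>

definition count_below :: "nat \<Rightarrow> (nat \<Rightarrow> nat) \<Rightarrow> nat \<Rightarrow> nat" where
  "count_below k f i = card {j \<in> {1..k}. f j < i}"

definition leads :: "nat \<Rightarrow> (nat \<Rightarrow> 'a::linorder) \<Rightarrow> (nat \<Rightarrow> 'a) \<Rightarrow> bool" where
  "leads k a b \<longleftrightarrow> (\<forall>j\<in>{1..k}. a j \<le> b j) \<and> (\<forall>j\<in>{1..<k}. b j < a (j + 1))"

text \<open>Stated for real-valued arrays so that it serves coordinates and slots alike.\<close>

definition bead_like :: "nat \<Rightarrow> nat \<Rightarrow> (nat \<times> nat \<Rightarrow> real) \<Rightarrow> bool" where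
  "bead_like n k t \<longleftrightarrow>
     (\<forall>h<n. strict_mono_on {1..k} (\<lambda>j. t (h, j))) \<and>
     (\<forall>h<n. interlaced k (\<lambda>j. t (h, j)) (\<lambda>j. t ((h + 1) mod n, j)))"

definition array_occupation :: "nat \<Rightarrow> (nat \<times> nat \<Rightarrow> real) \<Rightarrow> nat" where
  "array_occupation n t = card {h. h < n \<and> t (h, 1) < t (pred_string n h, 1)}"

text \<open>All beads occupy different slots here, because the array is to be read as a word with
  one letter per slot; \<open>separated\<close> below asks this of neighbouring strings
  only.\<close>

definition slot_arrays :: "nat \<Rightarrow> nat \<Rightarrow> nat \<Rightarrow> nat \<Rightarrow> (nat \<times> nat \<Rightarrow> nat) set" where
  "slot_arrays n k l M = {c \<in> {..<n} \<times> {1..k} \<rightarrow>\<^sub>E {..<M}.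
     inj_on c ({..<n} \<times> {1..k}) \<and> bead_like n k (\<lambda>x. real (c x)) \<and>
     array_occupation n (\<lambda>x. real (c x)) = l}"

text \<open>For increasing f, counting and f form a Galois connection. It trades statements about
  the j-th bead for statements about counts.\<close>

lemma less_iff_le_count_below:
  assumes "strict_mono_on {1..k} f" and "j \<in> {1..k}"
  shows "f j < i \<longleftrightarrow> j \<le> count_below k f i"
proof
  assume "f j < i"
  then have "{1..j} \<subseteq> {j \<in> {1..k}. f j < i}"
  proof (intro subsetI CollectI conjI)
    fix x assume x: "x \<in> {1..j}"
    then show "x \<in> {1..k}" using assms(2) by auto
    then have "f x \<le> f j" using strict_mono_on_leD[OF assms(1), of x j] assms(2) x by auto
    with \<open>f j < i\<close> show "f x < i" by simp
  qed
  then have "card {1..j} \<le> count_below k f i"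
    unfolding count_below_def by (intro card_mono) auto
  then show "j \<le> count_below k f i" by simp
next
  assume j: "j \<le> count_below k f i"
  show "f j < i"
  proof (rule ccontr)
    assume "\<not> f j < i"
    then have "{j \<in> {1..k}. f j < i} \<subseteq> {1..<j}"
    proof (intro subsetI)
      fix x assume x: "x \<in> {j \<in> {1..k}. f j < i}"
      then have "\<not> j \<le> x"
        using strict_mono_on_leD[OF assms(1), of j x] assms(2) \<open>\<not> f j < i\<close> by auto
      with x show "x \<in> {1..<j}" by auto
    qed
    then have "count_below k f i \<le> card {1..<j}"
      unfolding count_below_def by (intro card_mono) auto
    with j assms(2) show False by (cases j) auto
  qed
qed

lemma count_below_le: "count_below k f i \<le> k"
proof -
  have "count_below k f i \<le> card {1..k}"
    unfolding count_below_def by (intro card_mono) auto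
  then show ?thesis by simp
qed

text \<open>Through the Galois connection, a j \<le> b j says that a is never behind in the count,
  and b j < a (j + 1) that it is never ahead by more than one. From counts alone the latter
  inequality comes out weak; \<open>disj\<close> makes it strict.\<close>

lemma leads_iff_count_below:
  fixes a b :: "nat \<Rightarrow> nat"
  assumes a: "strict_mono_on {1..k} a" and b: "strict_mono_on {1..k} b"
    and disj: "\<And>i j. i \<in> {1..k} \<Longrightarrow> j \<in> {1..k} \<Longrightarrow> a i \<noteq> b j"
  shows "leads k a b \<longleftrightarrow>
    (\<forall>i. count_below k b i \<le> count_below k a i \<and> count_below k a i \<le> count_below k b i + 1)"
proof (intro iffI allI conjI)
  fix i
  assume l: "leads k a b"
  show "count_below k b i \<le> count_below k a i"
  proof (cases "count_below k b i = 0")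
    case False
    define m where "m = count_below k b i"
    have m: "m \<in> {1..k}" using False count_below_le[of k b i] by (simp add: m_def)
    have "b m < i" using less_iff_le_count_below[OF b m, of i] by (simp add: m_def)
    then have "a m < i" using l m by (auto simp: leads_def intro: le_less_trans)
    then show ?thesis using less_iff_le_count_below[OF a m, of i] by (simp add: m_def)
  qed simp
  show "count_below k a i \<le> count_below k b i + 1"
  proof (cases "count_below k a i \<le> 1")
    case False
    define m where "m = count_below k a i - 1"
    have m: "m \<in> {1..<k}" "m \<in> {1..k}" "m + 1 \<in> {1..k}" "m + 1 = count_below k a i"
      using False count_below_le[of k a i] by (auto simp: m_def)
    have "a (m + 1) < i" using less_iff_le_count_below[OF a m(3), of i] m(4) by simp
    then have "b m < i" using l m(1) by (auto simp: leads_def intro: less_trans)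
    then show ?thesis using less_iff_le_count_below[OF b m(2), of i] m(4) by simp
  qed simp
next
  assume c: "\<forall>i. count_below k b i \<le> count_below k a i \<and> count_below k a i \<le> count_below k b i + 1"
  have "a j \<le> b j" if j: "j \<in> {1..k}" for j
  proof -
    have "j \<le> count_below k b (b j + 1)" using less_iff_le_count_below[OF b j, of "b j + 1"] by simp
    also have "\<dots> \<le> count_below k a (b j + 1)" using c by blast
    finally show ?thesis using less_iff_le_count_below[OF a j, of "b j + 1"] by simp
  qed
  moreover have "b j < a (j + 1)" if "j \<in> {1..<k}" for j
  proof -
    have j: "j \<in> {1..k}" "j + 1 \<in> {1..k}" using that by auto
    have "j + 1 \<le> count_below k a (a (j + 1) + 1)"
      using less_iff_le_count_below[OF a j(2), of "a (j + 1) + 1"] by simp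
    also have "\<dots> \<le> count_below k b (a (j + 1) + 1) + 1" using c by blast
    finally have "b j \<le> a (j + 1)" using less_iff_le_count_below[OF b j(1), of "a (j + 1) + 1"] by simp
    with disj[OF j(2,1)] show ?thesis by simp
  qed
  ultimately show "leads k a b" by (simp add: leads_def)
qed

text \<open>The two alternatives of \<open>interlaced\<close> break ties differently; without ties
  they are the same relation with the strings exchanged.\<close>

lemma interlaced_iff_leads:
  assumes "\<And>i j. i \<in> {1..k} \<Longrightarrow> j \<in> {1..k} \<Longrightarrow> a i \<noteq> b j"
  shows "interlaced k a b \<longleftrightarrow> leads k a b \<or> leads k b a"
proof -
  have "(\<forall>j\<in>{1..k}. b j < a j) \<longleftrightarrow> (\<forall>j\<in>{1..k}. b j \<le> a j)"
    using assms by (force simp: less_le)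
  moreover have "(\<forall>j\<in>{1..<k}. a j \<le> b (j + 1)) \<longleftrightarrow> (\<forall>j\<in>{1..<k}. a j < b (j + 1))"
    using assms by (fastforce simp: less_le)
  ultimately show ?thesis unfolding interlaced_def leads_def by auto
qed

lemma leads_real [simp]: "leads k (\<lambda>j. real (a j)) (\<lambda>j. real (b j)) \<longleftrightarrow> leads k a b"
  by (simp add: leads_def flip: of_nat_Suc)

lemma strict_mono_on_real [simp]: "strict_mono_on A (\<lambda>j. real (a j)) \<longleftrightarrow> strict_mono_on A a"
  by (simp add: strict_mono_on_def)

lemma sum_count_list:
  assumes "\<And>a. a \<in> set v \<Longrightarrow> a \<le> n"
  shows "(\<Sum>h<n. count_list v h) = jumps n v"
  using assms
proof (induction v)
  case (Cons a v)
  have "(\<Sum>h<n. count_list (a # v) h) = (\<Sum>h<n. count_list v h) + (\<Sum>h<n. if a = h then 1 else 0)"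
    by (subst sum.distrib[symmetric]) (intro sum.cong, auto)
  also have "(\<Sum>h<n. if a = h then 1 else 0) = (if a < n then 1 else 0 :: nat)"
    by simp
  finally show ?case using Cons by (simp add: jumps_def)
qed (simp add: jumps_def)

lemma count_list_conv_card: "count_list v h = card {i. i < length v \<and> v ! i = h}"
  by (simp add: count_list_eq_length_filter length_filter_conv_card eq_commute)

lemma count_list_take:
  "i \<le> length v \<Longrightarrow> count_list (take i v) h = card {j. j < i \<and> v ! j = h}"
  by (auto simp: count_list_conv_card intro!: arg_cong[where f = card])

text \<open>A closed word leaves each site as it was, so by the conservation law consecutive strings
  receive equally many letters.\<close>

lemma closed_word_counts:
  assumes "X \<subseteq> {..<n}" "n \<ge> 2" "legal n X v" "final n X v = X" "h < n"
  shows "jumps n v = n * count_list v h"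
proof -
  have step: "count_list v (Suc i mod n) = count_list v i" if "i < n" for i
    using of_bool_final[OF assms(1-3) that] assms(4) by simp
  have const: "count_list v i = count_list v 0" if "i < n" for i
    using that
  proof (induction i)
    case (Suc i)
    then show ?case using step[of i] by simp
  qed simp
  have "(\<Sum>i<n. count_list v i) = (\<Sum>i<n. count_list v h)"
  proof (rule sum.cong)
    fix i assume "i \<in> {..<n}"
    then show "count_list v i = count_list v h"
      unfolding const[OF assms(5)] by (intro const) simp
  qed simp
  then show ?thesis
    using sum_count_list[OF legal_letters[OF assms(3)]] by simp
qed

section \<open>From slot arrays to closed words\<close>

definition array_word :: "nat \<Rightarrow> nat \<Rightarrow> nat \<Rightarrow> (nat \<times> nat \<Rightarrow> nat) \<Rightarrow> nat list" where
  "array_word n k M c = map (\<lambda>i. if i \<in> c ` ({..<n} \<times> {1..k})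
      then fst (inv_into ({..<n} \<times> {1..k}) c i) else n) [0..<M]"

definition array_start :: "nat \<Rightarrow> (nat \<times> nat \<Rightarrow> nat) \<Rightarrow> nat set" where
  "array_start n c = {h. h < n \<and> c ((h + 1) mod n, 1) < c (h, 1)}"

text \<open>The occupation number is indexed by the second string of each neighbouring pair,
  \<open>array_start\<close> by the first; \<open>pred_string\<close> is the bijection between
  them.\<close>

lemma array_occupation_eq: "array_occupation n (\<lambda>x. real (c x)) = card (array_start n c)"
proof -
  define D where "D = {h. h < n \<and> c (h, 1) < c (pred_string n h, 1)}"
  have "pred_string n ` D = array_start n c"
  proof (intro equalityI subsetI)
    fix h assume "h \<in> array_start n c"
    then have h: "h < n" "c (Suc h mod n, 1) < c (h, 1)" by (auto simp: array_start_def)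
    have "pred_string n (Suc h mod n) = h" "Suc h mod n < n"
      using pred_succ_string[OF h(1)] h(1) by simp_all
    then have "Suc h mod n \<in> D" "h = pred_string n (Suc h mod n)"
      using h(2) unfolding D_def by simp_all
    then show "h \<in> pred_string n ` D" by (rule image_eqI[rotated])
  next
    fix g assume "g \<in> pred_string n ` D"
    then obtain h where h: "h < n" "c (h, 1) < c (pred_string n h, 1)" "g = pred_string n h"
      unfolding D_def by blast
    then show "g \<in> array_start n c"
      using succ_pred_string[OF h(1)] pred_string_less[OF h(1)] by (simp add: array_start_def)
  qed
  moreover have "inj_on (pred_string n) D"
    unfolding D_def by (intro inj_onI) (metis (mono_tags, lifting) mem_Collect_eq succ_pred_string)
  ultimately have "card (array_start n c) = card D"
    using card_image by metis
  then show ?thesis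
    unfolding array_occupation_def of_nat_less_iff D_def by simp
qed

locale slot_array =
  fixes n k l M :: nat and c :: "nat \<times> nat \<Rightarrow> nat"
  assumes n: "n \<ge> 2" and k: "k \<ge> 1" and c: "c \<in> slot_arrays n k l M"
begin

lemma bound: "h < n \<Longrightarrow> j \<in> {1..k} \<Longrightarrow> c (h, j) < M"
  using c by (auto simp: slot_arrays_def)

lemma inj: "inj_on c ({..<n} \<times> {1..k})"
  using c by (simp add: slot_arrays_def)

lemma mono: "h < n \<Longrightarrow> strict_mono_on {1..k} (\<lambda>j. c (h, j))"
  using c by (simp add: slot_arrays_def bead_like_def)

lemma disjoint:
  assumes "h < n" "h' < n" "h \<noteq> h'" "i \<in> {1..k}" "j \<in> {1..k}"
  shows "c (h, i) \<noteq> c (h', j)"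
  using inj_onD[OF inj, of "(h, i)" "(h', j)"] assms by auto

lemma succ_less: "(h + 1) mod n < n"
  using n by simp

lemma succ_neq: "h < n \<Longrightarrow> (h + 1) mod n \<noteq> h"
  using n by (subst succ_string_eq) auto

text \<open>The first beads, which lie in different slots, decide which of the two interlacing
  alternatives holds.\<close>

lemma leads_cases:
  assumes "h < n"
  shows "if h \<in> array_start n c then leads k (\<lambda>j. c ((h + 1) mod n, j)) (\<lambda>j. c (h, j))
    else leads k (\<lambda>j. c (h, j)) (\<lambda>j. c ((h + 1) mod n, j))"
proof -
  have "interlaced k (\<lambda>j. real (c (h, j))) (\<lambda>j. real (c ((h + 1) mod n, j)))"
    using c assms by (simp add: slot_arrays_def bead_like_def)
  moreover have "real (c (h, i)) \<noteq> real (c ((h + 1) mod n, j))" if "i \<in> {1..k}" "j \<in> {1..k}" for i j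
    using disjoint[OF assms succ_less _ that] succ_neq[OF assms] by simp
  ultimately have "leads k (\<lambda>j. c (h, j)) (\<lambda>j. c ((h + 1) mod n, j)) \<or> leads k (\<lambda>j. c ((h + 1) mod n, j)) (\<lambda>j. c (h, j))"
    using interlaced_iff_leads[of k "\<lambda>j. real (c (h, j))" "\<lambda>j. real (c ((h + 1) mod n, j))"] by simp
  moreover have "leads k (\<lambda>j. c (h, j)) (\<lambda>j. c ((h + 1) mod n, j)) \<Longrightarrow> c (h, 1) \<le> c ((h + 1) mod n, 1)"
    "leads k (\<lambda>j. c ((h + 1) mod n, j)) (\<lambda>j. c (h, j)) \<Longrightarrow> c ((h + 1) mod n, 1) \<le> c (h, 1)"
    using k by (auto simp: leads_def)
  moreover have "c (h, 1) \<noteq> c ((h + 1) mod n, 1)"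
    using disjoint[OF assms succ_less _ , of h 1 1] succ_neq[OF assms] k by simp
  ultimately show ?thesis
    using assms by (cases "c ((h + 1) mod n, 1) < c (h, 1)") (auto simp: array_start_def)
qed

lemma nth_word:
  assumes "i < M" "h < n"
  shows "array_word n k M c ! i = h \<longleftrightarrow> (\<exists>j\<in>{1..k}. c (h, j) = i)"
proof -
  have nth: "array_word n k M c ! i = (if i \<in> c ` ({..<n} \<times> {1..k})
      then fst (inv_into ({..<n} \<times> {1..k}) c i) else n)"
    using assms(1) by (simp add: array_word_def)
  have inv: "inv_into ({..<n} \<times> {1..k}) c (c x) = x" if "x \<in> {..<n} \<times> {1..k}" for x
    using inj that by (rule inv_into_f_f)
  show ?thesis
  proof
    assume h: "array_word n k M c ! i = h"
    then have "i \<in> c ` ({..<n} \<times> {1..k})"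
      using assms(2) unfolding nth by (metis less_irrefl)
    then obtain x where x: "x \<in> {..<n} \<times> {1..k}" "i = c x" by blast
    then have "fst x = h" using h inv[OF x(1)] unfolding nth by simp
    then have "x = (h, snd x)" by (simp add: prod_eq_iff)
    with x show "\<exists>j\<in>{1..k}. c (h, j) = i" by (metis mem_Sigma_iff)
  next
    assume "\<exists>j\<in>{1..k}. c (h, j) = i"
    then obtain j where j: "j \<in> {1..k}" "c (h, j) = i" by blast
    then have hj: "(h, j) \<in> {..<n} \<times> {1..k}" using assms(2) by simp
    then have "i \<in> c ` ({..<n} \<times> {1..k})" using j(2) by (intro image_eqI[of _ _ "(h, j)"]) auto
    then show "array_word n k M c ! i = h"
      using inv[OF hj] j(2) unfolding nth by (simp only: if_True fst_conv)
  qed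
qed

lemma length_word: "length (array_word n k M c) = M"
  by (simp add: array_word_def)

lemma word_letters: "a \<in> set (array_word n k M c) \<Longrightarrow> a \<le> n"
proof -
  assume "a \<in> set (array_word n k M c)"
  then consider "a = n" | i where "i \<in> c ` ({..<n} \<times> {1..k})" "a = fst (inv_into ({..<n} \<times> {1..k}) c i)"
    by (auto simp: array_word_def split: if_splits)
  then show "a \<le> n"
  proof cases
    case 2
    then show ?thesis using inv_into_into[of i c "{..<n} \<times> {1..k}"] by (auto simp: mem_Times_iff)
  qed simp
qed

lemma count_word:
  assumes "i \<le> M" "h < n"
  shows "count_list (take i (array_word n k M c)) h = count_below k (\<lambda>j. c (h, j)) i"
proof -
  have "{x. x < i \<and> array_word n k M c ! x = h} = (\<lambda>j. c (h, j)) ` {j \<in> {1..k}. c (h, j) < i}"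
  proof (intro equalityI subsetI)
    fix x assume x: "x \<in> {x. x < i \<and> array_word n k M c ! x = h}"
    then obtain j where "j \<in> {1..k}" "c (h, j) = x"
      using nth_word[of x h] assms by auto
    with x show "x \<in> (\<lambda>j. c (h, j)) ` {j \<in> {1..k}. c (h, j) < i}" by auto
  next
    fix x assume "x \<in> (\<lambda>j. c (h, j)) ` {j \<in> {1..k}. c (h, j) < i}"
    then obtain j where "j \<in> {1..k}" "c (h, j) = x" "x < i" by auto
    then show "x \<in> {x. x < i \<and> array_word n k M c ! x = h}"
      using nth_word[of x h] assms by auto
  qed
  moreover have "inj_on (\<lambda>j. c (h, j)) {j \<in> {1..k}. c (h, j) < i}"
    using strict_mono_on_imp_inj_on[OF mono[OF assms(2)]] by (rule inj_on_subset) auto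
  ultimately show ?thesis
    using assms by (simp add: count_list_take length_word count_below_def card_image)
qed

lemma count_word_full:
  assumes "h < n"
  shows "count_list (array_word n k M c) h = k"
proof -
  have "{j \<in> {1..k}. c (h, j) < M} = {1..k}" using bound[OF assms] by auto
  then show ?thesis
    using count_word[of M h] assms by (simp add: length_word count_below_def)
qed

lemma start_subset: "array_start n c \<subseteq> {..<n}"
  by (auto simp: array_start_def)

lemma card_start: "card (array_start n c) = l"
  using c by (simp add: slot_arrays_def array_occupation_eq)

text \<open>The criterion of \<open>legalI\<close> at site h is \<open>leads_cases\<close> in terms
  of counts: at an initially occupied site string h + 1 is ahead by zero or one bead, at an empty
  one string h is.\<close>

lemma legal_word: "legal n (array_start n c) (array_word n k M c)"
proof (rule legalI[OF start_subset n word_letters])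
  fix i h assume ih: "i \<le> length (array_word n k M c)" "h < n"
  define A where "A = count_below k (\<lambda>j. c (h, j)) i"
  define B where "B = count_below k (\<lambda>j. c ((h + 1) mod n, j)) i"
  have "if h \<in> array_start n c then A \<le> B \<and> B \<le> A + 1 else B \<le> A \<and> A \<le> B + 1"
  proof (cases "h \<in> array_start n c")
    case True
    have "\<forall>i. count_below k (\<lambda>j. c (h, j)) i \<le> count_below k (\<lambda>j. c ((h + 1) mod n, j)) i \<and>
      count_below k (\<lambda>j. c ((h + 1) mod n, j)) i \<le> count_below k (\<lambda>j. c (h, j)) i + 1"
      using leads_cases[OF ih(2)] True disjoint[OF succ_less[of h] ih(2) succ_neq[OF ih(2)]]
      by (subst leads_iff_count_below[OF mono[OF succ_less[of h]] mono[OF ih(2)], symmetric]) auto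
    with True show ?thesis unfolding A_def B_def by simp
  next
    case False
    have "\<forall>i. count_below k (\<lambda>j. c ((h + 1) mod n, j)) i \<le> count_below k (\<lambda>j. c (h, j)) i \<and>
      count_below k (\<lambda>j. c (h, j)) i \<le> count_below k (\<lambda>j. c ((h + 1) mod n, j)) i + 1"
      using leads_cases[OF ih(2)] False disjoint[OF ih(2) succ_less[of h] succ_neq[OF ih(2), symmetric]]
      by (subst leads_iff_count_below[OF mono[OF ih(2)] mono[OF succ_less[of h]], symmetric]) auto
    with False show ?thesis unfolding A_def B_def by simp
  qed
  then show "of_bool (h \<in> array_start n c) + int (count_list (take i (array_word n k M c)) h)
      - int (count_list (take i (array_word n k M c)) ((h + 1) mod n)) \<in> {0, 1}"
    using ih count_word[of i h] count_word[of i "(h + 1) mod n"] succ_less[of h]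
    unfolding A_def B_def length_word by (cases "h \<in> array_start n c") auto
qed

lemma final_word: "final n (array_start n c) (array_word n k M c) = array_start n c"
proof (rule set_eqI)
  fix h
  show "h \<in> final n (array_start n c) (array_word n k M c) \<longleftrightarrow> h \<in> array_start n c"
  proof (cases "h < n")
    case True
    then have "of_bool (h \<in> final n (array_start n c) (array_word n k M c)) = (of_bool (h \<in> array_start n c) :: int)"
      using of_bool_final[OF start_subset n legal_word True] count_word_full[of h]
        count_word_full[OF succ_less[of h]] by simp
    then show ?thesis unfolding of_bool_eq_iff .
  next
    case False
    then show ?thesis using final_subset_card[OF start_subset legal_word] start_subset by auto
  qed
qed

lemma word_mem: "array_word n k M c \<in> words n M (n * k) (array_start n c)"
proof -
  have "jumps n (array_word n k M c) = (\<Sum>h<n. count_list (array_word n k M c) h)"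
    using sum_count_list[OF word_letters] by simp
  also have "\<dots> = n * k" using count_word_full by simp
  finally show ?thesis by (simp add: words_def length_word legal_word)
qed

end

text \<open>The prefix counts of the word are the counting functions of the strings, and these
  determine the slots.\<close>

lemma inj_on_array_word:
  assumes "n \<ge> 2" "k \<ge> 1"
  shows "inj_on (array_word n k M) (slot_arrays n k l M)"
proof (rule inj_onI)
  fix c d assume c: "c \<in> slot_arrays n k l M" and d: "d \<in> slot_arrays n k l M"
    and eq: "array_word n k M c = array_word n k M d"
  interpret c: slot_array n k l M c using assms c by unfold_locales
  interpret d: slot_array n k l M d using assms d by unfold_locales
  have less_iff: "c (h, j) < i \<longleftrightarrow> d (h, j) < i" if "h < n" "j \<in> {1..k}" "i \<le> M" for h i j
    using c.count_word[OF that(3,1)] d.count_word[OF that(3,1)] eq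
      less_iff_le_count_below[OF c.mono[OF that(1)] that(2), of i]
      less_iff_le_count_below[OF d.mono[OF that(1)] that(2), of i] by simp
  have "c (h, j) = d (h, j)" if "h < n" "j \<in> {1..k}" for h j
    using less_iff[OF that, of "c (h, j) + 1"] less_iff[OF that, of "d (h, j) + 1"]
      c.bound[OF that] d.bound[OF that] by simp
  then show "c = d"
    using c d by (intro PiE_ext[of c "{..<n} \<times> {1..k}" "\<lambda>_. {..<M}"]) (auto simp: slot_arrays_def)
qed

text \<open>Keep in \<open>sum_ground_words\<close> only the words that return to X. Each
  contributes \<open>ground n X\<close>, which cancels, so different states are never
  compared.\<close>

lemma card_closed_words_le:
  assumes "X \<subseteq> {..<n}" "n \<ge> 2"
  shows "real (card {v \<in> words n M N X. final n X v = X}) \<le> real (M choose N) * top_eigenvalue n (card X) ^ N"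
proof -
  have pos: "ground n (final n X v) > 0" if "v \<in> words n M N X" for v
    using that assms final_subset_card by (intro ground_pos) (auto simp: words_def)
  have "real (card {v \<in> words n M N X. final n X v = X}) * ground n X
      = (\<Sum>v\<in>{v \<in> words n M N X. final n X v = X}. ground n (final n X v))"
    by simp
  also have "\<dots> \<le> (\<Sum>v\<in>words n M N X. ground n (final n X v))"
    using pos by (intro sum_mono2) (auto intro: less_imp_le)
  also have "\<dots> = real (M choose N) * top_eigenvalue n (card X) ^ N * ground n X"
    using assms by (rule sum_ground_words)
  finally show ?thesis using ground_pos[OF assms(1)] by simp
qed

lemma finite_slot_arrays [simp]: "finite (slot_arrays n k l M)"
proof -
  have "finite ({..<n} \<times> {1..k} \<rightarrow>\<^sub>E {..<M})" by (intro finite_PiE) auto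
  then show ?thesis by (rule finite_subset[rotated]) (auto simp: slot_arrays_def)
qed

lemma card_slot_arrays_le:
  assumes "n \<ge> 2" "k \<ge> 1"
  shows "real (card (slot_arrays n k l M))
    \<le> real (n choose l) * (real (M choose (n * k)) * top_eigenvalue n l ^ (n * k))"
proof -
  define \<X> where "\<X> = {X. X \<subseteq> {..<n} \<and> card X = l}"
  define W where "W X = {v \<in> words n M (n * k) X. final n X v = X}" for X
  have fin: "finite \<X>" by (simp add: \<X>_def)
  have "array_word n k M ` slot_arrays n k l M \<subseteq> (\<Union>X\<in>\<X>. W X)"
  proof safe
    fix c assume "c \<in> slot_arrays n k l M"
    then interpret slot_array n k l M c using assms by unfold_locales
    show "array_word n k M c \<in> (\<Union>X\<in>\<X>. W X)"
      using word_mem final_word start_subset card_start by (auto simp: \<X>_def W_def)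
  qed
  then have "card (slot_arrays n k l M) \<le> card (\<Union>X\<in>\<X>. W X)"
    using inj_on_array_word[OF assms] fin by (intro card_inj_on_le) (auto simp: W_def)
  also have "\<dots> \<le> (\<Sum>X\<in>\<X>. card (W X))"
    using fin by (rule card_UN_le)
  finally have "real (card (slot_arrays n k l M)) \<le> (\<Sum>X\<in>\<X>. real (card (W X)))"
    by (metis of_nat_le_iff of_nat_sum)
  also have "\<dots> \<le> (\<Sum>X\<in>\<X>. real (M choose (n * k)) * top_eigenvalue n l ^ (n * k))"
    using card_closed_words_le[OF _ assms(1)] by (intro sum_mono) (auto simp: \<X>_def W_def)
  also have "card \<X> = n choose l"
    using n_subsets[of "{..<n}" l] by (simp add: \<X>_def)
  then have "(\<Sum>X\<in>\<X>. real (M choose (n * k)) * top_eigenvalue n l ^ (n * k))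
    = real (n choose l) * (real (M choose (n * k)) * top_eigenvalue n l ^ (n * k))" by simp
  finally show ?thesis .
qed

section \<open>From closed words back to slot arrays\<close>

definition word_array :: "nat \<Rightarrow> nat \<Rightarrow> nat list \<Rightarrow> nat \<times> nat \<Rightarrow> nat" where
  "word_array n k v = (\<lambda>(h, j)\<in>{..<n} \<times> {1..k}. sorted_list_of_set {i. i < length v \<and> v ! i = h} ! (j - 1))"

lemma nth_sorted_list_of_set:
  fixes S :: "'a::linorder set"
  assumes "finite S" "card S = k"
  shows "strict_mono_on {1..k} (\<lambda>j. sorted_list_of_set S ! (j - 1))"
    and "(\<lambda>j. sorted_list_of_set S ! (j - 1)) ` {1..k} = S"
proof -
  have len: "length (sorted_list_of_set S) = k" using assms by simp
  show "strict_mono_on {1..k} (\<lambda>j. sorted_list_of_set S ! (j - 1))"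
  proof (rule strict_mono_onI)
    fix i j assume "i \<in> {1..k}" "j \<in> {1..k}" "i < j"
    then have "i - 1 < j - 1" "j - 1 < length (sorted_list_of_set S)" using len by auto
    then show "sorted_list_of_set S ! (i - 1) < sorted_list_of_set S ! (j - 1)"
      using strict_sorted_list_of_set[of S] by (simp add: sorted_wrt_nth_less)
  qed
  have "S = set (sorted_list_of_set S)" using assms by simp
  also have "\<dots> = (\<lambda>i. sorted_list_of_set S ! i) ` {..<k}"
    using len by (auto simp: set_conv_nth)
  also have "{..<k} = (\<lambda>j. j - 1) ` {1..k}"
  proof (intro equalityI subsetI)
    fix x assume "x \<in> {..<k}"
    then show "x \<in> (\<lambda>j. j - 1) ` {1..k}" by (intro image_eqI[of _ _ "Suc x"]) auto
  qed auto
  finally show "(\<lambda>j. sorted_list_of_set S ! (j - 1)) ` {1..k} = S"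
    by (simp add: image_image)
qed

text \<open>The beads of string h are the slots with letter h: there are k of them by
  \<open>closed_word_counts\<close>, and legality keeps the prefix counts of neighbouring strings
  within one of each other, which is interlacing. The map is injective because the slots with
  letters below n determine where the letter n stands.\<close>

lemma card_slot_arrays_ge:
  assumes X: "X \<subseteq> {..<n}" "card X = l" and n: "n \<ge> 2" and k: "k \<ge> 1"
  shows "card {v \<in> words n M (n * k) X. final n X v = X} \<le> card (slot_arrays n k l M)"
proof (rule card_inj_on_le)
  define W where "W = {v \<in> words n M (n * k) X. final n X v = X}"
  have len: "length v = M" and leg: "legal n X v" and fin: "final n X v = X" and jmp: "jumps n v = n * k"
    if "v \<in> W" for v using that by (auto simp: W_def words_def)
  have letters: "a \<le> n" if "v \<in> W" "a \<in> set v" for v a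
    using legal_letters[OF leg[OF that(1)] that(2)] .
  have cnt: "card {i. i < length v \<and> v ! i = h} = k" if "v \<in> W" "h < n" for v h
    using closed_word_counts[OF X(1) n leg fin that(2)] that jmp n by (simp add: count_list_conv_card)
  have mono: "strict_mono_on {1..k} (\<lambda>j. word_array n k v (h, j))"
    and img: "(\<lambda>j. word_array n k v (h, j)) ` {1..k} = {i. i < length v \<and> v ! i = h}"
    if "v \<in> W" "h < n" for v h
  proof -
    define S where "S = {i. i < length v \<and> v ! i = h}"
    have S: "finite S" "card S = k" using cnt[OF that] by (simp_all add: S_def)
    have eq: "word_array n k v (h, j) = sorted_list_of_set S ! (j - 1)" if "j \<in> {1..k}" for j
      using that \<open>h < n\<close> by (simp add: word_array_def S_def)
    show "strict_mono_on {1..k} (\<lambda>j. word_array n k v (h, j))"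
    proof (rule strict_mono_onI)
      fix i j assume ij: "i \<in> {1..k}" "j \<in> {1..k}" "i < j"
      then show "word_array n k v (h, i) < word_array n k v (h, j)"
        unfolding eq[OF ij(1)] eq[OF ij(2)]
        by (rule strict_mono_onD[OF nth_sorted_list_of_set(1)[OF S]])
    qed
    have "(\<lambda>j. word_array n k v (h, j)) ` {1..k} = (\<lambda>j. sorted_list_of_set S ! (j - 1)) ` {1..k}"
      by (intro image_cong refl eq)
    then show "(\<lambda>j. word_array n k v (h, j)) ` {1..k} = {i. i < length v \<and> v ! i = h}"
      unfolding nth_sorted_list_of_set(2)[OF S] by (simp only: S_def)
  qed
  have mem: "word_array n k v (h, j) < length v" "v ! word_array n k v (h, j) = h"
    if "v \<in> W" "h < n" "j \<in> {1..k}" for v h j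
  proof -
    have "word_array n k v (h, j) \<in> {i. i < length v \<and> v ! i = h}"
      unfolding img[OF that(1,2), symmetric] using that(3) by (rule imageI)
    then show "word_array n k v (h, j) < length v" "v ! word_array n k v (h, j) = h" by simp_all
  qed
  have below: "count_below k (\<lambda>j. word_array n k v (h, j)) i = count_list (take i v) h"
    if "v \<in> W" "h < n" "i \<le> M" for v h i
  proof -
    have "{x. x < i \<and> v ! x = h} = (\<lambda>j. word_array n k v (h, j)) ` {j \<in> {1..k}. word_array n k v (h, j) < i}"
    proof (intro equalityI subsetI)
      fix x assume x: "x \<in> {x. x < i \<and> v ! x = h}"
      then have "x \<in> (\<lambda>j. word_array n k v (h, j)) ` {1..k}"
        using img[OF that(1,2)] len[OF that(1)] that(3) by auto
      with x show "x \<in> (\<lambda>j. word_array n k v (h, j)) ` {j \<in> {1..k}. word_array n k v (h, j) < i}" by auto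
    next
      fix x assume "x \<in> (\<lambda>j. word_array n k v (h, j)) ` {j \<in> {1..k}. word_array n k v (h, j) < i}"
      then obtain j where j: "j \<in> {1..k}" "x = word_array n k v (h, j)" "x < i" by blast
      then show "x \<in> {x. x < i \<and> v ! x = h}" using mem(2)[OF that(1,2) j(1)] by simp
    qed
    moreover have "inj_on (\<lambda>j. word_array n k v (h, j)) {j \<in> {1..k}. word_array n k v (h, j) < i}"
      using strict_mono_on_imp_inj_on[OF mono[OF that(1,2)]] by (rule inj_on_subset) auto
    ultimately show ?thesis
      using that len[OF that(1)] by (simp add: count_list_take count_below_def card_image)
  qed
  show "inj_on (word_array n k) {v \<in> words n M (n * k) X. final n X v = X}"
    unfolding W_def[symmetric]
  proof (rule inj_onI)
    fix v w assume v: "v \<in> W" and w: "w \<in> W" and eq: "word_array n k v = word_array n k w"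
    have iff: "v ! i = h \<longleftrightarrow> w ! i = h" if "i < M" "h < n" for i h
    proof -
      have "{i. i < length v \<and> v ! i = h} = {i. i < length w \<and> w ! i = h}"
        unfolding img[OF v that(2), symmetric] img[OF w that(2), symmetric] eq ..
      then have "i \<in> {i. i < length v \<and> v ! i = h} \<longleftrightarrow> i \<in> {i. i < length w \<and> w ! i = h}"
        by (simp only:)
      then show ?thesis using len[OF v] len[OF w] that(1) by simp
    qed
    show "v = w"
    proof (rule nth_equalityI)
      fix i assume "i < length v"
      then have i: "i < M" using len[OF v] by simp
      have "v ! i \<le> n" "w ! i \<le> n" using letters v w len i by auto
      show "v ! i = w ! i"
      proof (cases "v ! i < n")
        case True
        then show ?thesis using iff[OF i, of "v ! i"] by simp
      next
        case False
        moreover have "\<not> w ! i < n" using iff[OF i, of "w ! i"] False by metis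
        ultimately show ?thesis using \<open>v ! i \<le> n\<close> \<open>w ! i \<le> n\<close> by simp
      qed
    qed (simp add: len v w)
  qed
  show "word_array n k ` {v \<in> words n M (n * k) X. final n X v = X} \<subseteq> slot_arrays n k l M"
    unfolding W_def[symmetric]
  proof safe
    fix v assume v: "v \<in> W"
    define c where "c = word_array n k v"
    have inj: "inj_on c ({..<n} \<times> {1..k})"
    proof (rule inj_onI)
      fix x y assume xy: "x \<in> {..<n} \<times> {1..k}" "y \<in> {..<n} \<times> {1..k}" "c x = c y"
      have *: "v ! c z = fst z" if "z \<in> {..<n} \<times> {1..k}" for z
        using mem(2)[OF v, of "fst z" "snd z"] that by (auto simp: c_def)
      have h: "fst x = fst y" using *[OF xy(1)] *[OF xy(2)] xy(3) by simp
      have "c (fst x, snd x) = c (fst x, snd y)" by (metis h prod.collapse xy(3))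
      then have "snd x = snd y"
        using inj_onD[OF strict_mono_on_imp_inj_on[OF mono[OF v, of "fst x"]], of "snd x" "snd y"] xy(1,2)
        by (auto simp: c_def)
      with h show "x = y" by (simp add: prod_eq_iff)
    qed
    have ld: "if h \<in> X then leads k (\<lambda>j. c (Suc h mod n, j)) (\<lambda>j. c (h, j))
      else leads k (\<lambda>j. c (h, j)) (\<lambda>j. c (Suc h mod n, j))"
      and ne: "\<And>i j. i \<in> {1..k} \<Longrightarrow> j \<in> {1..k} \<Longrightarrow> c (h, i) \<noteq> c (Suc h mod n, j)" if h: "h < n" for h
    proof -
      have s: "Suc h mod n < n" "Suc h mod n \<noteq> h"
        using n h succ_string_eq[OF h] by auto
      show ne: "c (h, i) \<noteq> c (Suc h mod n, j)" if "i \<in> {1..k}" "j \<in> {1..k}" for i j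
        using inj_onD[OF inj, of "(h, i)" "(Suc h mod n, j)"] that h s by auto
      have bounds: "of_bool (h \<in> X) + int (count_below k (\<lambda>j. c (h, j)) i)
          - int (count_below k (\<lambda>j. c (Suc h mod n, j)) i) \<in> {0, 1}" for i
      proof -
        \<comment> \<open>\<open>leads_iff_count_below\<close> quantifies over all i, but prefixes
          of the word exist only up to M; beyond that the counts stay constant.\<close>
        have *: "count_below k (\<lambda>j. c (g, j)) i = count_list (take (min i M) v) g" if g: "g < n" for g
        proof -
          have "{j \<in> {1..k}. c (g, j) < i} = {j \<in> {1..k}. c (g, j) < min i M}"
            using mem(1)[OF v g] len[OF v] by (auto simp: c_def)
          then have "count_below k (\<lambda>j. c (g, j)) i = count_below k (\<lambda>j. c (g, j)) (min i M)"
            by (simp add: count_below_def)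
          then show ?thesis using below[OF v g, of "min i M"] by (simp add: c_def)
        qed
        have "of_bool (h \<in> final n X (take (min i M) v)) \<in> {0, 1 :: int}" by simp
        then show ?thesis
          using of_bool_final[OF X(1) n legal_take[OF leg[OF v]] h, of "min i M"]
          by (simp add: *[OF h] *[OF s(1)])
      qed
      have m: "strict_mono_on {1..k} (\<lambda>j. c (h, j))" "strict_mono_on {1..k} (\<lambda>j. c (Suc h mod n, j))"
        using mono[OF v] h s by (simp_all add: c_def)
      show "if h \<in> X then leads k (\<lambda>j. c (Suc h mod n, j)) (\<lambda>j. c (h, j))
        else leads k (\<lambda>j. c (h, j)) (\<lambda>j. c (Suc h mod n, j))"
      proof (cases "h \<in> X")
        case True
        have "leads k (\<lambda>j. c (Suc h mod n, j)) (\<lambda>j. c (h, j))"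
        proof (subst leads_iff_count_below[OF m(2,1)])
          show "\<forall>i. count_below k (\<lambda>j. c (h, j)) i \<le> count_below k (\<lambda>j. c (Suc h mod n, j)) i \<and>
            count_below k (\<lambda>j. c (Suc h mod n, j)) i \<le> count_below k (\<lambda>j. c (h, j)) i + 1"
          proof
            fix i show "count_below k (\<lambda>j. c (h, j)) i \<le> count_below k (\<lambda>j. c (Suc h mod n, j)) i \<and>
              count_below k (\<lambda>j. c (Suc h mod n, j)) i \<le> count_below k (\<lambda>j. c (h, j)) i + 1"
              using bounds[of i] True by auto
          qed
        qed (use ne in \<open>metis\<close>)
        with True show ?thesis by simp
      next
        case False
        have "leads k (\<lambda>j. c (h, j)) (\<lambda>j. c (Suc h mod n, j))"
        proof (subst leads_iff_count_below[OF m])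
          show "\<forall>i. count_below k (\<lambda>j. c (Suc h mod n, j)) i \<le> count_below k (\<lambda>j. c (h, j)) i \<and>
            count_below k (\<lambda>j. c (h, j)) i \<le> count_below k (\<lambda>j. c (Suc h mod n, j)) i + 1"
          proof
            fix i show "count_below k (\<lambda>j. c (Suc h mod n, j)) i \<le> count_below k (\<lambda>j. c (h, j)) i \<and>
              count_below k (\<lambda>j. c (h, j)) i \<le> count_below k (\<lambda>j. c (Suc h mod n, j)) i + 1"
              using bounds[of i] False by auto
          qed
        qed (use ne in \<open>metis\<close>)
        with False show ?thesis by simp
      qed
    qed
    have bl: "bead_like n k (\<lambda>x. real (c x))"
      unfolding bead_like_def
    proof (intro conjI allI impI)
      fix h assume h: "h < n"
      show "strict_mono_on {1..k} (\<lambda>j. real (c (h, j)))" using mono[OF v h] by (simp add: c_def)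
      show "interlaced k (\<lambda>j. real (c (h, j))) (\<lambda>j. real (c ((h + 1) mod n, j)))"
        using ld[OF h] ne[OF h]
          interlaced_iff_leads[of k "\<lambda>j. real (c (h, j))" "\<lambda>j. real (c ((h + 1) mod n, j))"]
        by (simp split: if_splits)
    qed
    have "array_start n c = X"
    proof (rule set_eqI)
      fix h
      show "h \<in> array_start n c \<longleftrightarrow> h \<in> X"
      proof (cases "h < n")
        case True
        have "c (h, 1) \<noteq> c (Suc h mod n, 1)" using ne[OF True, of 1 1] k by simp
        moreover have "if h \<in> X then c (Suc h mod n, 1) \<le> c (h, 1) else c (h, 1) \<le> c (Suc h mod n, 1)"
          using ld[OF True] k by (auto simp: leads_def split: if_splits)
        ultimately show ?thesis using True by (auto simp: array_start_def split: if_splits)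
      next
        case False
        then show ?thesis using X(1) by (auto simp: array_start_def)
      qed
    qed
    then have "array_occupation n (\<lambda>x. real (c x)) = l"
      using X(2) by (simp add: array_occupation_eq)
    moreover have "c \<in> {..<n} \<times> {1..k} \<rightarrow>\<^sub>E {..<M}"
      using mem(1)[OF v] len[OF v] by (auto simp: c_def word_array_def intro!: PiE_I)
    ultimately show "word_array n k v \<in> slot_arrays n k l M"
      using inj bl by (simp add: slot_arrays_def flip: c_def)
  qed
qed simp

section \<open>Many closed words\<close>

definition moves :: "nat \<Rightarrow> (nat set \<times> nat set) set" where
  "moves n = {(X, Y). X \<subseteq> {..<n} \<and> (\<exists>h\<in>movable n X. Y = jump n h X)}"

text \<open>
  The graph of moves is Eulerian: at each state the numbers of outgoing and of incoming moves both count the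
  runs of occupied sites. This is why reachability turns out to be symmetric.
\<close>

lemma card_movable_eq:
  assumes "X \<subseteq> {..<n}"
  shows "card (movable n X) = card {h. h < n \<and> h \<in> X \<and> pred_string n h \<notin> X}"
proof -
  define S where "S = {h. h < n \<and> pred_string n h \<in> X}"
  have fin: "finite X" "finite S" using assms finite_subset by (auto simp: S_def)
  have "pred_string n ` S = X"
  proof (intro equalityI subsetI)
    fix h assume "h \<in> X"
    then have h: "h < n" using assms by auto
    have "pred_string n (Suc h mod n) = h" "Suc h mod n < n"
      using pred_succ_string[OF h] h by simp_all
    with \<open>h \<in> X\<close> have "Suc h mod n \<in> S" "h = pred_string n (Suc h mod n)"
      unfolding S_def by simp_all
    then show "h \<in> pred_string n ` S" by (rule image_eqI[rotated])
  qed (auto simp: S_def)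
  moreover have "inj_on (pred_string n) S"
    unfolding S_def by (intro inj_onI) (metis (mono_tags, lifting) mem_Collect_eq succ_pred_string)
  ultimately have "card S = card X" using card_image by metis
  moreover have "movable n X = S - X" by (auto simp: movable_def S_def)
  moreover have "{h. h < n \<and> h \<in> X \<and> pred_string n h \<notin> X} = X - S"
    using assms by (auto simp: S_def)
  ultimately show ?thesis
    using card_Diff_subset_Int[of S X] card_Diff_subset_Int[of X S] fin by (simp add: Int_commute)
qed

lemma jump_properties:
  assumes "n \<ge> 2" "h \<in> movable n X"
  shows "h \<in> jump n h X" "pred_string n h \<notin> jump n h X" "insert (pred_string n h) (jump n h X - {h}) = X"
  using assms pred_string_neq[of h n] by (auto simp: movable_def jump_def)

text \<open>\<open>E\<close> lists the moves out of R and \<open>I\<close> the moves into R, each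
  labelled by the string of the hop. As R is closed, \<open>f\<close> embeds E into I. Both have the
  same size by \<open>card_movable_eq\<close>, so every move into R starts in R.\<close>

lemma moves_predecessor_closed:
  assumes n: "n \<ge> 2" and R: "R \<subseteq> Pow {..<n}" and closed: "\<And>X Y. X \<in> R \<Longrightarrow> (X, Y) \<in> moves n \<Longrightarrow> Y \<in> R"
    and XY: "(X, Y) \<in> moves n" and Y: "Y \<in> R"
  shows "X \<in> R"
proof -
  define E where "E = Sigma R (movable n)"
  define I where "I = Sigma R (\<lambda>Z. {h. h < n \<and> h \<in> Z \<and> pred_string n h \<notin> Z})"
  define f where "f = (\<lambda>(Z, h). (jump n h Z, h))"
  have finR: "finite R" using R by (rule finite_subset) simp
  have finI: "finite I" using finR by (simp add: I_def)
  have "card E = card I"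
    using finR R unfolding E_def I_def by (subst card_SigmaI; simp) (intro sum.cong refl card_movable_eq, auto)
  have f_I: "f ` E \<subseteq> I"
  proof
    fix x assume "x \<in> f ` E"
    then obtain Z h where "(Z, h) \<in> E" "x = f (Z, h)" by auto
    then have Z: "Z \<in> R" "h \<in> movable n Z" by (auto simp: E_def)
    then have "(Z, jump n h Z) \<in> moves n" using R by (auto simp: moves_def)
    then have "jump n h Z \<in> R" using closed Z(1) by blast
    then show "x \<in> I"
      unfolding \<open>x = f (Z, h)\<close>
      using jump_properties(1,2)[OF n Z(2)] Z(2) by (simp add: f_def I_def movable_def)
  qed
  have "inj_on f E"
  proof (rule inj_onI)
    fix x y assume xy: "x \<in> E" "y \<in> E" "f x = f y"
    obtain Z h W g where [simp]: "x = (Z, h)" "y = (W, g)" by fastforce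
    have "h = g" "jump n h Z = jump n h W" using xy by (auto simp: f_def)
    moreover have "h \<in> movable n Z" "g \<in> movable n W" using xy by (auto simp: E_def)
    ultimately show "x = y" using jump_properties(3)[OF n, of h] by (metis \<open>x = (Z, h)\<close> \<open>y = (W, g)\<close>)
  qed
  then have "f ` E = I"
    using f_I finI \<open>card E = card I\<close> by (intro card_subset_eq) (simp_all add: card_image)
  obtain h where h: "h \<in> movable n X" "Y = jump n h X" using XY by (auto simp: moves_def)
  then have "(Y, h) \<in> I" using Y jump_properties(1,2)[OF n h(1)] by (simp add: I_def movable_def)
  then obtain Z where Z: "(Z, h) \<in> E" "jump n h Z = Y" using \<open>f ` E = I\<close> by (auto simp: f_def)
  then have "Z = X" using jump_properties(3)[OF n, of h] h by (metis E_def mem_Sigma_iff)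
  then show ?thesis using Z by (simp add: E_def)
qed

lemma moves_subset: "(X, Y) \<in> moves n \<Longrightarrow> Y \<subseteq> {..<n}"
  unfolding moves_def using jump_subset by blast

lemma moves_rtrancl_subset: "(X, Y) \<in> (moves n)\<^sup>* \<Longrightarrow> X \<subseteq> {..<n} \<Longrightarrow> Y \<subseteq> {..<n}"
  by (induction rule: rtrancl_induct) (simp_all add: moves_subset)

lemma moves_rtrancl_sym:
  assumes n: "n \<ge> 2" and "(X, Y) \<in> (moves n)\<^sup>*"
  shows "(Y, X) \<in> (moves n)\<^sup>*"
  using assms(2)
proof (induction rule: rtrancl_induct)
  case (step Y Z)
  \<comment> \<open>The set reachable from Z is closed under moves and contains Z, so by double
    counting it also contains the predecessor Y of Z.\<close>
  define R where "R = {W. (Z, W) \<in> (moves n)\<^sup>*}"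
  have "Z \<subseteq> {..<n}" using step.hyps(2) by (rule moves_subset)
  then have "R \<subseteq> Pow {..<n}" using moves_rtrancl_subset unfolding R_def by blast
  moreover have "Z \<in> R" by (simp add: R_def)
  ultimately have "Y \<in> R"
    using step.hyps(2) by (intro moves_predecessor_closed[OF n, of R Y Z]) (auto simp: R_def)
  with step.IH show ?case by (auto simp: R_def)
qed simp

lemma word_imp_moves: "X \<subseteq> {..<n} \<Longrightarrow> legal n X v \<Longrightarrow> (X, final n X v) \<in> (moves n)\<^sup>*"
proof (induction v arbitrary: X)
  case (Cons a v)
  show ?case
  proof (cases "a < n")
    case True
    then have a: "a \<in> movable n X" "legal n (jump n a X) v" using Cons.prems by auto
    then have "(X, jump n a X) \<in> moves n" using Cons.prems(1) by (auto simp: moves_def)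
    moreover have "(jump n a X, final n (jump n a X) v) \<in> (moves n)\<^sup>*"
      using Cons.IH[OF jump_subset[OF Cons.prems(1) a(1)] a(2)] .
    ultimately show ?thesis using True by (simp add: converse_rtrancl_into_rtrancl)
  next
    case False
    then show ?thesis using Cons by simp
  qed
qed simp

lemma moves_imp_word:
  assumes "(X, Y) \<in> (moves n)\<^sup>*"
  shows "\<exists>v. legal n X v \<and> final n X v = Y \<and> length v = jumps n v"
  using assms
proof (induction rule: rtrancl_induct)
  case base
  show ?case by (intro exI[of _ "[]"]) (simp add: jumps_def)
next
  case (step Y Z)
  then obtain v where v: "legal n X v" "final n X v = Y" "length v = jumps n v" by blast
  obtain h where h: "h \<in> movable n Y" "Z = jump n h Y" using step.hyps(2) by (auto simp: moves_def)
  then have "h < n" by (simp add: movable_def)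
  with v h show ?case
    by (intro exI[of _ "v @ [h]"]) (simp add: legal_append final_append jumps_def)
qed

text \<open>One full turn: starting from the block \<open>{..<l}\<close>, the front particle runs around the ring to the site
  behind the block, and then the other particles close the gap one after the other.\<close>

lemma full_turn:
  assumes "0 < l" "l < n"
  shows "\<exists>v. legal n {..<l} v \<and> final n {..<l} v = {..<l} \<and> length v = n \<and> jumps n v = n"
proof -
  have up: "legal n {..<l} [l..<m] \<and> final n {..<l} [l..<m] = insert (m - 1) {..<l - 1}"
    if "l \<le> m" "m \<le> n" for m
    using that
  proof (induction m rule: dec_induct)
    case base
    have "insert (l - 1) {..<l - 1} = {..<l}" using assms by auto
    then show ?case by simp
  next
    case (step m)
    then have m: "m < n" "m > 0" using assms by auto
    define X where "X = insert (m - 1) {..<l - 1}"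
    have "pred_string n m = m - 1" using m by (simp add: pred_string_eq)
    then have "m \<in> movable n X" "jump n m X = insert m {..<l - 1}"
      using m step.hyps assms by (auto simp: X_def movable_def jump_def)
    with step m show ?case
      unfolding X_def by (simp add: legal_append final_append)
  qed
  have down: "legal n (insert (n - 1) {..<l - 1}) (rev [m..<l]) \<and>
      final n (insert (n - 1) {..<l - 1}) (rev [m..<l]) = insert (n - 1) ({..<l} - {m - 1})"
    if "1 \<le> m" "m \<le> l" for m
    using that(2,1)
  proof (induction m rule: inc_induct)
    case base
    have "{..<l - 1} = {..<l} - {l - 1}" using assms by auto
    then show ?case by simp
  next
    case (step m)
    define X where "X = insert (n - 1) ({..<l} - {m})"
    have "pred_string n m = m - 1" using step assms by (simp add: pred_string_eq)
    then have "m \<in> movable n X" "jump n m X = insert (n - 1) ({..<l} - {m - 1})"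
      using step.hyps step.prems assms by (auto simp: X_def movable_def jump_def)
    moreover have "rev [m..<l] = rev [Suc m..<l] @ [m]" using step.hyps by (simp add: upt_conv_Cons)
    ultimately show ?case
      using step assms unfolding X_def by (simp add: legal_append final_append)
  qed
  define Z where "Z = insert (n - 1) ({..<l} - {0})"
  have p0: "pred_string n 0 = n - 1" using assms by (simp add: pred_string_eq)
  have "0 \<in> movable n Z" "jump n 0 Z = {..<l}"
    using assms p0 by (auto simp: Z_def movable_def jump_def)
  then have last: "legal n Z [0]" "final n Z [0] = {..<l}" using assms by auto
  define v where "v = [l..<n] @ rev [1..<l] @ [0]"
  have "legal n {..<l} v" "final n {..<l} v = {..<l}"
    using up[of n] down[of 1] last assms unfolding v_def legal_append final_append by (auto simp: Z_def)
  moreover have "length v = n" using assms by (simp add: v_def)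
  moreover have "jumps n v = n" using assms by (auto simp: v_def jumps_def filter_id_conv)
  ultimately show ?thesis by blast
qed

lemma repeat_word:
  assumes "legal n X v" "final n X v = X"
  shows "legal n X (concat (replicate a v)) \<and> final n X (concat (replicate a v)) = X \<and>
    jumps n (concat (replicate a v)) = a * jumps n v"
  using assms by (induction a) (simp_all add: legal_append final_append jumps_append, simp add: jumps_def)

text \<open>Free words of length M - D are counted from below by \<open>sum_ground_words\<close>
  together with \<open>ground_le_1\<close>; each is then closed by a return word chosen from its end
  state alone. All return words have the same length D, which depends on neither M nor k, so the
  free part can be read off from the closed word.\<close>

lemma card_closed_words_ge:
  assumes l: "0 < l" "l < n" and n: "n \<ge> 2"
  shows "\<exists>D (\<delta> :: real). \<delta> > 0 \<and> (\<forall>M k. D \<le> n * k \<longrightarrow> n * k \<le> M \<longrightarrow>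
      \<delta> * real ((M - D) choose (n * k - D)) * top_eigenvalue n l ^ (n * k - D)
        \<le> real (card {v \<in> words n M (n * k) {..<l}. final n {..<l} v = {..<l}}))"
proof -
  define X where "X = {..<l}"
  have X: "X \<subseteq> {..<n}" "card X = l" using l by (auto simp: X_def)
  \<comment> \<open>Closed words have a multiple of n hops, so a return word to X has one precisely
    when the free word before it has. For the ends in \<open>\<Y>\<close> the return lengths
    therefore differ by multiples of n.\<close>
  define \<Y> where "\<Y> = {Y. \<exists>v. legal n X v \<and> final n X v = Y \<and> n dvd jumps n v}"
  have Y_sub: "\<Y> \<subseteq> Pow {..<n}" using final_subset_card[OF X(1)] by (auto simp: \<Y>_def)
  then have finY: "finite \<Y>" by (rule finite_subset) simp
  have "\<exists>u a. legal n Y u \<and> final n Y u = X \<and> length u = n * a \<and> jumps n u = n * a"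
    if Y: "Y \<in> \<Y>" for Y
  proof -
    obtain v where v: "legal n X v" "final n X v = Y" "n dvd jumps n v"
      using Y unfolding \<Y>_def by blast
    have "(Y, X) \<in> (moves n)\<^sup>*"
      using moves_rtrancl_sym[OF n] word_imp_moves[OF X(1) v(1)] v(2) by simp
    then obtain u where u: "legal n Y u" "final n Y u = X" "length u = jumps n u"
      using moves_imp_word by blast
    have "legal n X (v @ u)" "final n X (v @ u) = X" using u v by (simp_all add: legal_append final_append)
    then have "n dvd jumps n (v @ u)"
      using closed_word_counts[OF X(1) n, of "v @ u" 0] n by simp
    with v(3) have "n dvd jumps n u" by (simp add: jumps_append dvd_add_right_iff)
    with u show ?thesis by (metis dvdE)
  qed
  then obtain r b where r: "\<And>Y. Y \<in> \<Y> \<Longrightarrow> legal n Y (r Y) \<and> final n Y (r Y) = X \<and>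
      length (r Y) = n * b Y \<and> jumps n (r Y) = n * b Y" by metis
  define a where "a = Max (insert 0 (b ` \<Y>))"
  have b_le: "b Y \<le> a" if "Y \<in> \<Y>" for Y
    using finY that by (simp add: a_def)
  obtain turn where turn: "legal n X turn" "final n X turn = X" "length turn = n" "jumps n turn = n"
    using full_turn[OF l] by (auto simp: X_def)
  \<comment> \<open>Full turns, of n hops each and without empty slots, pad all return words to the
    common length n * a.\<close>
  define u where "u Y = r Y @ concat (replicate (a - b Y) turn)" for Y
  have u: "legal n Y (u Y)" "final n Y (u Y) = X" "length (u Y) = n * a" "jumps n (u Y) = n * a"
    if "Y \<in> \<Y>" for Y
  proof -
    note * = repeat_word[OF turn(1,2), of "a - b Y"]
    show "legal n Y (u Y)" "final n Y (u Y) = X"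
      using r[OF that] * by (simp_all add: u_def legal_append final_append)
    have "length (concat (replicate (a - b Y) turn)) = (a - b Y) * n"
      using turn(3) by (simp add: length_concat sum_list_replicate)
    moreover have "b Y * n + (a - b Y) * n = a * n"
      using b_le[OF that] by (simp flip: add_mult_distrib)
    ultimately show "length (u Y) = n * a" "jumps n (u Y) = n * a"
      using r[OF that] * turn by (simp_all add: u_def jumps_append mult.commute)
  qed
  have bound: "ground n X * real ((M - n * a) choose (n * k - n * a)) * top_eigenvalue n l ^ (n * k - n * a)
      \<le> real (card {v \<in> words n M (n * k) X. final n X v = X})"
    if D: "n * a \<le> n * k" "n * k \<le> M" for M k
  proof -
    define W where "W = words n (M - n * a) (n * k - n * a) X"
    have fin_Y: "final n X v \<in> \<Y>" if "v \<in> W" for v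
    proof -
      have "n dvd n * k - n * a" by (simp flip: diff_mult_distrib2)
      with that show ?thesis by (auto simp: W_def words_def \<Y>_def)
    qed
    have "real (card W) \<ge> (\<Sum>v\<in>W. ground n (final n X v))"
      using sum_mono[of W "\<lambda>v. ground n (final n X v)" "\<lambda>_. 1"] ground_le_1 by simp
    moreover have "(\<Sum>v\<in>W. ground n (final n X v))
        = ground n X * real ((M - n * a) choose (n * k - n * a)) * top_eigenvalue n l ^ (n * k - n * a)"
      unfolding W_def sum_ground_words[OF X(1) n] X(2) by (simp only: ac_simps)
    moreover have "card W \<le> card {v \<in> words n M (n * k) X. final n X v = X}"
    proof (rule card_inj_on_le)
      show "inj_on (\<lambda>v. v @ u (final n X v)) W"
      proof (rule inj_onI)
        fix v w assume vw: "v \<in> W" "w \<in> W" "v @ u (final n X v) = w @ u (final n X w)"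
        moreover have "length v = length w" using vw(1,2) by (simp add: W_def words_def)
        ultimately show "v = w" by simp
      qed
      show "(\<lambda>v. v @ u (final n X v)) ` W \<subseteq> {v \<in> words n M (n * k) X. final n X v = X}"
      proof (intro image_subsetI CollectI conjI)
        fix v assume v: "v \<in> W"
        note * = u[OF fin_Y[OF v]]
        have "length v = M - n * a" "jumps n v = n * k - n * a" "legal n X v"
          using v by (simp_all add: W_def words_def)
        moreover have "M - n * a + n * a = M"
          using order_trans[OF D] by (rule le_add_diff_inverse2)
        moreover have "n * k - n * a + n * a = n * k"
          using D(1) by (rule le_add_diff_inverse2)
        ultimately show "v @ u (final n X v) \<in> words n M (n * k) X"
          using * by (simp add: words_def legal_append jumps_append)
        show "final n X (v @ u (final n X v)) = X" using * by (simp add: final_append)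
      qed
    qed simp
    ultimately show ?thesis by linarith
  qed
  show ?thesis
    using ground_pos[OF X(1)] bound unfolding X_def
    by (intro exI[of _ "n * a"] exI[of _ "ground n {..<l}"]) blast
qed

section \<open>Volumes and slot arrays\<close>

definition array_region :: "nat \<Rightarrow> nat \<Rightarrow> nat \<Rightarrow> (nat \<times> nat \<Rightarrow> real) set" where
  "array_region n k l = {t \<in> {..<n} \<times> {1..k} \<rightarrow>\<^sub>E {0..<1}. bead_like n k t \<and> array_occupation n t = l}"

definition slot_box :: "nat \<Rightarrow> nat \<Rightarrow> nat \<Rightarrow> (nat \<times> nat \<Rightarrow> nat) \<Rightarrow> (nat \<times> nat \<Rightarrow> real) set" where
  "slot_box n k M c = (\<Pi>\<^sub>E x\<in>{..<n} \<times> {1..k}. {real (c x) / real M..<(real (c x) + 1) / real M})"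

text \<open>Strings that are not neighbours may share slots. This weaker condition still lets the
  slots decide every comparison in \<open>bead_like\<close> and in the occupation number, and it is
  what glued blocks satisfy.\<close>

definition separated :: "nat \<Rightarrow> nat \<Rightarrow> (nat \<times> nat \<Rightarrow> nat) \<Rightarrow> bool" where
  "separated n k c \<longleftrightarrow> (\<forall>h<n. \<forall>h'\<in>{h, (h + 1) mod n}. \<forall>i\<in>{1..k}. \<forall>j\<in>{1..k}.
     (h, i) \<noteq> (h', j) \<longrightarrow> c (h, i) \<noteq> c (h', j))"

section \<open>Bead configurations as measurable sets of arrays\<close>

lemma interlaced_cong:
  assumes "\<And>j. j \<in> {1..k} \<Longrightarrow> a j = a' j" "\<And>j. j \<in> {1..k} \<Longrightarrow> b j = b' j"
  shows "interlaced k a b \<longleftrightarrow> interlaced k a' b'"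
proof -
  have "(\<forall>j\<in>{1..k}. a j \<le> b j) \<longleftrightarrow> (\<forall>j\<in>{1..k}. a' j \<le> b' j)"
    "(\<forall>j\<in>{1..k}. b j < a j) \<longleftrightarrow> (\<forall>j\<in>{1..k}. b' j < a' j)"
    "(\<forall>j\<in>{1..<k}. b j < a (j + 1)) \<longleftrightarrow> (\<forall>j\<in>{1..<k}. b' j < a' (j + 1))"
    "(\<forall>j\<in>{1..<k}. a j \<le> b (j + 1)) \<longleftrightarrow> (\<forall>j\<in>{1..<k}. a' j \<le> b' (j + 1))"
    using assms by (auto intro!: ball_cong)
  then show ?thesis unfolding interlaced_def by simp
qed

lemma sorted_list_of_set_image:
  fixes f :: "nat \<Rightarrow> 'a::linorder"
  assumes "strict_mono_on {1..k} f" "j \<in> {1..k}"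
  shows "sorted_list_of_set (f ` {1..k}) ! (j - 1) = f j"
proof -
  define xs where "xs = map f [1..<k + 1]"
  have nth: "xs ! i = f (i + 1)" if "i < k" for i
    using that by (simp add: xs_def del: upt_Suc)
  have "sorted_wrt (<) xs"
    unfolding sorted_wrt_iff_nth_less
  proof (intro allI impI)
    fix i j assume ij: "i < j" "j < length xs"
    then have "i < k" "j < k" by (simp_all add: xs_def del: upt_Suc)
    then show "xs ! i < xs ! j" using nth strict_mono_onD[OF assms(1), of "i + 1" "j + 1"] ij(1) by simp
  qed
  then have "sorted xs" "distinct xs" by (simp_all add: strict_sorted_iff)
  moreover have "set xs = f ` {1..k}" by (auto simp: xs_def)
  ultimately have "sorted_list_of_set (f ` {1..k}) = xs"
    using sorted_list_of_set.idem_if_sorted_distinct by metis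
  then show ?thesis using nth[of "j - 1"] assms(2) by auto
qed

lemma Min_strict_mono_image:
  fixes f :: "nat \<Rightarrow> 'a::linorder"
  assumes "strict_mono_on {1..k} f" "k \<ge> 1"
  shows "Min (f ` {1..k}) = f 1"
proof (rule Min_eqI)
  fix y assume "y \<in> f ` {1..k}"
  then obtain j where "j \<in> {1..k}" "y = f j" by blast
  then show "f 1 \<le> y" using strict_mono_on_leD[OF assms(1), of 1 j] by auto
qed (use assms in auto)

lemma bead_configuration_array:
  assumes B: "bead_configuration n k B" and n: "n \<ge> 1"
  defines "t \<equiv> bead_array n k B"
  shows "t \<in> {..<n} \<times> {1..k} \<rightarrow>\<^sub>E {0..<1}" "bead_like n k t" "array_occupation n t = occupation_number n B"
proof -
  have k: "k \<ge> 1" and sub: "B \<subseteq> threaded_torus n" and card: "\<And>h. h < n \<Longrightarrow> card (string_coords B h) = k"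
    and inter: "\<And>h. h < n \<Longrightarrow> interlaced k (bead_coord B h) (bead_coord B ((h + 1) mod n))"
    using B by (auto simp: bead_configuration_def)
  have fin: "finite (string_coords B h)" if "h < n" for h
    using card[OF that] k by (intro card_ge_0_finite) simp
  have t_eq: "t (h, j) = sorted_list_of_set (string_coords B h) ! (j - 1)" if "h < n" "j \<in> {1..k}" for h j
    using that by (simp add: t_def bead_array_def bead_coord_def)
  have mono: "strict_mono_on {1..k} (\<lambda>j. t (h, j))" if "h < n" for h
  proof (rule strict_mono_onI)
    fix i j assume "i \<in> {1..k}" "j \<in> {1..k}" "i < j"
    then show "t (h, i) < t (h, j)"
      using strict_mono_onD[OF nth_sorted_list_of_set(1)[OF fin card, OF that that]] t_eq[OF that] by simp
  qed
  have img: "(\<lambda>j. t (h, j)) ` {1..k} = string_coords B h" if "h < n" for h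
  proof -
    have "(\<lambda>j. t (h, j)) ` {1..k} = (\<lambda>j. sorted_list_of_set (string_coords B h) ! (j - 1)) ` {1..k}"
      by (intro image_cong refl t_eq that)
    then show ?thesis using nth_sorted_list_of_set(2)[OF fin card, OF that that] by simp
  qed
  have "t (h, j) \<in> {0..<1}" if "h < n" "j \<in> {1..k}" for h j
  proof -
    have "t (h, j) \<in> string_coords B h" using img[OF that(1)] that(2) by blast
    then show ?thesis using sub by (auto simp: string_coords_def threaded_torus_def)
  qed
  moreover have "t \<in> extensional ({..<n} \<times> {1..k})" by (simp add: t_def bead_array_def)
  ultimately show "t \<in> {..<n} \<times> {1..k} \<rightarrow>\<^sub>E {0..<1}" by (auto simp: PiE_def)
  have "interlaced k (\<lambda>j. t (h, j)) (\<lambda>j. t ((h + 1) mod n, j))" if "h < n" for h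
  proof -
    have "(h + 1) mod n < n" using n by simp
    then show ?thesis
      using inter[OF that] that
      by (subst interlaced_cong[of k _ "bead_coord B h" _ "bead_coord B ((h + 1) mod n)"])
         (simp_all only: t_eq bead_coord_def)
  qed
  with mono show "bead_like n k t" by (simp add: bead_like_def)
  have "Min (string_coords B h) = t (h, 1)" if "h < n" for h
    using Min_strict_mono_image[OF mono[OF that] k] img[OF that] by simp
  then show "array_occupation n t = occupation_number n B"
    unfolding array_occupation_def occupation_number_def pred_string_def[symmetric]
    using pred_string_less by (intro arg_cong[where f = card]) auto
qed

lemma bead_array_image:
  assumes n: "n \<ge> 1" and k: "k \<ge> 1"
  shows "bead_array n k ` {B. bead_configuration n k B \<and> occupation_number n B = l} = array_region n k l"
proof (intro equalityI subsetI)
  fix t assume "t \<in> bead_array n k ` {B. bead_configuration n k B \<and> occupation_number n B = l}"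
  then obtain B where "bead_configuration n k B" "occupation_number n B = l" "t = bead_array n k B" by blast
  then show "t \<in> array_region n k l"
    using bead_configuration_array[OF _ n] by (simp add: array_region_def)
next
  fix t assume t: "t \<in> array_region n k l"
  define B where "B = (\<lambda>(h, j). (t (h, j), h)) ` ({..<n} \<times> {1..k})"
  have mono: "strict_mono_on {1..k} (\<lambda>j. t (h, j))"
    and inter: "interlaced k (\<lambda>j. t (h, j)) (\<lambda>j. t ((h + 1) mod n, j))" if "h < n" for h
    using t that by (auto simp: array_region_def bead_like_def)
  have range: "t \<in> {..<n} \<times> {1..k} \<rightarrow>\<^sub>E {0..<1}" using t by (simp add: array_region_def)
  have coords: "string_coords B h = (\<lambda>j. t (h, j)) ` {1..k}" if "h < n" for h
    using that by (auto simp: string_coords_def B_def)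
  have coord: "bead_coord B h j = t (h, j)" if "h < n" "j \<in> {1..k}" for h j
    unfolding bead_coord_def coords[OF that(1)] using mono[OF that(1)] that(2) by (rule sorted_list_of_set_image)
  have array: "bead_array n k B = t"
  proof (rule PiE_ext[of _ "{..<n} \<times> {1..k}" "\<lambda>_. UNIV"])
    show "bead_array n k B \<in> {..<n} \<times> {1..k} \<rightarrow>\<^sub>E UNIV"
      by (simp add: bead_array_def)
    show "t \<in> {..<n} \<times> {1..k} \<rightarrow>\<^sub>E UNIV" using range by (auto simp: PiE_def)
  qed (auto simp: bead_array_def coord)
  have "bead_configuration n k B"
    unfolding bead_configuration_def
  proof (intro conjI allI impI k)
    have "t (h, j) \<in> {0..<1}" if "h < n" "j \<in> {1..k}" for h j
      using range that by (intro PiE_mem[of t]) auto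
    then show "B \<subseteq> threaded_torus n" by (auto simp: B_def threaded_torus_def)
    fix h assume h: "h < n"
    show "card (string_coords B h) = k"
      using strict_mono_on_imp_inj_on[OF mono[OF h]] by (simp add: coords[OF h] card_image)
    have "(h + 1) mod n < n" using n by simp
    then show "interlaced k (bead_coord B h) (bead_coord B ((h + 1) mod n))"
      using inter[OF h] h coord
      by (subst interlaced_cong[of k _ "\<lambda>j. t (h, j)" _ "\<lambda>j. t ((h + 1) mod n, j)"]) auto
  qed
  moreover from bead_configuration_array(3)[OF this n] have "occupation_number n B = l"
    using t by (simp add: array array_region_def)
  ultimately show "t \<in> bead_array n k ` {B. bead_configuration n k B \<and> occupation_number n B = l}"
    using array by blast
qed

lemma bead_volume_eq:
  "n \<ge> 1 \<Longrightarrow> k \<ge> 1 \<Longrightarrow>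
    bead_volume n k l = measure (Pi\<^sub>M ({..<n} \<times> {1..k}) (\<lambda>_. lborel)) (array_region n k l)"
  by (simp add: bead_volume_def bead_array_image)

lemma sets_array_region:
  assumes n: "n \<ge> 1" and k: "k \<ge> 1"
  shows "array_region n k l \<in> sets (Pi\<^sub>M ({..<n} \<times> {1..k}) (\<lambda>_. lborel))"
proof -
  define I where "I = {..<n} \<times> {1..k}"
  define P where "P = Pi\<^sub>M I (\<lambda>_. lborel :: real measure)"
  have comp: "(\<lambda>t. t x) \<in> borel_measurable P" if "x \<in> I" for x
    using measurable_component_singleton[OF that, of "\<lambda>_. lborel :: real measure"]
    by (simp add: P_def measurable_lborel2)
  have less: "Measurable.pred P (\<lambda>t. t x < t y)" if "x \<in> I" "y \<in> I" for x y
    unfolding pred_def by (rule borel_measurable_less[OF comp[OF that(1)] comp[OF that(2)]])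
  have mem: "(h, j) \<in> I" if "h < n" "j \<in> {1..k}" for h j using that by (simp add: I_def)
  have mono: "Measurable.pred P (\<lambda>t. strict_mono_on {1..k} (\<lambda>j. t (h, j)))" if "h < n" for h
  proof -
    define A where "A = {p \<in> {1..k} \<times> {1..k}. fst p < snd p}"
    have "Measurable.pred P (\<lambda>t. \<forall>p\<in>A. t (h, fst p) < t (h, snd p))"
      by (intro pred_intros_finite less mem that) (auto simp: A_def)
    moreover have "strict_mono_on {1..k} (\<lambda>j. t (h, j)) \<longleftrightarrow> (\<forall>p\<in>A. t (h, fst p) < t (h, snd p))" for t :: "nat \<times> nat \<Rightarrow> real"
      unfolding strict_mono_on_def A_def by auto
    ultimately show ?thesis by simp
  qed
  have inter: "Measurable.pred P (\<lambda>t. interlaced k (\<lambda>j. t (h, j)) (\<lambda>j. t (h', j)))" if "h < n" "h' < n" for h h'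
    unfolding interlaced_def not_less[symmetric] using that
    by (intro pred_intros_finite pred_intros_logic less mem) auto
  have occ: "Measurable.pred P (\<lambda>t. array_occupation n t = l)"
  proof -
    \<comment> \<open>For measurability, the cardinality is replaced by a finite disjunction over
      the possible sets of descents.\<close>
    have "array_occupation n t = l \<longleftrightarrow>
        (\<exists>S\<in>{S \<in> Pow {..<n}. card S = l}. \<forall>h\<in>{..<n}. h \<in> S \<longleftrightarrow> t (h, 1) < t (pred_string n h, 1))" for t
    proof
      assume "array_occupation n t = l"
      then show "\<exists>S\<in>{S \<in> Pow {..<n}. card S = l}. \<forall>h\<in>{..<n}. h \<in> S \<longleftrightarrow> t (h, 1) < t (pred_string n h, 1)"
        by (intro bexI[of _ "{h. h < n \<and> t (h, 1) < t (pred_string n h, 1)}"]) (auto simp: array_occupation_def)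
    next
      assume "\<exists>S\<in>{S \<in> Pow {..<n}. card S = l}. \<forall>h\<in>{..<n}. h \<in> S \<longleftrightarrow> t (h, 1) < t (pred_string n h, 1)"
      then obtain S where S: "S \<subseteq> {..<n}" "card S = l" "\<forall>h\<in>{..<n}. h \<in> S \<longleftrightarrow> t (h, 1) < t (pred_string n h, 1)"
        by auto
      then have "{h. h < n \<and> t (h, 1) < t (pred_string n h, 1)} = S" by auto
      then show "array_occupation n t = l" using S(2) by (simp add: array_occupation_def)
    qed
    moreover have "Measurable.pred P (\<lambda>t. \<exists>S\<in>{S \<in> Pow {..<n}. card S = l}. \<forall>h\<in>{..<n}. h \<in> S \<longleftrightarrow> t (h, 1) < t (pred_string n h, 1))"
      using k pred_string_less
      by (intro pred_intros_finite pred_intros_logic less mem) auto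
    ultimately show ?thesis by simp
  qed
  have "Measurable.pred P (\<lambda>t. t x \<in> {0..<1})" if "x \<in> I" for x
  proof -
    have "{t \<in> space P. t x \<in> {0..<1}} = (\<lambda>t. t x) -` {0..<1} \<inter> space P" by auto
    also have "\<dots> \<in> sets P" by (rule measurable_sets[OF comp[OF that]]) simp
    finally show ?thesis unfolding pred_def .
  qed
  then have range: "Measurable.pred P (\<lambda>t. \<forall>x\<in>I. t x \<in> {0..<1})"
    by (intro pred_intros_finite) (simp_all add: I_def)
  have like: "Measurable.pred P (bead_like n k)"
  proof -
    have "Measurable.pred P (\<lambda>t. \<forall>h\<in>{..<n}. strict_mono_on {1..k} (\<lambda>j. t (h, j)))"
      by (intro pred_intros_finite mono) simp_all
    moreover have "Measurable.pred P (\<lambda>t. \<forall>h\<in>{..<n}. interlaced k (\<lambda>j. t (h, j)) (\<lambda>j. t ((h + 1) mod n, j)))"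
      using n by (intro pred_intros_finite inter) simp_all
    ultimately have "Measurable.pred P (\<lambda>t. (\<forall>h\<in>{..<n}. strict_mono_on {1..k} (\<lambda>j. t (h, j))) \<and>
        (\<forall>h\<in>{..<n}. interlaced k (\<lambda>j. t (h, j)) (\<lambda>j. t ((h + 1) mod n, j))))"
      by (rule pred_intros_logic(3))
    moreover have "bead_like n k = (\<lambda>t. (\<forall>h\<in>{..<n}. strict_mono_on {1..k} (\<lambda>j. t (h, j))) \<and>
        (\<forall>h\<in>{..<n}. interlaced k (\<lambda>j. t (h, j)) (\<lambda>j. t ((h + 1) mod n, j))))"
      unfolding bead_like_def fun_eq_iff Ball_def lessThan_iff by (rule allI) (rule refl)
    ultimately show ?thesis by (simp only:)
  qed
  have "Measurable.pred P (\<lambda>t. (\<forall>x\<in>I. t x \<in> {0..<1}) \<and> bead_like n k t \<and> array_occupation n t = l)"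
    by (rule pred_intros_logic(3)[OF range pred_intros_logic(3)[OF like occ]])
  moreover have "array_region n k l
      = {t \<in> space P. (\<forall>x\<in>I. t x \<in> {0..<1}) \<and> bead_like n k t \<and> array_occupation n t = l}"
  proof -
    have "t \<in> I \<rightarrow>\<^sub>E {0..<1} \<longleftrightarrow> t \<in> space P \<and> (\<forall>x\<in>I. t x \<in> {0..<1})" for t
      unfolding P_def space_PiM PiE_iff by auto
    then show ?thesis unfolding array_region_def I_def[symmetric] by blast
  qed
  ultimately show ?thesis unfolding P_def I_def pred_def by simp
qed

section \<open>Boxes of slots and their volume\<close>

lemma slot_box_mem:
  assumes "t \<in> slot_box n k M c" "h < n" "j \<in> {1..k}"
  shows "real (c (h, j)) / real M \<le> t (h, j)" "t (h, j) < (real (c (h, j)) + 1) / real M"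
  using PiE_mem[OF assms(1)[unfolded slot_box_def], of "(h, j)"] assms(2,3) by auto

lemma slot_box_less_iff:
  assumes t: "t \<in> slot_box n k M c" and M: "M > 0"
    and x: "h < n" "i \<in> {1..k}" and y: "h' < n" "j \<in> {1..k}" and ne: "c (h, i) \<noteq> c (h', j)"
  shows "t (h, i) < t (h', j) \<longleftrightarrow> c (h, i) < c (h', j)"
proof -
  have *: "t (a, b) < t (a', b')" if "a < n" "b \<in> {1..k}" "a' < n" "b' \<in> {1..k}" "c (a, b) < c (a', b')"
    for a b a' b'
  proof -
    have "t (a, b) < (real (c (a, b)) + 1) / real M" using slot_box_mem[OF t that(1,2)] by simp
    also have "\<dots> \<le> real (c (a', b')) / real M" using that(5) by (intro divide_right_mono) auto
    also have "\<dots> \<le> t (a', b')" using slot_box_mem[OF t that(3,4)] by simp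
    finally show ?thesis .
  qed
  show ?thesis
  proof (cases "c (h, i) < c (h', j)")
    case True
    with *[OF x y] show ?thesis by simp
  next
    case False
    with ne have "c (h', j) < c (h, i)" by simp
    from *[OF y x this] False show ?thesis by simp
  qed
qed

lemma interlaced_transfer:
  fixes a b a' b' :: "nat \<Rightarrow> real"
  assumes "\<And>i j. i \<in> {1..k} \<Longrightarrow> j \<in> {1..k} \<Longrightarrow> a i < b j \<longleftrightarrow> a' i < b' j"
    and "\<And>i j. i \<in> {1..k} \<Longrightarrow> j \<in> {1..k} \<Longrightarrow> b j < a i \<longleftrightarrow> b' j < a' i"
  shows "interlaced k a b \<longleftrightarrow> interlaced k a' b'"
proof -
  have "(\<forall>j\<in>{1..k}. a j \<le> b j) \<longleftrightarrow> (\<forall>j\<in>{1..k}. a' j \<le> b' j)"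
    "(\<forall>j\<in>{1..k}. b j < a j) \<longleftrightarrow> (\<forall>j\<in>{1..k}. b' j < a' j)"
    "(\<forall>j\<in>{1..<k}. b j < a (j + 1)) \<longleftrightarrow> (\<forall>j\<in>{1..<k}. b' j < a' (j + 1))"
    "(\<forall>j\<in>{1..<k}. a j \<le> b (j + 1)) \<longleftrightarrow> (\<forall>j\<in>{1..<k}. a' j \<le> b' (j + 1))"
    unfolding not_less[symmetric] using assms by (auto intro!: ball_cong)
  then show ?thesis unfolding interlaced_def by simp
qed

lemma slot_box_transfer:
  assumes n: "n \<ge> 2" and k: "k \<ge> 1" and M: "M > 0" and c: "separated n k c" and t: "t \<in> slot_box n k M c"
  shows "bead_like n k t \<longleftrightarrow> bead_like n k (\<lambda>x. real (c x))"
    and "array_occupation n t = array_occupation n (\<lambda>x. real (c x))"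
proof -
  have same: "t (h, i) < t (h, j) \<longleftrightarrow> real (c (h, i)) < real (c (h, j))"
    if "h < n" "i \<in> {1..k}" "j \<in> {1..k}" for h i j
  proof (cases "i = j")
    case False
    then have "c (h, i) \<noteq> c (h, j)" using c that by (auto simp: separated_def)
    then show ?thesis using slot_box_less_iff[OF t M that(1,2,1,3)] by simp
  qed simp
  have adj: "t (h, i) < t (Suc h mod n, j) \<longleftrightarrow> real (c (h, i)) < real (c (Suc h mod n, j))"
    "t (Suc h mod n, j) < t (h, i) \<longleftrightarrow> real (c (Suc h mod n, j)) < real (c (h, i))"
    if "h < n" "i \<in> {1..k}" "j \<in> {1..k}" for h i j
  proof -
    have "Suc h mod n < n" using n by simp
    moreover have "Suc h mod n \<noteq> h" using succ_string_eq[OF that(1)] n that(1) by auto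
    then have "c (h, i) \<noteq> c (Suc h mod n, j)" using c that by (auto simp: separated_def)
    ultimately show "t (h, i) < t (Suc h mod n, j) \<longleftrightarrow> real (c (h, i)) < real (c (Suc h mod n, j))"
      "t (Suc h mod n, j) < t (h, i) \<longleftrightarrow> real (c (Suc h mod n, j)) < real (c (h, i))"
      using slot_box_less_iff[OF t M that(1,2) _ that(3), of "Suc h mod n"]
        slot_box_less_iff[OF t M _ that(3,1,2), of "Suc h mod n"] by auto
  qed
  have "strict_mono_on {1..k} (\<lambda>j. t (h, j)) \<longleftrightarrow> strict_mono_on {1..k} (\<lambda>j. real (c (h, j)))" if "h < n" for h
    using same[OF that] unfolding strict_mono_on_def by blast
  moreover have "interlaced k (\<lambda>j. t (h, j)) (\<lambda>j. t ((h + 1) mod n, j)) \<longleftrightarrow>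
      interlaced k (\<lambda>j. real (c (h, j))) (\<lambda>j. real (c ((h + 1) mod n, j)))" if "h < n" for h
    using adj[OF that] by (intro interlaced_transfer) simp_all
  ultimately show "bead_like n k t \<longleftrightarrow> bead_like n k (\<lambda>x. real (c x))"
    unfolding bead_like_def by simp
  have "t (h, 1) < t (pred_string n h, 1) \<longleftrightarrow> real (c (h, 1)) < real (c (pred_string n h, 1))" if "h < n" for h
    using adj(2)[OF pred_string_less[OF that], of 1 1] succ_pred_string[OF that] k by simp
  then show "array_occupation n t = array_occupation n (\<lambda>x. real (c x))"
    unfolding array_occupation_def by (intro arg_cong[where f = card]) auto
qed

lemma slot_box_measure:
  assumes "M > 0"
  shows "slot_box n k M c \<in> sets (Pi\<^sub>M ({..<n} \<times> {1..k}) (\<lambda>_. lborel))"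
    and "emeasure (Pi\<^sub>M ({..<n} \<times> {1..k}) (\<lambda>_. lborel)) (slot_box n k M c) = ennreal ((1 / real M) ^ (n * k))"
proof -
  interpret product_sigma_finite "\<lambda>_ :: nat \<times> nat. lborel :: real measure"
    by standard
  show "slot_box n k M c \<in> sets (Pi\<^sub>M ({..<n} \<times> {1..k}) (\<lambda>_. lborel))"
    unfolding slot_box_def by (intro sets_PiM_I_finite) auto
  have len: "emeasure lborel {real (c x) / real M..<(real (c x) + 1) / real M} = ennreal (1 / real M)" for x
    using assms by (subst emeasure_lborel_Ico) (auto simp: divide_right_mono diff_divide_distrib[symmetric])
  have "emeasure (Pi\<^sub>M ({..<n} \<times> {1..k}) (\<lambda>_. lborel)) (slot_box n k M c)
      = (\<Prod>x\<in>{..<n} \<times> {1..k}. emeasure lborel {real (c x) / real M..<(real (c x) + 1) / real M})"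
    unfolding slot_box_def by (intro emeasure_PiM) auto
  also have "\<dots> = ennreal ((1 / real M) ^ (n * k))"
    unfolding len by (simp add: ennreal_power card_cartesian_product)
  finally show "emeasure (Pi\<^sub>M ({..<n} \<times> {1..k}) (\<lambda>_. lborel)) (slot_box n k M c) = ennreal ((1 / real M) ^ (n * k))" .
qed

text \<open>Each configuration lies in the box of its own slots. If these are all different, they
  form a slot array. The boxes of all assignments with a repeated slot, the set F - J, are counted
  in full and give the second term, which vanishes as M grows with n * k fixed.\<close>

lemma bead_volume_upper:
  assumes n: "n \<ge> 2" and k: "k \<ge> 1" and M: "M > 0" and le: "n * k \<le> M"
  shows "bead_volume n k l \<le> real (card (slot_arrays n k l M)) / real M ^ (n * k)
    + (1 - (\<Prod>i<n * k. real M - real i) / real M ^ (n * k))"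
proof -
  define I where "I = {..<n} \<times> {1..k}"
  define P where "P = Pi\<^sub>M I (\<lambda>_. lborel :: real measure)"
  define F where "F = I \<rightarrow>\<^sub>E {..<M}"
  define J where "J = {c \<in> F. inj_on c I}"
  define G where "G = slot_arrays n k l M \<union> (F - J)"
  have finI: "finite I" "card I = n * k" by (simp_all add: I_def card_cartesian_product)
  have finF: "finite F" unfolding F_def using finI by (intro finite_PiE) auto
  have cover: "array_region n k l \<subseteq> (\<Union>c\<in>G. slot_box n k M c)"
  proof
    fix t assume t: "t \<in> array_region n k l"
    define c where "c = (\<lambda>x\<in>I. nat \<lfloor>real M * t x\<rfloor>)"
    have range: "0 \<le> t x" "t x < 1" if "x \<in> I" for x
      using t that by (auto simp: array_region_def I_def)
    have cx: "real (c x) = of_int \<lfloor>real M * t x\<rfloor>" if "x \<in> I" for x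
      using range[OF that] that by (simp add: c_def)
    have "c x < M" if "x \<in> I" for x
    proof -
      have "real (c x) \<le> real M * t x" using cx[OF that] by simp
      also have "\<dots> < real M" using range[OF that] M by simp
      finally show ?thesis by simp
    qed
    then have cF: "c \<in> F" by (auto simp: F_def c_def)
    have box: "t \<in> slot_box n k M c"
      unfolding slot_box_def I_def[symmetric]
    proof (rule PiE_I)
      fix x assume x: "x \<in> I"
      have "real (c x) \<le> real M * t x" "real M * t x < real (c x) + 1" using cx[OF x] by linarith+
      then show "t x \<in> {real (c x) / real M..<(real (c x) + 1) / real M}"
        using M by (simp add: field_simps)
    next
      fix x assume "x \<notin> I"
      then show "t x = undefined" using t by (auto simp: array_region_def I_def)
    qed
    have "c \<in> G"
    proof (cases "c \<in> J")
      case True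
      then have inj: "inj_on c I" by (simp add: J_def)
      have "separated n k c"
        unfolding separated_def
      proof (intro allI ballI impI)
        fix h h' i j assume *: "h < n" "h' \<in> {h, (h + 1) mod n}" "i \<in> {1..k}" "j \<in> {1..k}" "(h, i) \<noteq> (h', j)"
        then have "(h, i) \<in> I" "(h', j) \<in> I" using n by (auto simp: I_def)
        then show "c (h, i) \<noteq> c (h', j)" using inj *(5) by (meson inj_onD)
      qed
      note tr = slot_box_transfer[OF n k M this box]
      have "bead_like n k t" "array_occupation n t = l" using t by (simp_all add: array_region_def)
      then have "c \<in> slot_arrays n k l M"
        using tr cF inj by (simp add: slot_arrays_def F_def I_def)
      then show ?thesis by (simp add: G_def)
    next
      case False
      with cF show ?thesis by (simp add: G_def)
    qed
    with box show "t \<in> (\<Union>c\<in>G. slot_box n k M c)" by blast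
  qed
  have finG: "finite G" using finF by (simp add: G_def)
  have cardJ: "real (card J) = (\<Prod>i<n * k. real M - real i)"
  proof -
    have "card J = (\<Prod>i<n * k. M - i)"
      unfolding J_def F_def using card_inj_on_subset_funcset[of I "{..<M}" I] finI
      by (simp add: atLeast0LessThan)
    then have "real (card J) = (\<Prod>i<n * k. real (M - i))" by simp
    also have "\<dots> = (\<Prod>i<n * k. real M - real i)"
      using le by (intro prod.cong) (auto simp: of_nat_diff)
    finally show ?thesis .
  qed
  have cardF: "real (card F) = real M ^ (n * k)"
    unfolding F_def using finI by (simp add: card_funcsetE)
  have "J \<subseteq> F" by (auto simp: J_def)
  then have cardFJ: "real (card (F - J)) = real M ^ (n * k) - (\<Prod>i<n * k. real M - real i)"
  proof -
    have "card J \<le> card F" using finF \<open>J \<subseteq> F\<close> by (rule card_mono)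
    moreover have "card (F - J) = card F - card J"
      using finite_subset[OF \<open>J \<subseteq> F\<close> finF] \<open>J \<subseteq> F\<close> by (rule card_Diff_subset)
    ultimately have "real (card (F - J)) = real (card F) - real (card J)" by (simp only: of_nat_diff)
    then show ?thesis by (simp only: cardF cardJ)
  qed
  have "emeasure P (array_region n k l) \<le> emeasure P (\<Union>c\<in>G. slot_box n k M c)"
    using finG slot_box_measure(1)[OF M, of n k] unfolding P_def I_def
    by (intro emeasure_mono cover sets.finite_UN) auto
  also have "\<dots> \<le> (\<Sum>c\<in>G. emeasure P (slot_box n k M c))"
    using finG slot_box_measure(1)[OF M, of n k] unfolding P_def I_def
    by (intro emeasure_subadditive_finite) auto
  also have "\<dots> = ennreal (real (card G) * (1 / real M) ^ (n * k))"
    unfolding P_def I_def slot_box_measure(2)[OF M]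
    by (simp add: ennreal_of_nat_eq_real_of_nat flip: ennreal_mult)
  finally have "measure P (array_region n k l) \<le> real (card G) * (1 / real M) ^ (n * k)"
    unfolding measure_def by (intro enn2real_leI) auto
  also have "\<dots> \<le> (real (card (slot_arrays n k l M)) + real (card (F - J))) * (1 / real M) ^ (n * k)"
    unfolding G_def using card_Un_le[of "slot_arrays n k l M" "F - J"]
    by (intro mult_right_mono) (simp_all flip: of_nat_add)
  also have "\<dots> = real (card (slot_arrays n k l M)) / real M ^ (n * k)
    + (1 - (\<Prod>i<n * k. real M - real i) / real M ^ (n * k))"
    unfolding cardFJ using M by (simp add: power_one_over field_simps)
  finally show ?thesis
    using bead_volume_eq[of n k l] n k by (simp add: P_def I_def)
qed

lemma bead_volume_lower:
  assumes n: "n \<ge> 2" and k: "k \<ge> 1" and M: "M > 0" and fin: "finite C"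
    and C: "\<And>c. c \<in> C \<Longrightarrow> c \<in> {..<n} \<times> {1..k} \<rightarrow>\<^sub>E {..<M} \<and> separated n k c \<and>
      bead_like n k (\<lambda>x. real (c x)) \<and> array_occupation n (\<lambda>x. real (c x)) = l"
  shows "real (card C) / real M ^ (n * k) \<le> bead_volume n k l"
proof -
  define I where "I = {..<n} \<times> {1..k}"
  define P where "P = Pi\<^sub>M I (\<lambda>_. lborel :: real measure)"
  have sub: "slot_box n k M c \<subseteq> array_region n k l" if c: "c \<in> C" for c
  proof
    fix t assume t: "t \<in> slot_box n k M c"
    have "separated n k c" using C[OF c] by simp
    note tr = slot_box_transfer[OF n k M this t]
    have "t \<in> I \<rightarrow>\<^sub>E {0..<1}"
    proof (rule PiE_I)
      fix x assume x: "x \<in> I"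
      have "c x < M" using C[OF c] x by (auto simp: I_def)
      then have "(real (c x) + 1) / real M \<le> 1" by simp
      moreover have "real (c x) / real M \<le> t x" "t x < (real (c x) + 1) / real M"
        using slot_box_mem[OF t, of "fst x" "snd x"] x by (auto simp: I_def)
      moreover have "0 \<le> real (c x) / real M" by simp
      ultimately show "t x \<in> {0..<1}" by (simp only: atLeastLessThan_iff) linarith
    next
      fix x assume "x \<notin> I"
      then show "t x = undefined" using t by (auto simp: slot_box_def I_def)
    qed
    then show "t \<in> array_region n k l" using tr C[OF c] by (simp add: array_region_def I_def)
  qed
  have disj: "disjoint_family_on (slot_box n k M) C"
    unfolding disjoint_family_on_def
  proof (intro ballI impI)
    fix c d assume cd: "c \<in> C" "d \<in> C" "c \<noteq> d"
    then obtain x where x: "x \<in> I" "c x \<noteq> d x"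
      using C PiE_ext[of c I "\<lambda>_. {..<M}" d] unfolding I_def by metis
    have "False" if "t \<in> slot_box n k M c" "t \<in> slot_box n k M d" for t
    proof -
      have "real (c x) / real M \<le> t x" "t x < (real (c x) + 1) / real M"
        "real (d x) / real M \<le> t x" "t x < (real (d x) + 1) / real M"
        using slot_box_mem[OF that(1), of "fst x" "snd x"] slot_box_mem[OF that(2), of "fst x" "snd x"] x(1)
        by (auto simp: I_def)
      then have "real (c x) / real M < (real (d x) + 1) / real M" "real (d x) / real M < (real (c x) + 1) / real M"
        by linarith+
      then have "real (c x) < real (d x) + 1" "real (d x) < real (c x) + 1"
        using M by (simp_all add: divide_less_cancel)
      with x(2) show False by linarith
    qed
    then show "slot_box n k M c \<inter> slot_box n k M d = {}" by blast
  qed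
  have Psets: "slot_box n k M c \<in> sets P" for c
    using slot_box_measure(1)[OF M] by (simp add: P_def I_def)
  \<comment> \<open>\<open>measure\<close> only bounds volume from below where
    \<open>emeasure\<close> is finite, so the region is first enclosed in the unit cube.\<close>
  have "array_region n k l \<subseteq> (\<Pi>\<^sub>E x\<in>I. {0..<1})"
    unfolding array_region_def I_def by blast
  also have "\<dots> \<subseteq> (\<Pi>\<^sub>E x\<in>I. {0..1})"
    by (intro PiE_mono) auto
  finally have "array_region n k l \<subseteq> (\<Pi>\<^sub>E x\<in>I. {0..1})" .
  moreover have "emeasure P (\<Pi>\<^sub>E x\<in>I. {0..1}) = 1"
  proof -
    interpret product_sigma_finite "\<lambda>_ :: nat \<times> nat. lborel :: real measure"
      by standard
    show ?thesis unfolding P_def by (subst emeasure_PiM) (auto simp: I_def)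
  qed
  moreover have "(\<Pi>\<^sub>E x\<in>I. {0..1}) \<in> sets P"
    unfolding P_def by (intro sets_PiM_I_finite) (auto simp: I_def)
  ultimately have finite_region: "emeasure P (array_region n k l) \<le> 1"
    using emeasure_mono by metis
  have "ennreal (real (card C) * (1 / real M) ^ (n * k)) = (\<Sum>c\<in>C. emeasure P (slot_box n k M c))"
    unfolding P_def I_def slot_box_measure(2)[OF M]
    by (simp add: ennreal_of_nat_eq_real_of_nat flip: ennreal_mult)
  also have "\<dots> = emeasure P (\<Union>c\<in>C. slot_box n k M c)"
    using Psets by (intro sum_emeasure disj fin) auto
  also have "\<dots> \<le> emeasure P (array_region n k l)"
    using sub sets_array_region[of n k l] n k by (intro emeasure_mono) (auto simp: P_def I_def)
  finally have "ennreal (real (card C) * (1 / real M) ^ (n * k)) \<le> emeasure P (array_region n k l)" .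
  moreover have "emeasure P (array_region n k l) = ennreal (measure P (array_region n k l))"
    using finite_region by (intro emeasure_eq_ennreal_measure) (auto simp: top_unique)
  ultimately have "real (card C) * (1 / real M) ^ (n * k) \<le> measure P (array_region n k l)"
    by (simp add: ennreal_le_iff)
  then show ?thesis
    using bead_volume_eq[of n k l] n k by (simp add: P_def I_def power_one_over field_simps)
qed

section \<open>Gluing\<close>

definition seam :: "nat \<Rightarrow> (nat \<times> nat \<Rightarrow> nat) \<Rightarrow> nat \<Rightarrow> nat" where
  "seam k c = (\<lambda>j\<in>{1..k}. c (0, j))"

definition seam_arrays :: "nat \<Rightarrow> nat \<Rightarrow> nat \<Rightarrow> nat \<Rightarrow> (nat \<Rightarrow> nat) \<Rightarrow> (nat \<times> nat \<Rightarrow> nat) set" where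
  "seam_arrays n k l M \<sigma> = {c \<in> slot_arrays n k l M. seam k c = \<sigma>}"

text \<open>A seam is increasing, hence determined by its set of k slots, so at most M choose k
  seams occur; the one shared by most arrays is taken.\<close>

lemma seam_pigeonhole:
  assumes n: "n \<ge> 2" and k: "k \<ge> 1" and ne: "slot_arrays n k l M \<noteq> {}"
  obtains \<sigma> where "seam_arrays n k l M \<sigma> \<noteq> {}"
    and "card (slot_arrays n k l M) \<le> (M choose k) * card (seam_arrays n k l M \<sigma>)"
proof -
  define A where "A = slot_arrays n k l M"
  define m where "m \<sigma> = card (seam_arrays n k l M \<sigma>)" for \<sigma>
  have fin: "finite (seam k ` A)" "seam k ` A \<noteq> {}" using ne by (auto simp: A_def)
  then have "Max (m ` seam k ` A) \<in> m ` seam k ` A" by (intro Max_in) auto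
  then obtain \<sigma> where \<sigma>: "Max (m ` seam k ` A) = m \<sigma>" "\<sigma> \<in> seam k ` A" by (rule imageE)
  have m_le: "m \<tau> \<le> m \<sigma>" if "\<tau> \<in> seam k ` A" for \<tau>
    unfolding \<sigma>(1)[symmetric] using fin that by (intro Max_ge) auto
  have img: "(\<lambda>j. \<tau> j) ` {1..k} \<in> {S. S \<subseteq> {..<M} \<and> card S = k}" "strict_mono_on {1..k} \<tau>"
    if \<tau>: "\<tau> \<in> seam k ` A" for \<tau>
  proof -
    obtain c where c: "c \<in> A" "\<tau> = seam k c" using \<tau> by blast
    interpret a: slot_array n k l M c using c n k by unfold_locales (simp_all add: A_def)
    show mono\<tau>: "strict_mono_on {1..k} \<tau>"
      using a.mono[of 0] n c(2) by (simp add: strict_mono_on_def seam_def)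
    have "\<tau> j < M" if "j \<in> {1..k}" for j using a.bound[of 0 j] that n c(2) by (simp add: seam_def)
    then show "(\<lambda>j. \<tau> j) ` {1..k} \<in> {S. S \<subseteq> {..<M} \<and> card S = k}"
      using strict_mono_on_imp_inj_on[OF mono\<tau>] by (auto simp: card_image)
  qed
  have "inj_on (\<lambda>\<tau>. (\<lambda>j. \<tau> j) ` {1..k}) (seam k ` A)"
  proof (rule inj_onI)
    fix \<tau> \<upsilon> assume \<tau>: "\<tau> \<in> seam k ` A" and \<upsilon>: "\<upsilon> \<in> seam k ` A"
      and eq: "(\<lambda>j. \<tau> j) ` {1..k} = (\<lambda>j. \<upsilon> j) ` {1..k}"
    have "\<tau> j = \<upsilon> j" if "j \<in> {1..k}" for j
      using sorted_list_of_set_image[OF img(2)[OF \<tau>] that] sorted_list_of_set_image[OF img(2)[OF \<upsilon>] that] eq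
      by simp
    then show "\<tau> = \<upsilon>"
      using \<tau> \<upsilon> by (auto simp: seam_def fun_eq_iff restrict_def)
  qed
  then have "card (seam k ` A) \<le> card {S. S \<subseteq> {..<M} \<and> card S = k}"
    using img(1) by (intro card_inj_on_le) auto
  also have "\<dots> = M choose k" using n_subsets[of "{..<M}" k] by simp
  finally have card_seams: "card (seam k ` A) \<le> M choose k" .
  have "A = (\<Union>\<tau>\<in>seam k ` A. seam_arrays n k l M \<tau>)" by (auto simp: A_def seam_arrays_def)
  then have "card A \<le> (\<Sum>\<tau>\<in>seam k ` A. m \<tau>)"
    unfolding m_def using card_UN_le[OF fin(1), of "seam_arrays n k l M"] by simp
  also have "\<dots> \<le> card (seam k ` A) * m \<sigma>"
    using sum_bounded_above[of "seam k ` A" m "m \<sigma>"] m_le by simp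
  also have "\<dots> \<le> (M choose k) * m \<sigma>" using card_seams by (rule mult_le_mono1)
  finally have "card A \<le> (M choose k) * m \<sigma>" .
  moreover have "seam_arrays n k l M \<sigma> \<noteq> {}" using \<sigma>(2) by (auto simp: seam_arrays_def A_def)
  ultimately show ?thesis using that by (simp add: A_def m_def)
qed

text \<open>
  Blocks of \<open>n0\<close> strings that carry the same beads on their string 0 are placed side by side, followed by
  \<open>s\<close> filler strings. Every slot used by the common string is split into \<open>R\<close> slots; \<open>spread\<close> is the
  induced relabelling of the old slots. The beads of filler string \<open>g\<close> occupy the \<open>filler g\<close>-th parts of
  these slots, and \<open>filler\<close> is the staircase of slope \<open>d / s\<close> modulo 1, which wraps around \<open>d\<close> times.
\<close>

locale gluing =
  fixes n0 k l0 M R r s d :: nat and \<sigma> :: "nat \<Rightarrow> nat"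
  assumes n0: "n0 \<ge> 2" and k: "k \<ge> 1" and r: "r \<ge> 1"
    and d: "0 < d" "d < s" "s \<le> R * d" "s \<le> R * (s - d)"
    and ne: "seam_arrays n0 k l0 M \<sigma> \<noteq> {}"
begin

definition n :: nat where "n = r * n0 + s"

definition M' :: nat where "M' = M + (R - 1) * k"

definition spread :: "nat \<Rightarrow> nat" where "spread i = i + (R - 1) * count_below k \<sigma> i"

definition filler :: "nat \<Rightarrow> nat" where "filler g = (R * ((g * d) mod s)) div s"

definition glue :: "(nat \<Rightarrow> nat \<times> nat \<Rightarrow> nat) \<Rightarrow> nat \<times> nat \<Rightarrow> nat" where
  "glue V = (\<lambda>(h, j)\<in>{..<n} \<times> {1..k}. if h < r * n0 then spread (V (h div n0) (h mod n0, j))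
     else spread (\<sigma> j) + filler (h - r * n0))"

lemma R_pos: "R > 0" using d by (cases R) auto

lemma n_ge: "n \<ge> 2"
proof -
  have "r * n0 \<ge> 1 * 2" using r n0 by (rule mult_le_mono)
  then show ?thesis by (simp add: n_def)
qed

lemma array:
  assumes "c \<in> seam_arrays n0 k l0 M \<sigma>"
  shows "slot_array n0 k l0 M c" and "\<And>j. j \<in> {1..k} \<Longrightarrow> c (0, j) = \<sigma> j"
proof -
  show "slot_array n0 k l0 M c"
    using assms n0 k by unfold_locales (simp_all add: seam_arrays_def)
  show "c (0, j) = \<sigma> j" if "j \<in> {1..k}" for j
    using assms that by (auto simp: seam_arrays_def seam_def)
qed

lemma seam_mono: "strict_mono_on {1..k} \<sigma>"
  and seam_bound: "j \<in> {1..k} \<Longrightarrow> \<sigma> j < M"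
proof -
  obtain c where c: "c \<in> seam_arrays n0 k l0 M \<sigma>" using ne by blast
  interpret a: slot_array n0 k l0 M c using array(1)[OF c] .
  show "strict_mono_on {1..k} \<sigma>"
    using a.mono[of 0] n0 array(2)[OF c] by (simp add: strict_mono_on_def)
  show "j \<in> {1..k} \<Longrightarrow> \<sigma> j < M" using a.bound[of 0 j] n0 array(2)[OF c] by simp
qed

lemma count_below_mono: "i \<le> i' \<Longrightarrow> count_below k \<sigma> i \<le> count_below k \<sigma> i'"
  unfolding count_below_def by (intro card_mono) auto

lemma spread_mono: "i < i' \<Longrightarrow> spread i < spread i'"
  using count_below_mono[of i i'] unfolding spread_def by (intro add_less_le_mono mult_le_mono2) auto

lemma spread_less_iff [simp]: "spread i < spread i' \<longleftrightarrow> i < i'"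
  by (metis less_imp_not_less linorder_neqE_nat spread_mono)

lemma spread_eq_iff [simp]: "spread i = spread i' \<longleftrightarrow> i = i'"
  by (metis less_irrefl linorder_neqE_nat spread_mono)

lemma spread_seam_Suc:
  assumes "j \<in> {1..k}"
  shows "spread (\<sigma> j + 1) = spread (\<sigma> j) + R"
proof -
  have "count_below k \<sigma> (\<sigma> j) < j" "j \<le> count_below k \<sigma> (\<sigma> j + 1)"
    using less_iff_le_count_below[OF seam_mono assms, of "\<sigma> j"]
      less_iff_le_count_below[OF seam_mono assms, of "\<sigma> j + 1"] by simp_all
  moreover have "count_below k \<sigma> (\<sigma> j + 1) \<le> count_below k \<sigma> (\<sigma> j) + 1"
  proof -
    have "{i \<in> {1..k}. \<sigma> i < \<sigma> j + 1} \<subseteq> insert j {i \<in> {1..k}. \<sigma> i < \<sigma> j}"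
      using inj_onD[OF strict_mono_on_imp_inj_on[OF seam_mono], of _ j] assms by (auto simp: less_Suc_eq)
    then have "count_below k \<sigma> (\<sigma> j + 1) \<le> card (insert j {i \<in> {1..k}. \<sigma> i < \<sigma> j})"
      unfolding count_below_def by (intro card_mono) auto
    also have "\<dots> \<le> count_below k \<sigma> (\<sigma> j) + 1"
      unfolding count_below_def by (simp add: card_insert_if)
    finally show ?thesis .
  qed
  ultimately have "count_below k \<sigma> (\<sigma> j + 1) = count_below k \<sigma> (\<sigma> j) + 1" by linarith
  then show ?thesis using R_pos by (simp add: spread_def)
qed

lemma spread_seam_gap: "j \<in> {1..k} \<Longrightarrow> \<sigma> j < i \<Longrightarrow> spread (\<sigma> j) + R \<le> spread i"
  using spread_seam_Suc[of j] spread_mono[of "\<sigma> j + 1" i] by (cases "\<sigma> j + 1 = i") auto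

lemma spread_bound: "i \<le> M \<Longrightarrow> spread i + (M - i) \<le> M'"
  using mult_le_mono2[OF count_below_le[of k \<sigma> i], of "R - 1"] by (simp add: spread_def M'_def)

text \<open>Before rounding, a step of the staircase goes up by R * d / s or down by R * (s - d) /
  s. The last two assumptions in \<open>d\<close> make both at least 1, so consecutive values still
  differ after rounding, and the descents are exactly the wraps modulo s, where (g * d) div s
  increases.\<close>

lemma filler_step:
  assumes "g < s"
  shows "filler (g + 1) \<noteq> filler g"
    and "(Suc g * d) div s = (g * d) div s + of_bool (filler (g + 1) < filler g)"
proof -
  define y where "y = (g * d) mod s"
  have s: "s > 0" using d by simp
  have y: "y < s" using s by (simp add: y_def)
  have gd: "Suc g * d = s * ((g * d) div s) + (y + d)"
    using mult_div_mod_eq[of s "g * d"] by (simp add: y_def)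
  have "filler (g + 1) \<noteq> filler g \<and> (Suc g * d) div s = (g * d) div s + of_bool (filler (g + 1) < filler g)"
  proof (cases "y + d < s")
    case True
    have m: "(Suc g * d) mod s = y + d" unfolding gd using True by simp
    have q: "(Suc g * d) div s = (g * d) div s" unfolding gd using True by simp
    have "(R * y + s) div s \<le> (R * (y + d)) div s"
      using d(3) by (intro div_le_mono) (simp add: distrib_left)
    then have "filler g < filler (g + 1)"
      using s m by (simp add: filler_def y_def)
    then show ?thesis using q by simp
  next
    case False
    have yd: "y + d = s + (y + d - s)" "y + d - s < s" using False y d by simp_all
    have gd': "Suc g * d = s * ((g * d) div s + 1) + (y + d - s)"
      using gd yd(1) by simp
    have m: "(Suc g * d) mod s = y + d - s" unfolding gd' using yd(2) by (simp del: mult_Suc_right)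
    have q: "(Suc g * d) div s = (g * d) div s + 1" unfolding gd' using yd(2) s by (simp del: mult_Suc_right)
    have "R * (y + d - s) + s \<le> R * (y + d - s) + R * (s - d)" using d(4) by simp
    also have "\<dots> = R * y"
      using yd(1) d(2) by (simp flip: distrib_left)
    finally have "(R * (y + d - s) + s) div s \<le> (R * y) div s" by (rule div_le_mono)
    then have "filler (g + 1) < filler g"
      using s m by (simp add: filler_def y_def)
    then show ?thesis using q by simp
  qed
  then show "filler (g + 1) \<noteq> filler g"
    and "(Suc g * d) div s = (g * d) div s + of_bool (filler (g + 1) < filler g)" by simp_all
qed

lemma filler_less: "filler g < R"
proof -
  have "(g * d) mod s < s" using d by simp
  then have "R * ((g * d) mod s) < R * s" using R_pos by simp
  then show ?thesis using d by (simp add: filler_def less_mult_imp_div_less)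
qed

lemma filler_0: "filler 0 = 0" and filler_s: "filler s = 0"
  by (simp_all add: filler_def)

text \<open>By \<open>filler_step\<close> the quotient (m * d) div s counts the descents before m;
  at m = s it is d.\<close>

lemma filler_descents: "card {g. g < s \<and> filler (g + 1) < filler g} = d"
proof -
  have "(m * d) div s = card {g. g < m \<and> filler (g + 1) < filler g}" if "m \<le> s" for m
    using that
  proof (induction m)
    case (Suc m)
    have "{g. g < Suc m \<and> filler (g + 1) < filler g} = {g. g < m \<and> filler (g + 1) < filler g} \<union>
        (if filler (m + 1) < filler m then {m} else {})"
      by (auto simp: less_Suc_eq)
    then have "card {g. g < Suc m \<and> filler (g + 1) < filler g}
        = card {g. g < m \<and> filler (g + 1) < filler g} + of_bool (filler (m + 1) < filler m)"
      by auto
    then show ?case using Suc filler_step(2)[of m] by simp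
  qed simp
  from this[of s] show ?thesis using d by simp
qed

section \<open>The glued array\<close>

definition block :: "(nat \<Rightarrow> nat \<times> nat \<Rightarrow> nat) \<Rightarrow> bool" where
  "block V \<longleftrightarrow> V \<in> {..<r} \<rightarrow>\<^sub>E seam_arrays n0 k l0 M \<sigma>"

lemma block_array:
  assumes "block V" "h < r * n0"
  shows "slot_array n0 k l0 M (V (h div n0))" "\<And>j. j \<in> {1..k} \<Longrightarrow> V (h div n0) (0, j) = \<sigma> j"
    "h mod n0 < n0"
proof -
  have "h div n0 < r" using assms(2) by (simp add: less_mult_imp_div_less)
  then have "V (h div n0) \<in> seam_arrays n0 k l0 M \<sigma>" using assms(1) by (auto simp: block_def)
  then show "slot_array n0 k l0 M (V (h div n0))" "\<And>j. j \<in> {1..k} \<Longrightarrow> V (h div n0) (0, j) = \<sigma> j"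
    using array by blast+
  show "h mod n0 < n0" using n0 by simp
qed

lemma glue_block:
  "h < r * n0 \<Longrightarrow> j \<in> {1..k} \<Longrightarrow> glue V (h, j) = spread (V (h div n0) (h mod n0, j))"
  by (simp add: glue_def n_def)

lemma glue_filler:
  "r * n0 \<le> h \<Longrightarrow> h < n \<Longrightarrow> j \<in> {1..k} \<Longrightarrow> glue V (h, j) = spread (\<sigma> j) + filler (h - r * n0)"
  by (simp add: glue_def)

text \<open>The string after a block carries the common seam, be it string 0 of the next block or
  filler string 0, whose offset is \<open>filler 0\<close> = 0. So the last string of each block has
  in effect its own string 0 as right neighbour, as on the closed ring.\<close>

lemma glue_block_Suc:
  assumes V: "block V" and h: "h < r * n0" and j: "j \<in> {1..k}"
  shows "glue V (Suc h mod n, j) = spread (V (h div n0) (Suc (h mod n0) mod n0, j))"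
proof -
  have "Suc h \<le> r * n0" using h by simp
  also have "\<dots> < n" using d by (simp add: n_def)
  finally have m: "Suc h mod n = Suc h" by simp
  show ?thesis
  proof (cases "Suc (h mod n0) = n0")
    case True
    then have dv: "n0 dvd Suc h" by (metis mod_Suc mod_0_imp_dvd)
    have "glue V (Suc h, j) = spread (\<sigma> j)"
    proof (cases "Suc h < r * n0")
      case True
      then show ?thesis
        using block_array(2)[OF V True j] dv j by (simp add: glue_block dvd_imp_mod_0)
    next
      case False
      with h have "Suc h = r * n0" by simp
      then show ?thesis
        using glue_filler[of "Suc h" j V] j d by (simp add: n_def filler_0)
    qed
    then show ?thesis
      using True m block_array(2)[OF V h j] by simp
  next
    case False
    then have *: "Suc h mod n0 = Suc (h mod n0)" "Suc h div n0 = h div n0"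
      by (simp_all add: mod_Suc div_Suc)
    have "Suc h \<noteq> r * n0"
    proof
      assume "Suc h = r * n0"
      then have "Suc h mod n0 = 0" by simp
      with * show False by simp
    qed
    with h have "Suc h < r * n0" by simp
    then have "glue V (Suc h, j) = spread (V (Suc h div n0) (Suc h mod n0, j))" using j by (rule glue_block)
    moreover have "Suc (h mod n0) mod n0 = Suc (h mod n0)"
      using * by (metis mod_mod_trivial)
    ultimately show ?thesis using m * by simp
  qed
qed

text \<open>The last filler string is followed cyclically by string 0 of the first block, which is
  the seam; since \<open>filler s\<close> = 0 the formula needs no exception there.\<close>

lemma glue_filler_Suc:
  assumes V: "block V" and h: "r * n0 \<le> h" "h < n" and j: "j \<in> {1..k}"
  shows "glue V (Suc h mod n, j) = spread (\<sigma> j) + filler (h - r * n0 + 1)"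
proof (cases "Suc h = n")
  case True
  have "0 < r * n0" using r n0 by simp
  then have "glue V (0, j) = spread (\<sigma> j)"
    using block_array(2)[OF V _ j, of 0] glue_block[of 0 j V] j by simp
  moreover have "h - r * n0 + 1 = s" using True h by (simp add: n_def)
  ultimately show ?thesis using True filler_s by simp
next
  case False
  with h have "Suc h < n" by simp
  then show ?thesis using glue_filler[of "Suc h" j V] h j by (simp add: Suc_diff_le)
qed

lemma glue_range:
  assumes V: "block V"
  shows "glue V \<in> {..<n} \<times> {1..k} \<rightarrow>\<^sub>E {..<M'}"
proof (rule PiE_I)
  fix x assume "x \<in> {..<n} \<times> {1..k}"
  then obtain h j where x: "x = (h, j)" "h < n" "j \<in> {1..k}" by auto
  show "glue V x \<in> {..<M'}"
  proof (cases "h < r * n0")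
    case True
    interpret b: slot_array n0 k l0 M "V (h div n0)" using block_array(1)[OF V True] .
    have lt: "V (h div n0) (h mod n0, j) < M" using b.bound block_array(3)[OF V True] x(3) by blast
    then show ?thesis
      using spread_bound[of "V (h div n0) (h mod n0, j)"] glue_block[OF True x(3)] x by simp
  next
    case False
    have "spread (\<sigma> j) + R \<le> spread M" using spread_seam_gap[OF x(3) seam_bound[OF x(3)]] .
    also have "\<dots> \<le> M'" using spread_bound[of M] by simp
    finally show ?thesis
      using filler_less[of "h - r * n0"] glue_filler[of h j V] False x by simp
  qed
next
  fix x assume "x \<notin> {..<n} \<times> {1..k}"
  then show "glue V x = undefined" unfolding glue_def restrict_def by (rule if_not_P)
qed

lemma glue_mono:
  assumes V: "block V" and h: "h < n"
  shows "strict_mono_on {1..k} (\<lambda>j. glue V (h, j))"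
proof (rule strict_mono_onI)
  fix i j assume ij: "i \<in> {1..k}" "j \<in> {1..k}" "i < j"
  show "glue V (h, i) < glue V (h, j)"
  proof (cases "h < r * n0")
    case True
    interpret b: slot_array n0 k l0 M "V (h div n0)" using block_array(1)[OF V True] .
    show ?thesis
      using strict_mono_onD[OF b.mono[OF block_array(3)[OF V True]] ij] ij True by (simp add: glue_block)
  next
    case False
    then show ?thesis
      using strict_mono_onD[OF seam_mono ij] ij h by (simp add: glue_filler)
  qed
qed

lemma seam_filler_neq:
  assumes "i \<in> {1..k}" "j \<in> {1..k}" "g < s"
  shows "spread (\<sigma> i) + filler g \<noteq> spread (\<sigma> j) + filler (g + 1)"
proof -
  consider "i = j" | "i < j" | "j < i" by linarith
  then show ?thesis
  proof cases
    case 1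
    then show ?thesis using filler_step(1)[OF assms(3)] by simp
  next
    case 2
    have "spread (\<sigma> i) + R \<le> spread (\<sigma> j)"
      using spread_seam_gap[OF assms(1)] strict_mono_onD[OF seam_mono assms(1,2) 2] by blast
    then show ?thesis using filler_less[of g] by linarith
  next
    case 3
    have "spread (\<sigma> j) + R \<le> spread (\<sigma> i)"
      using spread_seam_gap[OF assms(2)] strict_mono_onD[OF seam_mono assms(2,1) 3] by blast
    then show ?thesis using filler_less[of "g + 1"] by linarith
  qed
qed

lemma glue_separated:
  assumes V: "block V"
  shows "separated n k (glue V)"
  unfolding separated_def
proof (intro allI ballI impI)
  fix h h' i j
  assume h: "h < n" and h': "h' \<in> {h, (h + 1) mod n}" and ij: "i \<in> {1..k}" "j \<in> {1..k}" "(h, i) \<noteq> (h', j)"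
  show "glue V (h, i) \<noteq> glue V (h', j)"
  proof (cases "h' = h")
    case True
    then show ?thesis
      using inj_onD[OF strict_mono_on_imp_inj_on[OF glue_mono[OF V h]], of i j] ij by auto
  next
    case False
    then have h'_eq: "h' = Suc h mod n" using h' by simp
    show ?thesis
    proof (cases "h < r * n0")
      case True
      interpret b: slot_array n0 k l0 M "V (h div n0)" using block_array(1)[OF V True] .
      have "V (h div n0) (h mod n0, i) \<noteq> V (h div n0) (Suc (h mod n0) mod n0, j)"
        using b.disjoint[OF block_array(3)[OF V True] b.succ_less _ ij(1,2), of "h mod n0"]
          b.succ_neq[OF block_array(3)[OF V True]] by simp
      then show ?thesis
        unfolding h'_eq using True ij by (simp add: glue_block glue_block_Suc[OF V])
    next
      case False
      then have "h - r * n0 < s" using h by (simp add: n_def)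
      then show ?thesis
        unfolding h'_eq using False h ij seam_filler_neq[OF ij(1,2)]
        by (simp add: glue_filler glue_filler_Suc[OF V, simplified])
    qed
  qed
qed

lemma glue_bead_like:
  assumes V: "block V"
  shows "bead_like n k (\<lambda>x. real (glue V x))"
  unfolding bead_like_def
proof (intro conjI allI impI)
  fix h assume h: "h < n"
  show "strict_mono_on {1..k} (\<lambda>j. real (glue V (h, j)))" using glue_mono[OF V h] by simp
  show "interlaced k (\<lambda>j. real (glue V (h, j))) (\<lambda>j. real (glue V ((h + 1) mod n, j)))"
  proof (cases "h < r * n0")
    case True
    interpret b: slot_array n0 k l0 M "V (h div n0)" using block_array(1)[OF V True] .
    have "interlaced k (\<lambda>j. real (V (h div n0) (h mod n0, j))) (\<lambda>j. real (V (h div n0) ((h mod n0 + 1) mod n0, j)))"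
      using b.c block_array(3)[OF V True] unfolding slot_arrays_def bead_like_def by blast
    then show ?thesis
      by (subst interlaced_transfer[where a' = "\<lambda>j. real (V (h div n0) (h mod n0, j))"
            and b' = "\<lambda>j. real (V (h div n0) ((h mod n0 + 1) mod n0, j))"])
         (simp_all add: glue_block True glue_block_Suc[OF V True])
  next
    case False
    define g where "g = h - r * n0"
    have g: "g < s" using False h by (simp add: g_def n_def)
    have eq: "glue V (h, j) = spread (\<sigma> j) + filler g" "glue V ((h + 1) mod n, j) = spread (\<sigma> j) + filler (g + 1)"
      if "j \<in> {1..k}" for j
      using glue_filler[of h j V] glue_filler_Suc[OF V _ h that] False h that by (simp_all add: g_def)
    have gap: "spread (\<sigma> j) + R \<le> spread (\<sigma> (j + 1))" if "j \<in> {1..<k}" for j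
    proof -
      have "\<sigma> j < \<sigma> (j + 1)" using that by (intro strict_mono_onD[OF seam_mono]) auto
      then show ?thesis using that by (intro spread_seam_gap) auto
    qed
    \<comment> \<open>Offsets below R stay inside one split slot, so the next split slot lies beyond
      both beads.\<close>
    have "leads k (\<lambda>j. spread (\<sigma> j) + a) (\<lambda>j. spread (\<sigma> j) + b)" if "a < b" "b < R" for a b
      unfolding leads_def using that gap by (fastforce dest: le_less_trans)
    then have "leads k (\<lambda>j. spread (\<sigma> j) + filler g) (\<lambda>j. spread (\<sigma> j) + filler (g + 1)) \<or>
        leads k (\<lambda>j. spread (\<sigma> j) + filler (g + 1)) (\<lambda>j. spread (\<sigma> j) + filler g)"
      using filler_step(1)[OF g] filler_less by (metis linorder_neqE_nat)
    then have "interlaced k (\<lambda>j. real (spread (\<sigma> j) + filler g)) (\<lambda>j. real (spread (\<sigma> j) + filler (g + 1)))"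
      using seam_filler_neq[OF _ _ g] by (subst interlaced_iff_leads) (simp_all del: of_nat_add)
    then show ?thesis
      by (subst interlaced_cong[of k _ "\<lambda>j. real (spread (\<sigma> j) + filler g)" _ "\<lambda>j. real (spread (\<sigma> j) + filler (g + 1))"])
         (simp_all only: eq)
  qed
qed

text \<open>Since each block borders on a copy of its own string 0, it contributes l0 sites (the set
  \<open>S\<close>) just as on its ring; the filler strings contribute their d descents (the set
  \<open>T\<close>).\<close>

lemma glue_occupation:
  assumes V: "block V"
  shows "array_occupation n (\<lambda>x. real (glue V x)) = r * l0 + d"
proof -
  have k1: "1 \<in> {1..k}" using k by simp
  define S where "S = (\<lambda>(i, g). i * n0 + g) ` (SIGMA i:{..<r}. array_start n0 (V i))"
  define T where "T = (\<lambda>g. r * n0 + g) ` {g. g < s \<and> filler (g + 1) < filler g}"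
  have start_n0: "g < n0" if "g \<in> array_start n0 c" for g c using that by (simp add: array_start_def)
  have mem_block: "h \<in> array_start n (glue V) \<longleftrightarrow> h mod n0 \<in> array_start n0 (V (h div n0))" if "h < r * n0" for h
  proof -
    have "h < n" using that d by (simp add: n_def)
    then show ?thesis
      unfolding array_start_def mem_Collect_eq Suc_eq_plus1[symmetric] glue_block[OF that k1]
        glue_block_Suc[OF V that k1] spread_less_iff
      using block_array(3)[OF V that] by (simp only:)
  qed
  have mem_filler: "h \<in> array_start n (glue V) \<longleftrightarrow> filler (h - r * n0 + 1) < filler (h - r * n0)"
    if "r * n0 \<le> h" "h < n" for h
    using that glue_filler[OF that k1, of V] glue_filler_Suc[OF V that k1] by (simp add: array_start_def)
  have "array_start n (glue V) = S \<union> T"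
  proof (intro equalityI subsetI)
    fix h assume h: "h \<in> array_start n (glue V)"
    then have hn: "h < n" by (simp add: array_start_def)
    show "h \<in> S \<union> T"
    proof (cases "h < r * n0")
      case True
      then have "(h div n0, h mod n0) \<in> (SIGMA i:{..<r}. array_start n0 (V i))"
        using mem_block[OF True] h by (simp add: less_mult_imp_div_less)
      then have "h \<in> S" unfolding S_def by (rule image_eqI[rotated]) simp
      then show ?thesis by simp
    next
      case False
      then have "h - r * n0 \<in> {g. g < s \<and> filler (g + 1) < filler g}"
        using mem_filler[of h] h hn by (simp add: n_def)
      then have "h \<in> T" unfolding T_def by (rule image_eqI[rotated]) (use False in simp)
      then show ?thesis by simp
    qed
  next
    fix h assume "h \<in> S \<union> T"
    then show "h \<in> array_start n (glue V)"
    proof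
      assume "h \<in> S"
      then obtain i g where ig: "i < r" "g \<in> array_start n0 (V i)" "h = i * n0 + g" by (auto simp: S_def)
      have "h < i * n0 + n0" using start_n0[OF ig(2)] ig(3) by simp
      also have "\<dots> = Suc i * n0" by simp
      also have "\<dots> \<le> r * n0" using ig(1) by (intro mult_le_mono1) simp
      finally have "h < r * n0" .
      then show ?thesis using mem_block[of h] ig start_n0[OF ig(2)] by simp
    next
      assume "h \<in> T"
      then obtain g where "g < s" "filler (g + 1) < filler g" "h = r * n0 + g" by (auto simp: T_def)
      then show ?thesis using mem_filler[of h] by (simp add: n_def)
    qed
  qed
  moreover have "card S = r * l0"
  proof -
    have "inj_on (\<lambda>(i, g). i * n0 + g) (SIGMA i:{..<r}. array_start n0 (V i))"
    proof (rule inj_onI)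
      fix x y assume xy: "x \<in> (SIGMA i:{..<r}. array_start n0 (V i))" "y \<in> (SIGMA i:{..<r}. array_start n0 (V i))"
        "(\<lambda>(i, g). i * n0 + g) x = (\<lambda>(i, g). i * n0 + g) y"
      obtain i g i' g' where [simp]: "x = (i, g)" "y = (i', g')" by fastforce
      have g: "g < n0" "g' < n0" using xy start_n0 by auto
      have eq: "i * n0 + g = i' * n0 + g'" using xy(3) by simp
      have "(i * n0 + g) div n0 = i" "(i' * n0 + g') div n0 = i'" using g by simp_all
      then have "i = i'" using eq by simp
      with eq show "x = y" by simp
    qed
    then have "card S = card (SIGMA i:{..<r}. array_start n0 (V i))"
      unfolding S_def by (rule card_image)
    also have "\<dots> = (\<Sum>i<r. card (array_start n0 (V i)))"
      by (subst card_SigmaI) (auto simp: array_start_def)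
    also have "\<dots> = (\<Sum>i<r. l0)"
    proof (rule sum.cong)
      fix i assume "i \<in> {..<r}"
      then have "V i \<in> seam_arrays n0 k l0 M \<sigma>" using V by (auto simp: block_def)
      then interpret b: slot_array n0 k l0 M "V i" by (rule array(1))
      show "card (array_start n0 (V i)) = l0" by (rule b.card_start)
    qed simp
    finally show ?thesis by simp
  qed
  moreover have "card T = d"
    unfolding T_def using filler_descents by (subst card_image) auto
  moreover have "S \<inter> T = {}"
  proof -
    have "h < r * n0" if h: "h \<in> S" for h
    proof -
      obtain i g where ig: "i < r" "g < n0" "h = i * n0 + g" using h start_n0 by (auto simp: S_def)
      then have "h < Suc i * n0" by simp
      also have "\<dots> \<le> r * n0" using ig(1) by (intro mult_le_mono1) simp
      finally show ?thesis .
    qed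
    then show ?thesis by (auto simp: T_def)
  qed
  moreover have "finite S" "finite T"
    by (auto simp: S_def T_def array_start_def)
  ultimately show ?thesis
    by (simp add: array_occupation_eq card_Un_disjoint)
qed

lemma inj_glue: "inj_on glue {V. block V}"
proof (rule inj_onI)
  fix V W assume V: "V \<in> {V. block V}" and W: "W \<in> {V. block V}" and eq: "glue V = glue W"
  have "V i = W i" if i: "i < r" for i
  proof -
    have arr: "V i \<in> slot_arrays n0 k l0 M" "W i \<in> slot_arrays n0 k l0 M"
      using V W i by (auto simp: block_def seam_arrays_def)
    have "V i (g, j) = W i (g, j)" if "g < n0" "j \<in> {1..k}" for g j
    proof -
      have "i * n0 + g < Suc i * n0" using that by simp
      also have "\<dots> \<le> r * n0" using i by (intro mult_le_mono1) simp
      finally have "i * n0 + g < r * n0" .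
      then show ?thesis
        using glue_block[of "i * n0 + g" j V] glue_block[of "i * n0 + g" j W] that eq by simp
    qed
    then show ?thesis
      using arr by (intro PiE_ext[of "V i" "{..<n0} \<times> {1..k}" "\<lambda>_. {..<M}"]) (auto simp: slot_arrays_def)
  qed
  then show "V = W" using V W by (intro PiE_ext[of V "{..<r}"]) (auto simp: block_def)
qed

lemma bead_volume_glue:
  "real (card (seam_arrays n0 k l0 M \<sigma>)) ^ r / real M' ^ (n * k) \<le> bead_volume n k (r * l0 + d)"
proof -
  have "finite (seam_arrays n0 k l0 M \<sigma>)" by (simp add: seam_arrays_def)
  then have fin: "finite {V. block V}" and card: "card {V. block V} = card (seam_arrays n0 k l0 M \<sigma>) ^ r"
    unfolding block_def Collect_mem_eq by (auto intro: finite_PiE simp: card_funcsetE)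
  have "M > 0" using seam_bound[of 1] k by simp
  then have "M' > 0" by (simp add: M'_def)
  then have "real (card (glue ` {V. block V})) / real M' ^ (n * k) \<le> bead_volume n k (r * l0 + d)"
    using fin glue_range glue_separated glue_bead_like glue_occupation
    by (intro bead_volume_lower[OF n_ge k]) auto
  then show ?thesis by (simp add: card_image[OF inj_glue] card)
qed

end

section \<open>Asymptotics\<close>

lemma top_eigenvalue_pos:
  assumes "0 < l" "l < n"
  shows "top_eigenvalue n l > 0"
  using sin_pi_frac_pos[of l n] sin_pi_frac_pos[of 1 n] assms by (simp add: top_eigenvalue_def)

text \<open>Refine the slots with n and k fixed: (M choose N) / M ^ N \<le> 1 / N! for every M, and
  the proportion \<open>e M\<close> of assignments with coinciding slots tends to 0.\<close>

lemma bead_volume_le: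
  assumes n: "n \<ge> 2" and k: "k \<ge> 1" and l: "0 < l" "l < n"
  shows "bead_volume n k l \<le> real (n choose l) * top_eigenvalue n l ^ (n * k) / fact (n * k)"
proof -
  define N where "N = n * k"
  define B where "B = real (n choose l) * top_eigenvalue n l ^ N / fact N"
  define e where "e M = 1 - (\<Prod>i<N. (real M - real i) / real M)" for M :: nat
  have "(\<lambda>M. (real M - real i) / real M) \<longlonglongrightarrow> 1" for i :: nat
    by real_asymp
  then have "(\<lambda>M. \<Prod>i<N. (real M - real i) / real M) \<longlonglongrightarrow> (\<Prod>i<N. 1)"
    by (intro tendsto_prod) auto
  then have "e \<longlonglongrightarrow> 1 - 1"
    unfolding e_def by (intro tendsto_diff tendsto_const) simp
  then have lim: "(\<lambda>M. B + e M) \<longlonglongrightarrow> B + 0"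
    by (intro tendsto_add tendsto_const) simp
  have "bead_volume n k l \<le> B + e M" if "M \<ge> N" for M
  proof -
    have N: "N > 0" using n k by (simp add: N_def)
    then have M: "M > 0" using that by simp
    have "bead_volume n k l \<le> real (card (slot_arrays n k l M)) / real M ^ N
        + (1 - (\<Prod>i<N. real M - real i) / real M ^ N)"
      using bead_volume_upper[OF n k M] that by (simp add: N_def)
    also have "(\<Prod>i<N. real M - real i) / real M ^ N = (\<Prod>i<N. (real M - real i) / real M)"
      by (simp add: prod_dividef)
    also have "real (card (slot_arrays n k l M)) / real M ^ N
        \<le> (real (n choose l) * (real (M choose N) * top_eigenvalue n l ^ N)) / real M ^ N"
      using card_slot_arrays_le[OF n k, of l M] by (intro divide_right_mono) (simp_all add: N_def)
    also have "\<dots> = real (n choose l) * top_eigenvalue n l ^ N * (real (M choose N) / real M ^ N)"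
      by simp
    also have "\<dots> \<le> real (n choose l) * top_eigenvalue n l ^ N * (1 / fact N)"
    proof (rule mult_left_mono)
      have "real ((M choose N) * fact N) \<le> real (M ^ N)"
        using binomial_fact_pow[of M N] by (simp only: of_nat_le_iff)
      then have "real (M choose N) * fact N \<le> real M ^ N" by simp
      then show "real (M choose N) / real M ^ N \<le> 1 / fact N"
        using M by (simp add: field_simps)
      show "0 \<le> real (n choose l) * top_eigenvalue n l ^ N"
        using top_eigenvalue_pos[OF l] by simp
    qed
    finally show ?thesis by (simp add: B_def e_def)
  qed
  then have "bead_volume n k l \<le> B + 0"
    by (intro LIMSEQ_le_const[OF lim]) blast
  then show ?thesis by (simp add: B_def N_def)
qed

section \<open>Stirling bounds for factorials and binomial coefficients\<close>

lemma ln_fact_ge: "N \<ge> 1 \<Longrightarrow> ln (fact N) \<ge> real N * ln (real N) - real N"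
proof (induction N rule: dec_induct)
  case (step N)
  then have N: "real N > 0" by simp
  have "ln (1 + 1 / real N) \<le> 1 / real N" using N by (intro ln_add_one_self_le_self) simp
  moreover have "1 + 1 / real N = real (Suc N) / real N" using N by (simp add: field_simps)
  ultimately have "ln (real (Suc N)) - ln (real N) \<le> 1 / real N" using N by (simp add: ln_div)
  then have "real N * (ln (real (Suc N)) - ln (real N)) \<le> 1"
    using N by (simp add: field_simps)
  moreover have "ln (fact (Suc N) :: real) = ln (real (Suc N)) + ln (fact N)"
    by (simp add: ln_mult del: of_nat_Suc)
  ultimately show ?case using step.IH by (simp add: algebra_simps)
qed simp

lemma ln_fact_le: "N \<ge> 1 \<Longrightarrow> ln (fact N) \<le> real N * ln (real N) - real N + ln (real N) + 1"
proof (induction N rule: dec_induct)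
  case (step N)
  then have N: "real N > 0" by simp
  have "ln (real N / real (Suc N)) \<le> real N / real (Suc N) - 1" using N by (intro ln_le_minus_one) simp
  moreover have "real N / real (Suc N) - 1 = - 1 / real (Suc N)" by (simp add: field_simps)
  ultimately have "ln (real N) - ln (real (Suc N)) \<le> - 1 / real (Suc N)" using N by (simp add: ln_div del: of_nat_Suc)
  then have "real (Suc N) * (ln (real N) - ln (real (Suc N))) \<le> - 1"
    using N by (simp add: field_simps del: of_nat_Suc)
  moreover have fact: "ln (fact (Suc N) :: real) = ln (real (Suc N)) + ln (fact N)"
    by (simp add: ln_mult del: of_nat_Suc)
  ultimately show ?case using step.IH unfolding fact by (simp add: algebra_simps)
qed simp

lemma binomial_mult_fact_ge:
  assumes "j \<le> m"
  shows "real (m - j) ^ j \<le> real (m choose j) * fact j"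
proof -
  have "real (m choose j) * fact j = (\<Prod>i<j. real (m - i))"
  proof -
    have "real (m choose j) = (\<Prod>i<j. real (m - i) / real (j - i))"
      using binomial_altdef_of_nat[OF assms, where ?'a = real] by (simp add: atLeast0LessThan)
    also have "\<dots> = (\<Prod>i<j. real (m - i)) / (\<Prod>i<j. real (j - i))"
      by (rule prod_dividef)
    also have "(\<Prod>i<j. real (j - i)) = fact j"
      by (simp add: fact_prod_rev atLeast0LessThan)
    finally show ?thesis by simp
  qed
  also have "\<dots> \<ge> (\<Prod>i<j. real (m - j))"
    by (intro prod_mono) auto
  finally show ?thesis by simp
qed

lemma ln_binomial_ge:
  assumes "j \<ge> 1" "j < m"
  shows "ln (real (m choose j)) \<ge> real j * (ln (real (m - j)) - ln (real j) + 1) - ln (real j) - 1"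
proof -
  have "real (m - j) ^ j > 0" using assms by simp
  then have "ln (real (m - j) ^ j) \<le> ln (real (m choose j) * fact j)"
    using binomial_mult_fact_ge[of j m] assms by (intro ln_mono) (auto intro: less_le_trans)
  also have "\<dots> = ln (real (m choose j)) + ln (fact j)"
    using assms by (simp add: ln_mult)
  finally have "real j * ln (real (m - j)) \<le> ln (real (m choose j)) + ln (fact j)"
    using assms by (simp add: ln_realpow)
  then show ?thesis using ln_fact_le[OF assms(1)] by (simp add: algebra_simps)
qed

lemma ln_binomial_le:
  assumes "k \<ge> 1" "k \<le> m"
  shows "ln (real (m choose k)) \<le> real k * (ln (real m) - ln (real k) + 1)"
proof -
  have "real ((m choose k) * fact k) \<le> real (m ^ k)"
    using binomial_fact_pow[of m k] by (simp only: of_nat_le_iff)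
  then have "ln (real (m choose k) * fact k) \<le> ln (real m ^ k)"
    using assms by (intro ln_mono) simp_all
  then have "ln (real (m choose k)) + ln (fact k) \<le> real k * ln (real m)"
    using assms by (simp add: ln_mult ln_realpow)
  then show ?thesis using ln_fact_ge[OF assms(1)] by (simp add: algebra_simps)
qed

section \<open>Limits involving integer parts\<close>

lemma nat_floor_bounds:
  assumes "x \<ge> 0"
  shows "real (nat \<lfloor>x\<rfloor>) \<le> x" "x < real (nat \<lfloor>x\<rfloor>) + 1"
  using assms by (simp_all add: of_nat_nat)

lemma tendsto_nat_floor_ratio:
  assumes "\<tau> \<ge> 0"
  shows "(\<lambda>n. real (nat \<lfloor>\<tau> * real n\<rfloor>) / real n) \<longlonglongrightarrow> \<tau>"
proof (rule tendsto_sandwich)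
  show "\<forall>\<^sub>F n in sequentially. \<tau> - 1 / real n \<le> real (nat \<lfloor>\<tau> * real n\<rfloor>) / real n"
  proof (rule eventually_sequentiallyI[of 1])
    fix n :: nat assume "n \<ge> 1"
    then have "\<tau> - 1 / real n = (\<tau> * real n - 1) / real n" by (simp add: field_simps)
    also have "\<dots> \<le> real (nat \<lfloor>\<tau> * real n\<rfloor>) / real n"
      using nat_floor_bounds(2)[of "\<tau> * real n"] assms by (intro divide_right_mono) simp_all
    finally show "\<tau> - 1 / real n \<le> real (nat \<lfloor>\<tau> * real n\<rfloor>) / real n" .
  qed
  show "\<forall>\<^sub>F n in sequentially. real (nat \<lfloor>\<tau> * real n\<rfloor>) / real n \<le> \<tau>"
  proof (rule eventually_sequentiallyI[of 1])
    fix n :: nat assume "n \<ge> 1"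
    then show "real (nat \<lfloor>\<tau> * real n\<rfloor>) / real n \<le> \<tau>"
      using nat_floor_bounds(1)[of "\<tau> * real n"] assms by (simp add: pos_divide_le_eq del: of_nat_nat)
  qed
  show "(\<lambda>n. \<tau> - 1 / real n) \<longlonglongrightarrow> \<tau>" by real_asymp
qed simp

lemma top_eigenvalue_limit:
  assumes "0 \<le> \<tau>" and sin: "sin (pi * \<tau>) > 0"
  shows "(\<lambda>n. ln (top_eigenvalue n (nat \<lfloor>\<tau> * real n\<rfloor>) / real n)) \<longlonglongrightarrow> ln (sin (pi * \<tau>) / pi)"
proof (rule tendsto_ln)
  have "(\<lambda>n. sin (pi * (real (nat \<lfloor>\<tau> * real n\<rfloor>) / real n)) * (1 / (real n * sin (pi / real n))))
      \<longlonglongrightarrow> sin (pi * \<tau>) * (1 / pi)"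
  proof (intro tendsto_mult tendsto_sin tendsto_const tendsto_nat_floor_ratio assms)
    show "(\<lambda>n. 1 / (real n * sin (pi / real n))) \<longlonglongrightarrow> 1 / pi" by (real_asymp, simp add: inverse_eq_divide)
  qed
  then show "(\<lambda>n. top_eigenvalue n (nat \<lfloor>\<tau> * real n\<rfloor>) / real n) \<longlonglongrightarrow> sin (pi * \<tau>) / pi"
    by (simp add: top_eigenvalue_def field_simps)
  show "sin (pi * \<tau>) / pi \<noteq> 0" using sin by simp
qed

text \<open>The bracket bounds from below the logarithm of the number of blocks with the best seam:
  it comes from closed words on n0^2 * k slots, less k * (1 + 2 * ln n0) for fixing the seam. The
  factor r arises because the blocks are chosen independently. The last term is the logarithm of the
  volume of one box, with M' = (n0^2 + R - 1) * k slots.\<close>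

lemma ln_bead_volume_ge:
  fixes n0 l0 k D R r s d :: nat and \<delta> :: real
  assumes n0: "n0 \<ge> 2" and l0: "0 < l0" "l0 < n0" and k: "k \<ge> 1" and D: "D < n0 * k" and \<delta>: "\<delta> > 0"
    and words: "\<And>M. n0 * k \<le> M \<Longrightarrow>
      \<delta> * real ((M - D) choose (n0 * k - D)) * top_eigenvalue n0 l0 ^ (n0 * k - D)
        \<le> real (card {v \<in> words n0 M (n0 * k) {..<l0}. final n0 {..<l0} v = {..<l0}})"
    and r: "r \<ge> 1" and d: "0 < d" "d < s" "s \<le> R * d" "s \<le> R * (s - d)"
  defines "n \<equiv> r * n0 + s" and "l \<equiv> r * l0 + d"
  shows "bead_volume n k l > 0"
    and "real r * (ln \<delta> + (real (n0 * k) - real D) * (ln (real n0 - 1) + 1 + ln (top_eigenvalue n0 l0))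
        - ln (real (n0 * k)) - 1 - real k * (1 + 2 * ln (real n0)))
      - real (n * k) * ln ((real n0 ^ 2 + real R - 1) * real k) \<le> ln (bead_volume n k l)"
proof -
  define M where "M = n0 ^ 2 * k"
  define N where "N = n0 * k"
  define j where "j = N - D"
  define \<rho> where "\<rho> = top_eigenvalue n0 l0"
  have \<rho>: "\<rho> > 0" using top_eigenvalue_pos[OF l0] by (simp add: \<rho>_def)
  have j: "j \<ge> 1" "j \<le> N" "real j = real N - real D" using D by (simp_all add: j_def N_def of_nat_diff)
  have MN: "M = N + n0 * (n0 - 1) * k"
    using n0 by (cases n0) (simp_all add: M_def N_def power2_eq_square algebra_simps)
  have pos: "n0 * (n0 - 1) * k > 0" using n0 k by simp
  \<comment> \<open>Removing the return word removes as many slots as beads, so the number of empty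
    slots stays n0 - 1 per bead of the whole block; this is the origin of ln (n0 - 1).\<close>
  have mj: "M - D - j = n0 * (n0 - 1) * k" using MN D by (simp add: j_def N_def)
  have jm: "j < M - D" using pos unfolding mj[symmetric] by (simp only: zero_less_diff)
  have ln_choose: "ln (real ((M - D) choose j)) \<ge> real j * (ln (real n0 - 1) + 1) - ln (real N) - 1"
  proof -
    have lnN: "ln (real j) \<le> ln (real N)" using j by simp
    have "ln (real (M - D - j)) = ln (real n0 - 1) + ln (real N)"
    proof -
      have "real (M - D - j) = (real n0 - 1) * real N"
        unfolding mj using n0 by (simp add: N_def of_nat_diff)
      moreover have "real N > 0" "real n0 - 1 > 0" using n0 k by (simp_all add: N_def)
      ultimately show ?thesis by (simp add: ln_mult)
    qed
    then have "real j * (ln (real n0 - 1) + 1) \<le> real j * (ln (real (M - D - j)) - ln (real j) + 1)"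
      using lnN by (intro mult_left_mono) auto
    then show ?thesis using ln_binomial_ge[OF j(1) jm] lnN by linarith
  qed
  define A where "A = card (slot_arrays n0 k l0 M)"
  define W where "W = \<delta> * real ((M - D) choose j) * \<rho> ^ j"
  have choose_pos: "real ((M - D) choose j) > 0" using jm by simp
  have W_pos: "W > 0" using \<delta> \<rho> choose_pos by (simp add: W_def)
  have "W \<le> real (card {v \<in> words n0 M (n0 * k) {..<l0}. final n0 {..<l0} v = {..<l0}})"
    using words[of M] MN by (simp add: W_def j_def N_def \<rho>_def)
  also have "\<dots> \<le> real A"
    unfolding A_def using card_slot_arrays_ge[of "{..<l0}" n0 l0 k M] l0 n0 k by simp
  finally have WA: "W \<le> real A" .
  then have "slot_arrays n0 k l0 M \<noteq> {}" using W_pos by (auto simp: A_def)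
  then obtain \<sigma> where ne: "seam_arrays n0 k l0 M \<sigma> \<noteq> {}"
    and A_le: "A \<le> (M choose k) * card (seam_arrays n0 k l0 M \<sigma>)"
    using seam_pigeonhole[OF n0 k] unfolding A_def by blast
  interpret g: gluing n0 k l0 M R r s d \<sigma>
    by unfold_locales (use n0 k r d ne in auto)
  define a where "a = real (card (seam_arrays n0 k l0 M \<sigma>))"
  have "finite (seam_arrays n0 k l0 M \<sigma>)" by (simp add: seam_arrays_def)
  then have a: "a > 0" using ne by (simp add: a_def card_gt_0_iff)
  have kM: "k \<le> M" using n0 by (simp add: M_def)
  have chooseM: "real (M choose k) > 0" using kM by simp
  have "real A \<le> real (M choose k) * a"
    using A_le unfolding a_def by (metis of_nat_le_iff of_nat_mult)
  with WA have "W \<le> real (M choose k) * a" by simp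
  then have "ln W \<le> ln (real (M choose k)) + ln a"
    using W_pos a chooseM ln_mono[of W "real (M choose k) * a"] by (simp add: ln_mult)
  moreover have "ln W = ln \<delta> + ln (real ((M - D) choose j)) + real j * ln \<rho>"
    using \<delta> \<rho> choose_pos by (simp add: W_def ln_mult ln_realpow)
  moreover have "ln (real (M choose k)) \<le> real k * (1 + 2 * ln (real n0))"
  proof -
    have "ln (real M) = 2 * ln (real n0) + ln (real k)"
      using n0 k by (simp add: M_def ln_mult ln_realpow)
    then show ?thesis using ln_binomial_le[OF k kM] by (simp add: algebra_simps)
  qed
  ultimately have ln_a: "ln a \<ge> ln \<delta> + real j * (ln (real n0 - 1) + 1 + ln \<rho>) - ln (real N) - 1
      - real k * (1 + 2 * ln (real n0))"
    using ln_choose by (simp add: algebra_simps)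
  define M' where "M' = g.M'"
  have R: "R \<ge> 1" using g.R_pos by simp
  have M'_eq: "M' = M + (R - 1) * k" unfolding M'_def by (rule g.M'_def)
  have M': "real M' = (real n0 ^ 2 + real R - 1) * real k"
  proof -
    have R': "real (R - 1) = real R - 1" using R by (simp add: of_nat_diff)
    show ?thesis unfolding M'_eq of_nat_add of_nat_mult R' by (simp add: M_def algebra_simps)
  qed
  have "M' > 0" using kM k by (simp add: M'_eq)
  have n_eq: "g.n = n" by (simp add: g.n_def n_def)
  have vol: "a ^ r / real M' ^ (n * k) \<le> bead_volume n k l"
    using g.bead_volume_glue by (simp add: a_def M'_def n_eq l_def)
  have lhs_pos: "a ^ r / real M' ^ (n * k) > 0" using a \<open>M' > 0\<close> by simp
  with vol show "bead_volume n k l > 0" by linarith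
  have "real r * ln a - real (n * k) * ln (real M') = ln (a ^ r / real M' ^ (n * k))"
    using a \<open>M' > 0\<close> by (simp add: ln_div ln_realpow)
  also have "\<dots> \<le> ln (bead_volume n k l)"
    using lhs_pos vol by (intro ln_mono) simp_all
  finally have "real r * ln a - real (n * k) * ln (real M') \<le> ln (bead_volume n k l)" .
  moreover have "real r * (ln \<delta> + real j * (ln (real n0 - 1) + 1 + ln \<rho>) - ln (real N) - 1
      - real k * (1 + 2 * ln (real n0))) \<le> real r * ln a"
    using ln_a by (intro mult_left_mono) simp_all
  ultimately show "real r * (ln \<delta> + (real (n0 * k) - real D) * (ln (real n0 - 1) + 1 + ln (top_eigenvalue n0 l0))
        - ln (real (n0 * k)) - 1 - real k * (1 + 2 * ln (real n0)))
      - real (n * k) * ln ((real n0 ^ 2 + real R - 1) * real k) \<le> ln (bead_volume n k l)"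
    unfolding M' j(3) N_def \<rho>_def by linarith
qed

lemma filterlim_nat_floor:
  assumes "p > 0"
  shows "filterlim (\<lambda>n. real (nat \<lfloor>p * real n\<rfloor>)) at_top sequentially"
proof (rule filterlim_at_top_mono)
  show "filterlim (\<lambda>n. p * real n - 1) at_top sequentially" using assms by real_asymp
  show "\<forall>\<^sub>F n in sequentially. p * real n - 1 \<le> real (nat \<lfloor>p * real n\<rfloor>)"
  proof (rule always_eventually, rule allI)
    fix n :: nat
    show "p * real n - 1 \<le> real (nat \<lfloor>p * real n\<rfloor>)"
      using nat_floor_bounds(2)[of "p * real n"] assms by simp
  qed
qed

lemma div_ratio_limit:
  assumes "q > 0"
  shows "(\<lambda>n. real (n div q) / real n) \<longlonglongrightarrow> 1 / real q"
proof -
  have "nat \<lfloor>1 / real q * real n\<rfloor> = n div q" for n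
    using floor_divide_of_nat_eq[of n q, where ?'a = real] by simp
  then show ?thesis
    using tendsto_nat_floor_ratio[of "1 / real q"] by simp
qed

text \<open>The entropy per bead of a gluing of blocks of \<open>n0\<close> strings; \<open>R\<close> governs the share \<open>R / (n0 + R)\<close> of filler strings.\<close>

definition block_rate :: "nat \<Rightarrow> nat \<Rightarrow> nat \<Rightarrow> real" where
  "block_rate R n0 l0 = real n0 / (real n0 + real R) *
     (ln (real n0 - 1) + 1 + ln (top_eigenvalue n0 l0) - (1 + 2 * ln (real n0)) / real n0)
     - ln (real n0 ^ 2 + real R - 1)"

definition rate :: "(nat \<Rightarrow> nat) \<Rightarrow> (nat \<Rightarrow> nat) \<Rightarrow> nat \<Rightarrow> real" where
  "rate k l = (\<lambda>n. 1 / (real n * real (k n)) * ln (real (k n) ^ (n * k n) * bead_volume n (k n) (l n)))"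

context
  fixes p \<tau> :: real and k l :: "nat \<Rightarrow> nat"
  assumes p: "p > 0" and \<tau>: "0 < \<tau>" "\<tau> < 1"
    and k_def: "\<And>n. k n = nat \<lfloor>p * real n\<rfloor>" and l_def: "\<And>n. l n = nat \<lfloor>\<tau> * real n\<rfloor>"
begin

lemma l_bounds: "real (l n) \<le> \<tau> * real n" "\<tau> * real n < real (l n) + 1"
  using nat_floor_bounds[of "\<tau> * real n"] \<tau> by (simp_all add: l_def)

lemma k_at_top: "filterlim (\<lambda>n. real (k n)) at_top sequentially"
  unfolding k_def using p by (rule filterlim_nat_floor)

lemma k_eventually: "\<forall>\<^sub>F n in sequentially. real (k n) \<ge> x"
  using k_at_top by (simp add: filterlim_at_top)

lemma rate_eq:
  assumes "n \<ge> 1" "k n \<ge> 1" "bead_volume n (k n) (l n) > 0"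
  shows "rate k l n = ln (real (k n)) + ln (bead_volume n (k n) (l n)) / (real n * real (k n))"
proof -
  have "ln (real (k n) ^ (n * k n) * bead_volume n (k n) (l n))
      = real n * real (k n) * ln (real (k n)) + ln (bead_volume n (k n) (l n))"
    using assms by (simp add: ln_mult ln_realpow)
  then show ?thesis
    using assms unfolding rate_def by (simp add: field_simps)
qed

text \<open>Rounding \<open>l n0\<close> down loses less than one particle per block, so the filler
  strings must absorb up to r n extra particles: d n lies between \<tau> * s n - 1 and \<tau> * s n
  + r n. As s n \<ge> R * r n, the conditions on R keep d n / s n between \<tau> / 2 and (1 +
  \<tau>) / 2, and then also give s n \<le> R * d n and s n \<le> R * (s n - d n), as the staircase
  needs. They do not involve n0.\<close>

lemma rate_lower:
  fixes R n0 :: nat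
  assumes R: "2 \<le> real R * \<tau>" "2 \<le> real R * (1 - \<tau>)"
    and n0: "n0 \<ge> 2" and l0: "0 < l n0" "l n0 < n0"
  obtains b where "b \<longlonglongrightarrow> block_rate R n0 (l n0)"
    and "\<forall>\<^sub>F n in sequentially. bead_volume n (k n) (l n) > 0 \<and> b n \<le> rate k l n"
proof -
  obtain D \<delta> where \<delta>: "\<delta> > 0" and words: "\<forall>M k. D \<le> n0 * k \<longrightarrow> n0 * k \<le> M \<longrightarrow>
      \<delta> * real ((M - D) choose (n0 * k - D)) * top_eigenvalue n0 (l n0) ^ (n0 * k - D)
        \<le> real (card {v \<in> words n0 M (n0 * k) {..<l n0}. final n0 {..<l n0} v = {..<l n0}})"
    using card_closed_words_ge[OF l0 n0] by blast
  define \<beta> where "\<beta> = ln (real n0 - 1) + 1 + ln (top_eigenvalue n0 (l n0))"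
  define \<gamma> where "\<gamma> = 1 + 2 * ln (real n0)"
  \<comment> \<open>With x beads per string, \<open>G x\<close> is the guaranteed logarithm of the
    number of blocks, divided by the n0 * x beads of a block.\<close>
  define G where "G x = (ln \<delta> + (real n0 * x - real D) * \<beta> - ln (real n0 * x) - 1 - x * \<gamma>) / (real n0 * x)" for x
  define q where "q = n0 + R"
  define r where "r n = n div q" for n
  define s where "s n = n - r n * n0" for n
  define d where "d n = l n - r n * l n0" for n
  define b where "b n = real (r n) / real n * real n0 * G (real (k n)) - ln (real n0 ^ 2 + real R - 1)" for n
  have n0_pos: "real n0 > 0" using n0 by simp
  have "((\<lambda>x. (ln \<delta> - real D * \<beta> - 1) * (1 / (real n0 * x)) + \<beta> - ln (real n0 * x) / (real n0 * x) - \<gamma> / real n0)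
      \<longlongrightarrow> (ln \<delta> - real D * \<beta> - 1) * 0 + \<beta> - 0 - \<gamma> / real n0) at_top"
  proof (intro tendsto_add tendsto_diff tendsto_mult tendsto_const)
    show "((\<lambda>x. 1 / (real n0 * x)) \<longlongrightarrow> 0) at_top" using n0_pos by real_asymp
    show "((\<lambda>x. ln (real n0 * x) / (real n0 * x)) \<longlongrightarrow> 0) at_top" using n0_pos by real_asymp
  qed
  then have "((\<lambda>x. (ln \<delta> - real D * \<beta> - 1) * (1 / (real n0 * x)) + \<beta> - ln (real n0 * x) / (real n0 * x) - \<gamma> / real n0)
      \<longlongrightarrow> \<beta> - \<gamma> / real n0) at_top" by simp
  moreover have "\<forall>\<^sub>F x in at_top. (ln \<delta> - real D * \<beta> - 1) * (1 / (real n0 * x)) + \<beta>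
      - ln (real n0 * x) / (real n0 * x) - \<gamma> / real n0 = G x"
    using eventually_gt_at_top[of 0]
  proof eventually_elim
    case (elim x)
    have "\<beta> = real n0 * x * \<beta> / (real n0 * x)" "\<gamma> / real n0 = x * \<gamma> / (real n0 * x)"
      using elim n0_pos by simp_all
    then show ?case
      by (simp only: G_def diff_divide_distrib add_divide_distrib left_diff_distrib) (simp add: diff_divide_distrib add_divide_distrib)
  qed
  ultimately have "(G \<longlongrightarrow> \<beta> - \<gamma> / real n0) at_top" by (rule Lim_transform_eventually)
  then have "(\<lambda>n. G (real (k n))) \<longlonglongrightarrow> \<beta> - \<gamma> / real n0"
    using k_at_top by (rule filterlim_compose)
  moreover have "q > 0" using n0 by (simp add: q_def)
  ultimately have "b \<longlonglongrightarrow> 1 / real q * real n0 * (\<beta> - \<gamma> / real n0) - ln (real n0 ^ 2 + real R - 1)"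
    unfolding b_def r_def by (intro tendsto_diff tendsto_mult tendsto_const div_ratio_limit)
  then have lim: "b \<longlonglongrightarrow> block_rate R n0 (l n0)"
    by (simp add: block_rate_def q_def \<beta>_def \<gamma>_def)
  have ev_D: "\<forall>\<^sub>F n in sequentially. real (k n) \<ge> real D + 1" by (rule k_eventually)
  \<comment> \<open>At least K blocks ensure \<tau> * s n \<ge> 2, so that the rounding of
    \<open>l n\<close> costs at most half of \<tau> * s n.\<close>
  define K where "K = nat \<lceil>2 / \<tau>\<rceil> + 1"
  have "\<forall>\<^sub>F n in sequentially. n \<ge> q * K" by (rule eventually_ge_at_top)
  with ev_D have "\<forall>\<^sub>F n in sequentially. bead_volume n (k n) (l n) > 0 \<and> b n \<le> rate k l n"
  proof eventually_elim
    case (elim n)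
    have kD: "k n \<ge> D + 1" using elim(1) by linarith
    have "k n \<le> n0 * k n" using n0 by simp
    then have Dk: "D < n0 * k n" using kD by linarith
    have k1: "k n \<ge> 1" using kD by simp
    have rK: "r n \<ge> K"
      using div_le_mono[OF elim(2), of q] \<open>q > 0\<close> by (simp add: r_def)
    then have r1: "r n \<ge> 1" by (simp add: K_def)
    have rq: "r n * q \<le> n" by (simp add: r_def)
    then have "r n * n0 \<le> n" by (simp add: q_def distrib_left)
    then have n_eq: "r n * n0 + s n = n" by (simp add: s_def)
    have real_n: "real n = real (r n) * real n0 + real (s n)"
      using arg_cong[OF n_eq, of real] unfolding of_nat_add of_nat_mult by (rule sym)
    have "r n * R \<le> s n" using rq n_eq by (simp add: q_def distrib_left)
    then have sR: "real (r n) * real R \<le> real (s n)" by (metis of_nat_le_iff of_nat_mult)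
    have R1: "R \<ge> 1" using R(1) by (cases R) auto
    have "real (s n) \<ge> real (r n)"
      using mult_left_mono[of 1 "real R" "real (r n)"] R1 sR by simp
    moreover have "real K \<ge> 2 / \<tau>" unfolding K_def by linarith
    ultimately have "real (s n) \<ge> 2 / \<tau>" using rK by linarith
    then have s\<tau>: "\<tau> * real (s n) \<ge> 2" using \<tau> by (simp add: field_simps)
    have 1: "real (r n) * real (l n0) \<le> real (r n) * (\<tau> * real n0)"
      using l_bounds(1)[of n0] by (intro mult_left_mono) simp_all
    have 2: "real (r n) * (\<tau> * real n0) \<le> real (r n) * (real (l n0) + 1)"
      using l_bounds(2)[of n0] by (intro mult_left_mono) simp_all
    have \<tau>n: "\<tau> * real n = real (r n) * (\<tau> * real n0) + \<tau> * real (s n)"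
      by (subst real_n) (simp add: algebra_simps)
    have ge: "real (l n) - real (r n) * real (l n0) > \<tau> * real (s n) - 1"
      using 1 \<tau>n l_bounds(2)[of n] by linarith
    have le: "real (l n) - real (r n) * real (l n0) \<le> \<tau> * real (s n) + real (r n)"
      using 2 \<tau>n l_bounds(1)[of n] by (simp add: distrib_left)
    have "real (r n * l n0) \<le> real (l n)" using ge s\<tau> by simp
    then have l_eq: "r n * l n0 + d n = l n" by (simp only: of_nat_le_iff d_def le_add_diff_inverse)
    then have real_d: "real (d n) = real (l n) - real (r n) * real (l n0)"
      by (metis add_diff_cancel_left' of_nat_add of_nat_mult)
    have d_ge: "real (d n) \<ge> \<tau> * real (s n) / 2" using ge s\<tau> unfolding real_d by linarith
    have "real (r n) * 2 \<le> real (r n) * (real R * (1 - \<tau>))"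
      using R(2) by (intro mult_left_mono) simp_all
    also have "\<dots> \<le> real (s n) * (1 - \<tau>)"
      using mult_right_mono[OF sR, of "1 - \<tau>"] \<tau> by (simp add: mult.assoc)
    finally have "real (r n) \<le> real (s n) * (1 - \<tau>) / 2" by simp
    moreover have "real (s n) * (1 - \<tau>) / 2 = real (s n) / 2 - \<tau> * real (s n) / 2"
      by (simp add: algebra_simps diff_divide_distrib)
    ultimately have d_le: "real (s n) - real (d n) \<ge> real (s n) * (1 - \<tau>) / 2"
      using le unfolding real_d by linarith
    have s_pos: "real (s n) > 0" using s\<tau> by (cases "s n") simp_all
    have "real (d n) > 0" using d_ge s\<tau> by linarith
    then have d_pos: "0 < d n" by simp
    have "real (s n) * (1 - \<tau>) / 2 > 0" using s_pos \<tau> by simp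
    then have ds: "d n < s n" using d_le by linarith
    have "real (s n) \<le> real R * (\<tau> * real (s n) / 2)"
      using mult_right_mono[OF R(1), of "real (s n) / 2"] by (simp add: field_simps)
    also have "\<dots> \<le> real R * real (d n)" using d_ge by (intro mult_left_mono) simp_all
    finally have Rd: "s n \<le> R * d n" by (metis of_nat_le_iff of_nat_mult)
    have "real (s n) \<le> real R * (real (s n) * (1 - \<tau>) / 2)"
      using mult_right_mono[OF R(2), of "real (s n) / 2"] by (simp add: field_simps)
    also have "\<dots> \<le> real R * (real (s n) - real (d n))" using d_le by (intro mult_left_mono) simp_all
    also have "\<dots> = real (R * (s n - d n))" using ds by (simp add: of_nat_diff)
    finally have Rs: "s n \<le> R * (s n - d n)" by (simp only: of_nat_le_iff)
    have words_k: "\<delta> * real ((M - D) choose (n0 * k n - D)) * top_eigenvalue n0 (l n0) ^ (n0 * k n - D)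
        \<le> real (card {v \<in> words n0 M (n0 * k n) {..<l n0}. final n0 {..<l n0} v = {..<l n0}})"
      if "n0 * k n \<le> M" for M
      using words less_imp_le[OF Dk] that by blast
    note vol = ln_bead_volume_ge[OF n0 l0 k1 Dk \<delta> words_k r1 d_pos ds Rd Rs, unfolded n_eq l_eq]
    have n1: "n \<ge> 1" using n_eq r1 n0 by (cases n) auto
    have pos: "bead_volume n (k n) (l n) > 0" using vol(1) by simp
    define x where "x = real (k n)"
    have x: "x > 0" using k1 by (simp add: x_def)
    define Q where "Q = real n0 ^ 2 + real R - 1"
    have Q: "Q > 0"
    proof -
      have "1 \<le> real n0 ^ 2" using n0 by (intro one_le_power) simp
      then show ?thesis using R1 by (simp add: Q_def)
    qed
    have n_pos: "real n > 0" using n1 by simp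
    have "real (r n) * (real n0 * x * G x) - real n * x * ln (Q * x) \<le> ln (bead_volume n (k n) (l n))"
      using vol(2) n0_pos x by (simp add: G_def x_def \<beta>_def \<gamma>_def Q_def)
    then have "(real (r n) * (real n0 * x * G x) - real n * x * ln (Q * x)) / (real n * x)
        \<le> ln (bead_volume n (k n) (l n)) / (real n * x)"
      using n_pos x by (intro divide_right_mono) simp_all
    moreover have "(real (r n) * (real n0 * x * G x) - real n * x * ln (Q * x)) / (real n * x)
        = real (r n) / real n * real n0 * G x - ln (Q * x)"
      using n_pos x by (simp add: field_simps)
    moreover have "ln (Q * x) = ln Q + ln x" using Q x by (simp add: ln_mult)
    ultimately have "real (r n) / real n * real n0 * G x - ln Q
        \<le> ln x + ln (bead_volume n (k n) (l n)) / (real n * x)" by linarith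
    then have "b n \<le> rate k l n"
      using rate_eq[OF n1 k1 pos] by (simp add: b_def x_def Q_def)
    with pos show ?case by simp
  qed
  with lim show ?thesis by (rule that)
qed

section \<open>Matching bounds for the entropy per bead\<close>

lemma sin_pos: "sin (pi * \<tau>) > 0"
  using \<tau> by (intro sin_gt_zero) simp_all

lemma l_eventually: "\<forall>\<^sub>F n in sequentially. 0 < l n \<and> l n < n"
proof -
  have "\<forall>\<^sub>F n in sequentially. \<tau> * real n - 1 > 0" using \<tau>(1) by real_asymp
  moreover have "\<forall>\<^sub>F n in sequentially. n \<ge> (1 :: nat)" by (rule eventually_ge_at_top)
  ultimately show ?thesis
  proof eventually_elim
    case (elim n)
    then have "\<tau> * real n < 1 * real n" using \<tau> by (intro mult_strict_right_mono) simp_all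
    then have "real (l n) < real n" using l_bounds(1)[of n] by linarith
    moreover have "real (l n) > 0" using l_bounds(2)[of n] elim(1) by linarith
    ultimately show ?case by simp
  qed
qed

lemma top_eigenvalue_ratio_limit:
  "(\<lambda>n. ln (top_eigenvalue n (l n) / real n)) \<longlonglongrightarrow> ln (sin (pi * \<tau>) / pi)"
  unfolding l_def using top_eigenvalue_limit[OF _ sin_pos] \<tau> by simp

text \<open>Writing the eigenvalue as n times a convergent factor frees a term ln n, which together
  with ln (n - 1) cancels ln (n^2 + R - 1). Everything left over is collected in \<open>u\<close>;
  the share R / (n + R) of filler strings enters it only through terms of order ln n / n.\<close>

lemma block_rate_limit:
  assumes "R \<ge> 1"
  shows "(\<lambda>n. block_rate R n (l n)) \<longlonglongrightarrow> 1 + ln (sin (pi * \<tau>) / pi)"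
proof -
  define c where "c = real R"
  have c: "c > 0" using assms by (simp add: c_def)
  define u where "u n = real n / (real n + c) * (ln (real n - 1) + ln (real n) - (1 + 2 * ln (real n)) / real n)
      - ln (real n ^ 2 + c - 1)" for n :: nat
  have "u \<longlonglongrightarrow> 0" unfolding u_def using c by real_asymp
  moreover have "(\<lambda>n. real n / (real n + c)) \<longlonglongrightarrow> 1" using c by real_asymp
  ultimately have "(\<lambda>n. real n / (real n + c) * (1 + ln (top_eigenvalue n (l n) / real n)) + u n)
      \<longlonglongrightarrow> 1 * (1 + ln (sin (pi * \<tau>) / pi)) + 0"
    by (intro tendsto_add tendsto_mult tendsto_const top_eigenvalue_ratio_limit)
  then have lim: "(\<lambda>n. real n / (real n + c) * (1 + ln (top_eigenvalue n (l n) / real n)) + u n)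
      \<longlonglongrightarrow> 1 + ln (sin (pi * \<tau>) / pi)" by simp
  have "\<forall>\<^sub>F n in sequentially. real n / (real n + c) * (1 + ln (top_eigenvalue n (l n) / real n)) + u n
      = block_rate R n (l n)"
    using l_eventually
  proof eventually_elim
    case (elim n)
    then have "ln (top_eigenvalue n (l n) / real n) = ln (top_eigenvalue n (l n)) - ln (real n)"
      using top_eigenvalue_pos[of "l n" n] by (simp add: ln_div)
    note ln_eq = this
    have alg: "F * (1 + (b - z)) + (F * (a + z - x) - y) = F * (a + 1 + b - x) - y" for F a b x y z :: real
      by (simp add: algebra_simps)
    show ?case unfolding block_rate_def u_def c_def ln_eq by (rule alg)
  qed
  with lim show ?thesis by (rule Lim_transform_eventually)
qed

text \<open>Stirling's bound for N! with N = n * k contributes 1 - ln n - ln k per bead: ln k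
  cancels the normalising power in \<open>rate\<close>, and ln n normalises the eigenvalue.\<close>

lemma rate_upper:
  assumes n: "n \<ge> 2" and k: "k n \<ge> 1" and l: "0 < l n" "l n < n" and pos: "bead_volume n (k n) (l n) > 0"
  shows "rate k l n \<le> ln 2 / real (k n) + 1 + ln (top_eigenvalue n (l n) / real n)"
proof -
  define N where "N = n * k n"
  define \<rho> where "\<rho> = top_eigenvalue n (l n)"
  have \<rho>: "\<rho> > 0" using top_eigenvalue_pos[OF l] by (simp add: \<rho>_def)
  have N: "N \<ge> 1" using n k by (simp add: N_def)
  have cpos: "real (n choose l n) > 0" using l by simp
  have "ln (bead_volume n (k n) (l n)) \<le> ln (real (n choose l n) * \<rho> ^ N / fact N)"
    using bead_volume_le[OF n k l] pos by (intro ln_mono) (simp_all add: N_def \<rho>_def)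
  also have "\<dots> = ln (real (n choose l n)) + real N * ln \<rho> - ln (fact N)"
    using \<rho> cpos by (simp add: ln_mult ln_div ln_realpow)
  also have "ln (real (n choose l n)) \<le> real n * ln 2"
  proof -
    have "(n choose l n) \<le> 2 ^ n" using l by (simp add: binomial_le_pow2)
    then have "real (n choose l n) \<le> 2 ^ n" by (metis of_nat_le_iff of_nat_numeral of_nat_power)
    then have "ln (real (n choose l n)) \<le> ln (2 ^ n)" using cpos by (intro ln_mono) simp_all
    then show ?thesis by (simp add: ln_realpow)
  qed
  finally have "ln (bead_volume n (k n) (l n)) \<le> real n * ln 2 + real N * ln \<rho> - (real N * ln (real N) - real N)"
    using ln_fact_ge[OF N] by linarith
  then have "ln (bead_volume n (k n) (l n)) / real N
      \<le> (real n * ln 2 + real N * ln \<rho> - (real N * ln (real N) - real N)) / real N"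
    by (intro divide_right_mono) simp_all
  also have "\<dots> = ln 2 / real (k n) + ln \<rho> - ln (real N) + 1"
    using n k by (simp add: N_def field_simps)
  also have "ln (real N) = ln (real n) + ln (real (k n))"
    using n k by (simp add: N_def ln_mult)
  finally have "ln (bead_volume n (k n) (l n)) / real N
      \<le> ln 2 / real (k n) + ln \<rho> - ln (real n) - ln (real (k n)) + 1" by simp
  moreover have "ln (\<rho> / real n) = ln \<rho> - ln (real n)" using \<rho> n by (simp add: ln_div)
  ultimately show ?thesis
    using rate_eq[OF _ k pos] n by (simp add: N_def \<rho>_def)
qed

text \<open>The order of limits matters: given x below the limit, n0 is fixed with
  \<open>block_rate\<close> above x, and only then n tends to infinity. This is possible because
  \<open>R\<close> depends on \<tau> alone.\<close>

lemma rate_limit: "rate k l \<longlonglongrightarrow> 1 + ln (sin (pi * \<tau>) / pi)"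
proof -
  define L where "L = 1 + ln (sin (pi * \<tau>) / pi)"
  define R where "R = nat \<lceil>2 / \<tau>\<rceil> + nat \<lceil>2 / (1 - \<tau>)\<rceil> + 1"
  have "real R \<ge> 2 / \<tau>" "real R \<ge> 2 / (1 - \<tau>)"
    using real_nat_ceiling_ge[of "2 / \<tau>"] real_nat_ceiling_ge[of "2 / (1 - \<tau>)"]
    unfolding R_def of_nat_add by linarith+
  then have R: "2 \<le> real R * \<tau>" "2 \<le> real R * (1 - \<tau>)" using \<tau> by (simp_all add: field_simps)
  have R1: "R \<ge> 1" by (simp add: R_def)
  have good: "\<forall>\<^sub>F n in sequentially. n \<ge> 2 \<and> 0 < l n \<and> l n < n"
    using l_eventually eventually_ge_at_top[of "2 :: nat"] by eventually_elim simp
  have lower: "\<forall>\<^sub>F n in sequentially. bead_volume n (k n) (l n) > 0 \<and> x < rate k l n" if x: "x < L" for x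
  proof -
    have "\<forall>\<^sub>F n in sequentially. x < block_rate R n (l n)"
      using order_tendstoD(1)[OF block_rate_limit[OF R1]] x by (simp add: L_def)
    then have "\<forall>\<^sub>F n in sequentially. x < block_rate R n (l n) \<and> n \<ge> 2 \<and> 0 < l n \<and> l n < n"
      using good by (rule eventually_conj)
    then obtain n0 where n0: "x < block_rate R n0 (l n0)" "n0 \<ge> 2" "0 < l n0" "l n0 < n0"
      using eventually_happens'[OF sequentially_bot] by blast
    obtain b where b: "b \<longlonglongrightarrow> block_rate R n0 (l n0)"
      "\<forall>\<^sub>F n in sequentially. bead_volume n (k n) (l n) > 0 \<and> b n \<le> rate k l n"
      using rate_lower[OF R n0(2-4)] by blast
    have "\<forall>\<^sub>F n in sequentially. x < b n" using order_tendstoD(1)[OF b(1) n0(1)] .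
    with b(2) show ?thesis by eventually_elim auto
  qed
  have "(\<lambda>n. ln 2 / real (k n)) \<longlonglongrightarrow> 0"
    using k_at_top by (intro tendsto_divide_0[OF tendsto_const] filterlim_at_top_imp_at_infinity)
  then have "(\<lambda>n. ln 2 / real (k n) + 1 + ln (top_eigenvalue n (l n) / real n)) \<longlonglongrightarrow> 0 + 1 + ln (sin (pi * \<tau>) / pi)"
    by (intro tendsto_add tendsto_const top_eigenvalue_ratio_limit)
  then have upper_lim: "(\<lambda>n. ln 2 / real (k n) + 1 + ln (top_eigenvalue n (l n) / real n)) \<longlonglongrightarrow> L"
    by (simp add: L_def)
  have "rate k l \<longlonglongrightarrow> L"
  proof (rule order_tendstoI)
    fix x assume "x < L"
    from lower[OF this] show "\<forall>\<^sub>F n in sequentially. x < rate k l n" by eventually_elim simp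
  next
    fix x assume "L < x"
    then have "\<forall>\<^sub>F n in sequentially. ln 2 / real (k n) + 1 + ln (top_eigenvalue n (l n) / real n) < x"
      using order_tendstoD(2)[OF upper_lim] by blast
    \<comment> \<open>\<open>rate_upper\<close> takes logarithms of the volume; its positivity is
      supplied by the lower bound.\<close>
    moreover have "\<forall>\<^sub>F n in sequentially. bead_volume n (k n) (l n) > 0 \<and> L - 1 < rate k l n"
      by (rule lower) simp
    ultimately show "\<forall>\<^sub>F n in sequentially. rate k l n < x"
      using good k_eventually[of 1]
    proof eventually_elim
      case (elim n)
      then show ?case using rate_upper[of n] by simp
    qed
  qed
  then show ?thesis by (simp add: L_def)
qed

end

theorem corollary1p5:
  fixes p \<tau> :: real
  assumes "p > 0" and "0 < \<tau>" and "\<tau> < 1"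
  shows "(\<lambda>n::nat.
           let k = nat \<lfloor>p * real n\<rfloor>; l = nat \<lfloor>\<tau> * real n\<rfloor>
           in 1 / (real n * real k) * ln (real k ^ (n * k) * bead_volume n k l))
         \<longlonglongrightarrow> 1 + ln (sin (pi * \<tau>)) - ln pi"
proof -
  have "rate (\<lambda>n. nat \<lfloor>p * real n\<rfloor>) (\<lambda>n. nat \<lfloor>\<tau> * real n\<rfloor>)
      \<longlonglongrightarrow> 1 + ln (sin (pi * \<tau>) / pi)"
    using assms by (intro rate_limit) simp_all
  also have "1 + ln (sin (pi * \<tau>) / pi) = 1 + ln (sin (pi * \<tau>)) - ln pi"
    using assms sin_gt_zero[of "pi * \<tau>"] by (simp add: ln_div)
  finally show ?thesis unfolding rate_def Let_def .
qed

end
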